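(* Let $r\ge 2$ and $d\ge 1$ be integers, let $N:=\binom{r+d}{r}-1$, and let $t$ be a positive integer with $t<3d/2$. Let $P\in\mathbb{P}^N$ be a point with symmetric tensor rank $sr(P)=t$, and assume that the symmetric rank of $P$ is computed by at least two different sets $A,B\subset\mathbb{P}^r$, i.e. there exist $A,B\in\mathcal{S}(P)$ with $A\neq B$. Then $sr(P)$ is computed by an infinite family of subsets of $\mathbb{P}^r$, i.e. $\mathcal{S}(P)$ is infinite, and this family $\mathcal{S}(P)$ has no isolated points.
   Context: Work over an algebraically closed field $\mathbb{K}$ of characteristic $0$. Let $\nu_d:\mathbb{P}^r\to\mathbb{P}^N$, $N=\binom{r+d}{r}-1$, be the degree $d$ Veronese embedding, and let $X_{r,d}:=\nu_d(\mathbb{P}^r)$. The symbol $\langle\ \rangle$ denotes linear span in projective space. For $P\in\mathbb{P}^N$, the symmetric (tensor) rank $sr(P)$ is the minimal cardinality of a finite set $S\subset X_{r,d}$ such that $P\in\langle S\rangle$. The set $\mathcal{S}(P)$ is the set of all finite subsets $A\subset\mathbb{P}^r$ such that $\nu_d(A)$ computes $sr(P)$, i.e. $P\in\langle\nu_d(A)\rangle$ and $\sharp(A)=sr(P)$. For an integer $k>0$, let $\mathrm{Hilb}^k(\mathbb{P}^r)^0$ denote the smooth quasi-projective variety (of dimension $rk$) parametrizing the finite reduced subsets of $\mathbb{P}^r$ of cardinality $k$. The set $\mathcal{S}(P)$ is a constructible subset of $\mathrm{Hilb}^{sr(P)}(\mathbb{P}^r)^0$. An element $Z\in\mathcal{S}(P)$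 is an isolated point of $\mathcal{S}(P)$ if $\{Z\}$ is an irreducible component of the (Zariski) closure of $\mathcal{S}(P)$. *)

theory Defs
  imports
    "HOL-Analysis.Analysis"
    "HOL-Library.Function_Algebras"
    "HOL-Library.Poly_Mapping"
    "HOL-Computational_Algebra.Polynomial"
begin

definition fscale :: "'a::field \<Rightarrow> ('i \<Rightarrow> 'a) \<Rightarrow> 'i \<Rightarrow> 'a" where
  "fscale c v = (\<lambda>i. c * v i)"

global_interpretation funvec: vector_space "fscale :: 'a::field \<Rightarrow> ('i \<Rightarrow> 'a) \<Rightarrow> 'i \<Rightarrow> 'a"
  by unfold_locales (auto simp: fscale_def fun_eq_iff algebra_simps)

text \<open>
  The projective space with homogeneous coordinates indexed by \<open>I\<close>; vectors are functions that
  vanish outside \<open>I\<close>, and a point is the one-dimensional subspace it represents.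
  With \<open>I = {..r}\<close> this is \<open>r\<close>-dimensional projective space.
\<close>

definition proj_space :: "'i set \<Rightarrow> ('i \<Rightarrow> 'a::field) set set" where
  "proj_space I = {funvec.span {v} | v. v \<noteq> 0 \<and> (\<forall>i. i \<notin> I \<longrightarrow> v i = 0)}"

definition proj_span :: "'i set \<Rightarrow> ('i \<Rightarrow> 'a::field) set set \<Rightarrow> ('i \<Rightarrow> 'a) set set" where
  "proj_span I S = {Q \<in> proj_space I. Q \<subseteq> funvec.span (\<Union>S)}"

text \<open>
  The coordinates of the target of the degree \<open>d\<close> Veronese embedding are indexed by the exponent
  vectors of the degree \<open>d\<close> monomials in \<open>r + 1\<close> variables, so the target is
  \<open>proj_space (monomials r d)\<close>, of dimension \<open>(r + d choose r) - 1\<close> by the lemma below.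
\<close>

definition monomials :: "nat \<Rightarrow> nat \<Rightarrow> (nat \<Rightarrow>\<^sub>0 nat) set" where
  "monomials r d = {m. Poly_Mapping.keys m \<subseteq> {..r} \<and> (\<Sum>j\<le>r. Poly_Mapping.lookup m j) = d}"

lemma card_monomials: "card (monomials r d) = (r + d) choose r"
proof -
  let ?L = "{l::nat list. size l = Suc r \<and> sum_list l = d}"
  let ?f = "\<lambda>m::nat \<Rightarrow>\<^sub>0 nat. map (Poly_Mapping.lookup m) [0..<Suc r]"
  have inj: "inj_on ?f (monomials r d)"
  proof (rule inj_onI)
    fix m m' :: "nat \<Rightarrow>\<^sub>0 nat"
    assume m: "m \<in> monomials r d" and m': "m' \<in> monomials r d" and eq: "?f m = ?f m'"
    show "m = m'"
    proof (rule poly_mapping_eqI)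
      fix j
      show "Poly_Mapping.lookup m j = Poly_Mapping.lookup m' j"
      proof (cases "j \<le> r")
        case True
        then have "j \<in> set [0..<Suc r]" by auto
        then show ?thesis using eq unfolding map_eq_conv by (rule bspec[rotated])
      next
        case False
        then have "j \<notin> Poly_Mapping.keys m" "j \<notin> Poly_Mapping.keys m'"
          using m m' by (auto simp: monomials_def)
        then show ?thesis by (simp add: in_keys_iff)
      qed
    qed
  qed
  have img: "?f ` monomials r d = ?L"
  proof (intro equalityI subsetI)
    fix l assume "l \<in> ?f ` monomials r d"
    then obtain m where m: "m \<in> monomials r d" and l: "l = ?f m" by blast
    have "sum_list l = (\<Sum>j\<le>r. Poly_Mapping.lookup m j)"
      by (simp only: l interv_sum_list_conv_sum_set_nat set_upt lessThan_Suc_atMost[symmetric]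
          atLeast0LessThan)
    then show "l \<in> ?L" using m by (simp add: l monomials_def)
  next
    fix l assume l: "l \<in> ?L"
    define g where "g = (\<lambda>j. if j < length l then l ! j else 0)"
    have "finite {j. g j \<noteq> 0}"
      by (rule finite_subset[of _ "{..<length l}"]) (auto simp: g_def)
    then have look: "Poly_Mapping.lookup (Abs_poly_mapping g) = g" by simp
    have eq: "?f (Abs_poly_mapping g) = l"
      using l by (intro nth_equalityI) (auto simp: look g_def simp del: upt_Suc)
    have "sum_list (?f (Abs_poly_mapping g)) =
        (\<Sum>j\<le>r. Poly_Mapping.lookup (Abs_poly_mapping g) j)"
      by (simp only: interv_sum_list_conv_sum_set_nat set_upt lessThan_Suc_atMost[symmetric]
          atLeast0LessThan)
    then have "(\<Sum>j\<le>r. Poly_Mapping.lookup (Abs_poly_mapping g) j) = d"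
      using l unfolding eq by simp
    moreover have "Poly_Mapping.keys (Abs_poly_mapping g) \<subseteq> {..r}"
      using l by (auto simp: in_keys_iff look g_def split: if_splits)
    ultimately have "Abs_poly_mapping g \<in> monomials r d" by (simp add: monomials_def)
    then show "l \<in> ?f ` monomials r d" using eq by (metis image_eqI)
  qed
  have "card (monomials r d) = card ?L" using card_image[OF inj] img by simp
  also have "\<dots> = (d + Suc r - 1) choose d" by (rule card_length_sum_list)
  also have "\<dots> = (r + d) choose r" using binomial_symmetric[of d "r + d"] by (simp add: add.commute)
  finally show ?thesis .
qed

definition veronese_vec :: "nat \<Rightarrow> nat \<Rightarrow> (nat \<Rightarrow> 'a::field) \<Rightarrow> (nat \<Rightarrow>\<^sub>0 nat) \<Rightarrow> 'a" where
  "veronese_vec r d x =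
     (\<lambda>m. if m \<in> monomials r d then (\<Prod>j\<le>r. x j ^ Poly_Mapping.lookup m j) else 0)"

text \<open>
  \<open>veronese_vec r d\<close> is homogeneous of degree \<open>d\<close>, so all representatives of a point are sent to the
  same line and no representative has to be chosen.
\<close>

definition veronese :: "nat \<Rightarrow> nat \<Rightarrow> (nat \<Rightarrow> 'a::field) set \<Rightarrow> ((nat \<Rightarrow>\<^sub>0 nat) \<Rightarrow> 'a) set" where
  "veronese r d p = funvec.span (veronese_vec r d ` p)"

definition veronese_variety :: "nat \<Rightarrow> nat \<Rightarrow> ((nat \<Rightarrow>\<^sub>0 nat) \<Rightarrow> 'a::field) set set" where
  "veronese_variety r d = veronese r d ` proj_space {..r}"

definition symmetric_rank :: "nat \<Rightarrow> nat \<Rightarrow> ((nat \<Rightarrow>\<^sub>0 nat) \<Rightarrow> 'a::field) set \<Rightarrow> nat" where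
  "symmetric_rank r d P =
     (LEAST k. \<exists>S \<subseteq> veronese_variety r d.
        finite S \<and> card S = k \<and> P \<in> proj_span (monomials r d) S)"

definition rank_sets ::
    "nat \<Rightarrow> nat \<Rightarrow> ((nat \<Rightarrow>\<^sub>0 nat) \<Rightarrow> 'a::field) set \<Rightarrow> (nat \<Rightarrow> 'a) set set set" where
  "rank_sets r d P =
     {A. A \<subseteq> proj_space {..r} \<and> finite A \<and> card A = symmetric_rank r d P \<and>
         P \<in> proj_span (monomials r d) (veronese r d ` A)}"

definition poly_eval :: "(('v \<Rightarrow>\<^sub>0 nat) \<Rightarrow>\<^sub>0 'a) \<Rightarrow> ('v \<Rightarrow> 'a) \<Rightarrow> 'a::comm_semiring_1" where
  "poly_eval f x = (\<Sum>m\<in>Poly_Mapping.keys f. Poly_Mapping.lookup f m * (\<Prod>v\<in>Poly_Mapping.keys m. x v ^ Poly_Mapping.lookup m v))"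

text \<open>
  The variable \<open>(i, j)\<close> stands for the \<open>j\<close>-th homogeneous coordinate of the \<open>i\<close>-th point of a
  \<open>k\<close>-tuple; \<open>e i\<close> is the degree in the \<open>i\<close>-th group of variables.
\<close>

definition multihomogeneous :: "nat \<Rightarrow> nat \<Rightarrow> ((nat \<times> nat \<Rightarrow>\<^sub>0 nat) \<Rightarrow>\<^sub>0 'a::zero) \<Rightarrow> bool" where
  "multihomogeneous r k f \<longleftrightarrow>
     (\<exists>e. \<forall>m\<in>Poly_Mapping.keys f. Poly_Mapping.keys m \<subseteq> {..<k} \<times> {..r} \<and> (\<forall>i<k. (\<Sum>j\<le>r. Poly_Mapping.lookup m (i, j)) = e i))"

definition ordered_configs :: "nat \<Rightarrow> nat \<Rightarrow> (nat \<Rightarrow> 'a::field) set list set" where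
  "ordered_configs r k = {ps. length ps = k \<and> distinct ps \<and> set ps \<subseteq> proj_space {..r}}"

text \<open>The points of a \<open>k\<close>-fold product of projective spaces where a multihomogeneous form is nonzero;
  whether it vanishes does not depend on the chosen representatives.\<close>

definition nonvanishing ::
    "nat \<Rightarrow> nat \<Rightarrow> ((nat \<times> nat \<Rightarrow>\<^sub>0 nat) \<Rightarrow>\<^sub>0 'a::field) \<Rightarrow> (nat \<Rightarrow> 'a) set list set" where
  "nonvanishing r k f =
     {ps \<in> ordered_configs r k.
        \<forall>x. (\<forall>i<k. x i \<in> ps ! i \<and> x i \<noteq> 0) \<longrightarrow> poly_eval f (\<lambda>(i, j). x i j) \<noteq> 0}"

text \<open>
  The distinguished open sets are closed under finite intersections (multiply the forms), so the
  closed sets are exactly the common zero loci of families of multihomogeneous forms.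
\<close>

definition ordered_config_topology :: "nat \<Rightarrow> nat \<Rightarrow> (nat \<Rightarrow> 'a::field) set list topology" where
  "ordered_config_topology r k = topology_generated_by {nonvanishing r k f | f. multihomogeneous r k f}"

lemma topspace_ordered_config [simp]:
  "topspace (ordered_config_topology r k :: (nat \<Rightarrow> 'a::field) set list topology) = ordered_configs r k"
proof -
  let ?one = "1 :: (nat \<times> nat \<Rightarrow>\<^sub>0 nat) \<Rightarrow>\<^sub>0 'a"
  have "multihomogeneous r k ?one" by (auto simp: multihomogeneous_def)
  moreover have "nonvanishing r k ?one = ordered_configs r k"
    by (auto simp: nonvanishing_def poly_eval_def)
  ultimately have "ordered_configs r k \<in>
      {nonvanishing r k f | f :: (nat \<times> nat \<Rightarrow>\<^sub>0 nat) \<Rightarrow>\<^sub>0 'a. multihomogeneous r k f}"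
    by blast
  moreover have "nonvanishing r k f \<subseteq> ordered_configs r k" for f :: "(nat \<times> nat \<Rightarrow>\<^sub>0 nat) \<Rightarrow>\<^sub>0 'a"
    by (auto simp: nonvanishing_def)
  ultimately show ?thesis
    unfolding ordered_config_topology_def topology_generated_by_topspace by blast
qed

definition reduced_subsets :: "nat \<Rightarrow> nat \<Rightarrow> (nat \<Rightarrow> 'a::field) set set set" where
  "reduced_subsets r k = {Z. Z \<subseteq> proj_space {..r} \<and> finite Z \<and> card Z = k}"

text \<open>
  The Hilbert scheme of reduced \<open>k\<close>-point subsets is the geometric quotient of the ordered
  configuration space by the symmetric group; its Zariski topology is the quotient topology along
  the map that forgets the order.
\<close>

definition hilb_topology :: "nat \<Rightarrow> nat \<Rightarrow> (nat \<Rightarrow> 'a::field) set set topology" where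
  "hilb_topology r k = topology (\<lambda>U. U \<subseteq> reduced_subsets r k \<and>
     openin (ordered_config_topology r k) {ps \<in> ordered_configs r k. set ps \<in> U})"

lemma istopology_hilb:
  "istopology (\<lambda>U. U \<subseteq> reduced_subsets r k \<and>
     openin (ordered_config_topology r k) {ps \<in> ordered_configs r k. set ps \<in> U})"
proof -
  have I: "{ps \<in> C. set ps \<in> S \<inter> T} = {ps \<in> C. set ps \<in> S} \<inter> {ps \<in> C. set ps \<in> T}"
    for C :: "'b list set" and S T by auto
  have U: "{ps \<in> C. set ps \<in> \<Union>\<K>} = (\<Union>K\<in>\<K>. {ps \<in> C. set ps \<in> K})"
    for C :: "'b list set" and \<K> by auto
  show ?thesis
    unfolding istopology_def I U by (auto intro!: openin_Int openin_Union)
qed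

lemma topspace_hilb [simp]:
  "topspace (hilb_topology r k :: (nat \<Rightarrow> 'a::field) set set topology) = reduced_subsets r k"
proof -
  have op: "openin (hilb_topology r k) U \<longleftrightarrow> U \<subseteq> reduced_subsets r k \<and>
     openin (ordered_config_topology r k) {ps \<in> ordered_configs r k. set ps \<in> U}"
    for U :: "(nat \<Rightarrow> 'a) set set set"
    unfolding hilb_topology_def by (subst topology_inverse'[OF istopology_hilb]) (rule refl)
  have eq: "{ps \<in> ordered_configs r k. set ps \<in> reduced_subsets r k} =
      (ordered_configs r k :: (nat \<Rightarrow> 'a) set list set)"
    by (auto simp: ordered_configs_def reduced_subsets_def distinct_card)
  have "openin (hilb_topology r k) (reduced_subsets r k :: (nat \<Rightarrow> 'a) set set set)"
    unfolding op eq using openin_topspace[of "ordered_config_topology r k :: (nat \<Rightarrow> 'a) set list topology"]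
    by simp
  moreover have "topspace (hilb_topology r k) \<subseteq> (reduced_subsets r k :: (nat \<Rightarrow> 'a) set set set)"
    using op[of "topspace (hilb_topology r k)"] by simp
  ultimately show ?thesis
    by (intro subset_antisym openin_subset)
qed

definition irreducible_in :: "'b topology \<Rightarrow> 'b set \<Rightarrow> bool" where
  "irreducible_in X S \<longleftrightarrow> S \<subseteq> topspace X \<and> S \<noteq> {} \<and>
     (\<forall>C D. closedin X C \<and> closedin X D \<and> S \<subseteq> C \<union> D \<longrightarrow> S \<subseteq> C \<or> S \<subseteq> D)"

definition irreducible_component_of :: "'b topology \<Rightarrow> 'b set \<Rightarrow> 'b set \<Rightarrow> bool" where
  "irreducible_component_of X T C \<longleftrightarrow> C \<subseteq> T \<and> irreducible_in X C \<and>
     (\<forall>D. irreducible_in X D \<and> C \<subseteq> D \<and> D \<subseteq> T \<longrightarrow> D = C)"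

definition isolated_rank_set ::
    "nat \<Rightarrow> nat \<Rightarrow> ((nat \<Rightarrow>\<^sub>0 nat) \<Rightarrow> 'a::field) set \<Rightarrow> (nat \<Rightarrow> 'a) set set \<Rightarrow> bool" where
  "isolated_rank_set r d P Z \<longleftrightarrow> Z \<in> rank_sets r d P \<and>
     irreducible_component_of (hilb_topology r (symmetric_rank r d P))
       (hilb_topology r (symmetric_rank r d P) closure_of rank_sets r d P) {Z}"

end

theory Submission
  imports Defs
begin

text \<open>
  A set \<open>A\<close> computing the rank of \<open>P\<close> amounts to a formula \<open>P(f) = (\<Sum>a\<in>A. \<alpha> a * f a)\<close>, valid for all
  forms \<open>f\<close> of degree \<open>d\<close>, with the fewest possible points. Subtracting the formulas of two such
  sets gives a linear relation between the evaluations of degree \<open>d\<close> forms at a nonempty set \<open>W\<close>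
  of at most \<open>2 * t < 3 * d\<close> points, with nonzero coefficients.

  Such a short relation forces \<open>W\<close> onto two lines or onto a smooth plane conic
  (\<open>CB_two_lines_or_conic\<close>). The tool is residuation: multiplying the coefficients by the values of
  a form \<open>g\<close> of degree \<open>e\<close> gives a relation in degree \<open>d - e\<close> on the points where \<open>g\<close> does not
  vanish. If a hyperplane contains three points of \<open>W\<close> but not all of it, residuating at hyperplanes
  and quadrics leads by induction on \<open>d\<close> to the claim. Otherwise \<open>W\<close> is a set of points of a plane,
  no three of them collinear; if no conic contains six of them, the growth of the Hilbert function of
  \<open>W\<close> is incompatible with the relation.

  Off the lines or the conic the two formulas agree, so everything happens on a rational curve, where
  forms become polynomials \<open>q\<close> in one variable. If \<open>A\<close> and \<open>B\<close> have the same number of points on the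
  curve and induce the same functional there, the functional vanishes on all multiples of the monic
  polynomials \<open>g\<^sub>A\<close> and \<open>g\<^sub>B\<close> whose roots are these points, hence on all multiples of every member
  \<open>(1 - u) * g\<^sub>A + u * g\<^sub>B\<close> of their pencil; by interpolation it is then a combination of
  evaluations at the roots of that member (\<open>pencil_apolar\<close>). Moving \<open>u\<close> moves \<open>A\<close> in a family of rank
  sets (\<open>double_pencil_family\<close>). For two lines meeting in a point \<open>o'\<close> the relation splits only up to a
  multiple of the evaluation at \<open>o'\<close>. Minimality of the rank leaves, besides pencils on one line, one
  further case: the multiple does not vanish, and then the pencils on both lines have to be moved
  simultaneously, with \<open>o'\<close> as the point at infinity of both (\<open>not_on_node\<close>).

  The roots of the members of a pencil cannot be ordered rationally in \<open>u\<close>, so irreducibility of the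
  family in the Hilbert scheme is shown with symmetric sums: the sums of \<open>q(\<rho>) / g'(\<rho>)\<close> over the roots
  \<open>\<rho>\<close> of a monic member \<open>g\<close> are polynomials in \<open>u\<close>, and hence so are the similarly weighted sums of any
  polynomial in all points of the set over all choices of its arguments. Every closed set missing one
  member of the family is separated from it by such a polynomial (\<open>closed_avoiding_polynomial\<close>), so
  the family is the image of an infinite set with the cofinite topology. Thus every rank set lies in
  an infinite irreducible set of rank sets.
\<close>

section \<open>Forms and linear forms with prescribed zeros\<close>

lemma sum_fun_apply: "(\<Sum>i\<in>I. F i) x = (\<Sum>i\<in>I. F i x :: 'a::comm_monoid_add)"
  by (induction I rule: infinite_finite_induct) auto

lemma sum_lessThan_add: "(\<Sum>i<m + n. F i) = (\<Sum>i<m. F i) + (\<Sum>i<n. F (m + i))"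
  for F :: "nat \<Rightarrow> 'a::comm_monoid_add"
  by (induction n) (simp_all add: add.assoc)

text \<open>
  A homogeneous linear system with fewer equations than unknowns, solved by eliminating one equation
  and one unknown at a time.
\<close>

lemma nontrivial_solution:
  fixes M :: "'i \<Rightarrow> 'j \<Rightarrow> 'a::field"
  assumes "finite J" "finite I" "card J < card I"
  shows "\<exists>c. (\<exists>i\<in>I. c i \<noteq> 0) \<and> (\<forall>j\<in>J. (\<Sum>i\<in>I. c i * M i j) = 0)"
  using assms
proof (induction J arbitrary: I M rule: finite_induct)
  case empty
  then have "I \<noteq> {}" by auto
  then show ?case by (intro exI[of _ "\<lambda>_. 1"]) auto
next
  case (insert j J I M)
  show ?case
  proof (cases "\<forall>i\<in>I. M i j = 0")
    case True
    then show ?thesis using insert.IH[of I M] insert by auto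
  next
    case False
    then obtain k where k: "k \<in> I" "M k j \<noteq> 0" by blast
    \<comment> \<open>eliminate the unknown \<open>k\<close> with the equation \<open>j\<close>\<close>
    define M' where "M' i l = M i l - M i j / M k j * M k l" for i l
    have "card J < card (I - {k})" using insert k by simp
    then obtain c where c: "\<exists>i\<in>I - {k}. c i \<noteq> 0" "\<forall>l\<in>J. (\<Sum>i\<in>I - {k}. c i * M' i l) = 0"
      using insert.IH[of "I - {k}" M'] insert.prems by blast
    define e where "e = (\<lambda>i. if i = k then - (\<Sum>i\<in>I - {k}. c i * (M i j / M k j)) else c i)"
    have eq: "(\<Sum>i\<in>I. e i * M i l) = (\<Sum>i\<in>I - {k}. c i * M' i l)" for l
    proof -
      have "(\<Sum>i\<in>I. e i * M i l) = e k * M k l + (\<Sum>i\<in>I - {k}. e i * M i l)"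
        using insert.prems(1) k(1) by (rule sum.remove)
      also have "(\<Sum>i\<in>I - {k}. e i * M i l) = (\<Sum>i\<in>I - {k}. c i * M i l)"
        by (intro sum.cong) (auto simp: e_def)
      also have "e k * M k l + \<dots> = (\<Sum>i\<in>I - {k}. c i * M' i l)"
        by (simp add: e_def M'_def sum_distrib_right sum_distrib_left sum_subtractf algebra_simps)
      finally show ?thesis .
    qed
    have "\<exists>i\<in>I. e i \<noteq> 0" using c(1) by (auto simp: e_def)
    moreover have "(\<Sum>i\<in>I. e i * M i l) = 0" if "l \<in> insert j J" for l
    proof (cases "l = j")
      case True
      have "M' i j = 0" for i using k by (simp add: M'_def)
      then show ?thesis unfolding eq True by simp
    next
      case False then show ?thesis unfolding eq using c(2) that by auto
    qed
    ultimately show ?thesis by blast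
  qed
qed

definition vecs :: "nat \<Rightarrow> (nat \<Rightarrow> 'a::field) set" where
  "vecs r = {v. \<forall>i. i \<notin> {..r} \<longrightarrow> v i = 0}"

definition lin :: "nat \<Rightarrow> (nat \<Rightarrow> 'a::field) \<Rightarrow> (nat \<Rightarrow> 'a) \<Rightarrow> 'a" where
  "lin r l x = (\<Sum>j\<le>r. l j * x j)"

text \<open>
  Forms are treated as functions, which loses nothing over an infinite field. Generating them by
  multiplication with linear forms, rather than by monomials, makes closure under products and
  restriction to a line or a conic direct inductions.
\<close>

inductive is_form :: "nat \<Rightarrow> nat \<Rightarrow> ((nat \<Rightarrow> 'a::field) \<Rightarrow> 'a) \<Rightarrow> bool" for r where
  const: "is_form r 0 (\<lambda>x. c)"
| lin_mult: "is_form r d f \<Longrightarrow> is_form r (Suc d) (\<lambda>x. lin r l x * f x)"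
| add: "is_form r d f \<Longrightarrow> is_form r d g \<Longrightarrow> is_form r d (\<lambda>x. f x + g x)"

definition forms :: "nat \<Rightarrow> nat \<Rightarrow> ((nat \<Rightarrow> 'a::field) \<Rightarrow> 'a) set" where
  "forms r d = {f. is_form r d f}"

lemma forms_const: "(\<lambda>x. c) \<in> forms r 0"
  and forms_lin_mult: "f \<in> forms r d \<Longrightarrow> (\<lambda>x. lin r l x * f x) \<in> forms r (Suc d)"
  and forms_add: "f \<in> forms r d \<Longrightarrow> g \<in> forms r d \<Longrightarrow> (\<lambda>x. f x + g x) \<in> forms r d"
  by (auto simp: forms_def intro: is_form.intros)

lemma forms_induct [consumes 1, case_names const lin_mult add]:
  assumes "f \<in> forms r d"
    and "\<And>c. Q 0 (\<lambda>x. c)"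
    and "\<And>f d l. f \<in> forms r d \<Longrightarrow> Q d f \<Longrightarrow> Q (Suc d) (\<lambda>x. lin r l x * f x)"
    and "\<And>f d g. f \<in> forms r d \<Longrightarrow> Q d f \<Longrightarrow> g \<in> forms r d \<Longrightarrow> Q d g \<Longrightarrow> Q d (\<lambda>x. f x + g x)"
  shows "Q d f"
proof -
  have "is_form r d f" using assms(1) by (simp add: forms_def)
  then show ?thesis
    by (induction rule: is_form.induct) (auto intro: assms(2-) simp: forms_def)
qed

lemma lin_add [simp]: "lin r l (x + y) = lin r l x + lin r l y"
  by (simp add: lin_def sum.distrib algebra_simps)

lemma lin_scale [simp]: "lin r l (fscale c x) = c * lin r l x"
  by (simp add: lin_def sum_distrib_left fscale_def algebra_simps)

lemma lin_zero [simp]: "lin r l 0 = 0"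
  by (simp add: lin_def)

lemma lin_coeff_add: "lin r (\<lambda>j. a * k j + b * l j) x = a * lin r k x + b * lin r l x"
  by (simp add: lin_def sum.distrib sum_distrib_left algebra_simps)

lemma lin_uminus [simp]: "lin r l (- x) = - lin r l x"
  using lin_scale[of r l "-1" x] by simp

lemma lin_diff [simp]: "lin r l (x - y) = lin r l x - lin r l y"
  using lin_add[of r l x "- y"] by simp

lemma lin_coeff_diff: "lin r (\<lambda>j. a * k j - b * l j) x = a * lin r k x - b * lin r l x"
  using lin_coeff_add[of r a k "- b" l x] by simp

lemma lin_coeff_scale: "lin r (\<lambda>j. a * k j) x = a * lin r k x"
  by (simp add: lin_def sum.distrib sum_distrib_left algebra_simps)

lemma lin_unit: "i \<le> r \<Longrightarrow> lin r (\<lambda>j. if j = i then 1 else 0) x = x i"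
proof -
  assume "i \<le> r"
  have "lin r (\<lambda>j. if j = i then 1 else 0) x = (\<Sum>j\<le>r. if j = i then x j else 0)"
    unfolding lin_def by (intro sum.cong) auto
  then show ?thesis using \<open>i \<le> r\<close> by simp
qed

lemma vecs_subspace: "funvec.subspace (vecs r)"
  by (auto simp: funvec.subspace_def vecs_def fscale_def)

lemma vecs_closed [simp]:
  "x \<in> vecs r \<Longrightarrow> y \<in> vecs r \<Longrightarrow> x + y \<in> vecs r" "x \<in> vecs r \<Longrightarrow> fscale c x \<in> vecs r" "0 \<in> vecs r"
  by (auto simp: vecs_def fscale_def)

lemma lin_vanish_span:
  assumes "\<And>s. s \<in> S \<Longrightarrow> lin r l s = 0" "x \<in> funvec.span S"
  shows "lin r l x = 0"
proof -
  have "funvec.subspace {y. lin r l y = 0}" by (auto intro!: funvec.subspaceI)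
  then have "funvec.span S \<subseteq> {y. lin r l y = 0}"
    using assms(1) by (intro funvec.span_minimal) auto
  then show ?thesis using assms(2) by auto
qed

lemma forms_zero: "(\<lambda>x. 0) \<in> forms r d"
proof (induction d)
  case 0 show ?case by (rule forms_const)
next
  case (Suc d) then show ?case using forms_lin_mult[of "\<lambda>x. 0" r d "\<lambda>_. 0"] by simp
qed

lemma forms_scale: "f \<in> forms r d \<Longrightarrow> (\<lambda>x. c * f x) \<in> forms r d"
proof (induction rule: forms_induct)
  case (const c') then show ?case by (rule forms_const)
next
  case (lin_mult f d l)
  then have "(\<lambda>x. lin r l x * (c * f x)) \<in> forms r (Suc d)" by (intro forms_lin_mult)
  then show ?case by (simp add: algebra_simps)
next
  case (add f d g) then show ?case by (simp add: forms_add distrib_left)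
qed

lemma forms_sum:
  assumes "\<And>i. i \<in> I \<Longrightarrow> f i \<in> forms r d"
  shows "(\<lambda>x. \<Sum>i\<in>I. f i x) \<in> forms r d"
  using assms
proof (induction I rule: infinite_finite_induct)
  case (insert i I) then show ?case by (simp add: forms_add)
qed (auto simp: forms_zero)

lemma forms_mult: "f \<in> forms r d \<Longrightarrow> g \<in> forms r e \<Longrightarrow> (\<lambda>x. f x * g x) \<in> forms r (d + e)"
proof (induction rule: forms_induct)
  case (const c) then show ?case using forms_scale by simp
next
  case (lin_mult f d l)
  then have "(\<lambda>x. lin r l x * (f x * g x)) \<in> forms r (Suc (d + e))" by (intro forms_lin_mult) auto
  then show ?case by (simp add: algebra_simps)
next
  case (add f d g) then show ?case by (simp add: forms_add distrib_right)
qed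

lemma forms_lin: "lin r l \<in> forms r 1"
  using forms_lin_mult[OF forms_const[of 1]] by simp

lemma forms_lin_power: "(\<lambda>x. lin r l x ^ d) \<in> forms r d"
proof (induction d)
  case 0 show ?case using forms_const by simp
next
  case (Suc d) then show ?case using forms_lin_mult by simp
qed

lemma forms_prod:
  assumes "finite I" "\<And>i. i \<in> I \<Longrightarrow> f i \<in> forms r (e i)"
  shows "(\<lambda>x. \<Prod>i\<in>I. f i x) \<in> forms r (\<Sum>i\<in>I. e i)"
  using assms
proof (induction I rule: finite_induct)
  case empty then show ?case using forms_const by simp
next
  case (insert i I) then show ?case by (simp add: forms_mult)
qed

lemma forms_homogeneous: "f \<in> forms r d \<Longrightarrow> f (fscale c x) = c ^ d * f x"
  by (induction rule: forms_induct) (auto simp: algebra_simps)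

global_interpretation funvec_dual: vector_space_pair "fscale :: 'a::field \<Rightarrow> ('i \<Rightarrow> 'a) \<Rightarrow> 'i \<Rightarrow> 'a"
    "(*) :: 'a \<Rightarrow> 'a \<Rightarrow> 'a"
  by unfold_locales (auto simp: algebra_simps)

lemma linear_eq_lin:
  fixes g :: "(nat \<Rightarrow> 'a::field) \<Rightarrow> 'a"
  assumes g: "Vector_Spaces.linear fscale (*) g" and v: "v \<in> vecs r"
  shows "g v = lin r (\<lambda>j. g (\<lambda>i. if i = j then 1 else 0)) v"
proof -
  interpret g: Vector_Spaces.linear fscale "(*)" g by fact
  have "v = (\<Sum>j\<le>r. fscale (v j) (\<lambda>i. if i = j then 1 else 0))"
  proof
    fix i
    have "(\<Sum>j\<le>r. fscale (v j) (\<lambda>i. if i = j then 1 else 0)) i = (\<Sum>j\<le>r. if j = i then v j else 0)"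
      unfolding sum_fun_apply by (rule sum.cong) (auto simp: fscale_def)
    also have "\<dots> = v i" using v by (auto simp: vecs_def)
    finally show "v i = (\<Sum>j\<le>r. fscale (v j) (\<lambda>i. if i = j then 1 else 0)) i" by simp
  qed
  then have "g v = g (\<Sum>j\<le>r. fscale (v j) (\<lambda>i. if i = j then 1 else 0))" by simp
  also have "\<dots> = (\<Sum>j\<le>r. v j * g (\<lambda>i. if i = j then 1 else 0))"
    by (simp add: g.sum g.scale)
  finally show ?thesis by (simp add: lin_def mult.commute)
qed

lemma lin_separates:
  assumes S: "S \<subseteq> vecs r" and w: "w \<in> vecs r" "w \<notin> funvec.span S"
  obtains l where "\<And>s. s \<in> funvec.span S \<Longrightarrow> lin r l s = 0" "lin r l w = 1"
proof -
  obtain B where B: "B \<subseteq> S" "funvec.independent B" "S \<subseteq> funvec.span B"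
    using funvec.maximal_independent_subset[of S] by blast
  have spB: "funvec.span B = funvec.span S"
    using B by (metis funvec.span_mono funvec.span_span subset_antisym)
  have ind: "funvec.independent (insert w B)"
    using B(2) w(2) unfolding spB[symmetric] by (simp add: funvec.independent_insert)
  obtain g where g: "Vector_Spaces.linear fscale (*) g" "\<forall>x\<in>insert w B. g x = (if x = w then 1 else 0)"
    using funvec_dual.linear_independent_extend[OF ind, of "\<lambda>x. if x = w then 1 else 0"] by blast
  let ?l = "\<lambda>j. g (\<lambda>i. if i = j then 1 else 0)"
  have "lin r ?l b = 0" if "b \<in> B" for b
  proof -
    have "b \<in> vecs r" "b \<noteq> w" using that B S w funvec.span_base[of w S] by auto
    then show ?thesis using linear_eq_lin[OF g(1), of b r] g(2) that by auto
  qed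
  then have "lin r ?l s = 0" if "s \<in> funvec.span S" for s
    using lin_vanish_span[of B r ?l s] that spB by auto
  moreover have "lin r ?l w = 1" using linear_eq_lin[OF g(1) w(1)] g(2) by simp
  ultimately show ?thesis by (rule that)
qed

lemma lin_separates_ex:
  assumes "S \<subseteq> vecs r" "w \<in> vecs r" "w \<notin> funvec.span S"
  shows "\<exists>l. (\<forall>s\<in>funvec.span S. lin r l s = 0) \<and> lin r l w = 1"
  by (rule lin_separates[OF assms]) blast

lemma lin_separates_point:
  assumes "q \<in> vecs r" "p \<in> vecs r" "p \<notin> funvec.span {q}"
  shows "\<exists>k. lin r k p = 1 \<and> lin r k q = 0"
proof -
  have "{q} \<subseteq> vecs r" using assms by simp
  from lin_separates[OF this assms(2,3)] show ?thesis
    using funvec.span_base[of q "{q}"] by (metis singletonI)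
qed

lemma lin_separates_line:
  assumes "a \<in> vecs r" "b \<in> vecs r" "p \<in> vecs r" "p \<notin> funvec.span {a, b}"
  shows "\<exists>k. lin r k p = 1 \<and> lin r k a = 0 \<and> lin r k b = 0"
proof -
  have "{a, b} \<subseteq> vecs r" using assms by simp
  from lin_separates[OF this assms(3,4)] show ?thesis
    using funvec.span_base[of a "{a, b}"] funvec.span_base[of b "{a, b}"] by (metis insertCI)
qed

lemma span_single: "x \<in> funvec.span {p} \<longleftrightarrow> (\<exists>c. x = fscale c p)"
  by (auto simp: funvec.span_singleton)

lemma span_single_eq: "w \<in> funvec.span {v} \<Longrightarrow> w \<noteq> 0 \<Longrightarrow> funvec.span {w} = funvec.span {v}"
proof (rule antisym)
  assume w: "w \<in> funvec.span {v}" "w \<noteq> 0"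
  then show "funvec.span {w} \<subseteq> funvec.span {v}" by (intro funvec.span_minimal funvec.subspace_span) auto
  obtain c where c: "w = fscale c v" using w unfolding span_single by blast
  then have "c \<noteq> 0" using w by (auto simp: fscale_def zero_fun_def)
  then have "v = fscale (1 / c) w" by (simp add: c fscale_def)
  then have "v \<in> funvec.span {w}" unfolding span_single by blast
  then show "funvec.span {v} \<subseteq> funvec.span {w}" by (intro funvec.span_minimal funvec.subspace_span) auto
qed

lemma span_single_eq_imp: "funvec.span {v} = funvec.span {w} \<Longrightarrow> w \<in> funvec.span {v}"
  using funvec.span_base[of w "{w}"] by blast

lemma span_pair: "x \<in> funvec.span {p, q} \<longleftrightarrow> (\<exists>a b. x = fscale a p + fscale b q)"
proof
  assume "x \<in> funvec.span {p, q}"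
  then obtain a where "x - fscale a p \<in> funvec.span {q}" by (auto simp: funvec.span_insert)
  then obtain b where "x - fscale a p = fscale b q" by (auto simp: funvec.span_singleton)
  then show "\<exists>a b. x = fscale a p + fscale b q" by (metis diff_add_cancel add.commute)
next
  assume "\<exists>a b. x = fscale a p + fscale b q"
  then show "x \<in> funvec.span {p, q}"
    by (auto intro!: funvec.span_add funvec.span_scale intro: funvec.span_base)
qed

lemma span_triple: "x \<in> funvec.span {p, q, s} \<longleftrightarrow> (\<exists>a b c. x = fscale a p + fscale b q + fscale c s)"
proof
  assume "x \<in> funvec.span {p, q, s}"
  then obtain a where "x - fscale a p \<in> funvec.span {q, s}" by (auto simp: funvec.span_insert)
  then obtain b c where "x - fscale a p = fscale b q + fscale c s" by (auto simp: span_pair)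
  then have "x = fscale a p + fscale b q + fscale c s"
    by (simp add: algebra_simps)
  then show "\<exists>a b c. x = fscale a p + fscale b q + fscale c s" by blast
next
  assume "\<exists>a b c. x = fscale a p + fscale b q + fscale c s"
  then show "x \<in> funvec.span {p, q, s}"
    by (auto intro!: funvec.span_add funvec.span_scale intro: funvec.span_base)
qed

text \<open>
  For a pencil \<open>f + s * g\<close> only finitely many \<open>s\<close> produce a zero on the finite set \<open>W\<close>.
\<close>

lemma avoid_finite_zeros:
  fixes F :: "('x \<Rightarrow> 'a::field_char_0) set"
  assumes W: "finite W" and ex: "\<And>w. w \<in> W \<Longrightarrow> \<exists>f\<in>F. f w \<noteq> 0" and ne: "F \<noteq> {}"
    and comb: "\<And>f g s. f \<in> F \<Longrightarrow> g \<in> F \<Longrightarrow> (\<lambda>x. f x + s * g x) \<in> F"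
  shows "\<exists>f\<in>F. \<forall>w\<in>W. f w \<noteq> 0"
  using W ex
proof (induction W rule: finite_induct)
  case empty then show ?case using ne by auto
next
  case (insert w W)
  then obtain f g where fg: "f \<in> F" "\<forall>w\<in>W. f w \<noteq> 0" "g \<in> F" "g w \<noteq> 0" by (metis insert_iff)
  have "finite ((\<lambda>v. - f v / g v) ` insert w W)" using insert by simp
  then obtain s where s: "s \<notin> (\<lambda>v. - f v / g v) ` insert w W"
    using ex_new_if_finite[OF infinite_UNIV_char_0] by metis
  have nz: "f v + s * g v \<noteq> 0" if "v \<in> insert w W" for v
  proof
    assume *: "f v + s * g v = 0"
    then have "g v \<noteq> 0" using fg that by auto
    moreover have "s * g v = - f v" using * by (simp add: eq_neg_iff_add_eq_0 add.commute)
    ultimately have "s = - f v / g v" using nonzero_eq_divide_eq[of "g v" s "- f v"] by blast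
    then show False using s that by blast
  qed
  show ?case by (rule bexI[OF _ comb[OF fg(1,3), of s]]) (use nz in blast)
qed

lemma lin_separates_many:
  fixes S :: "(nat \<Rightarrow> 'a::field_char_0) set"
  assumes S: "S \<subseteq> vecs r" and W: "finite W" "W \<subseteq> vecs r" "W \<inter> funvec.span S = {}"
  obtains l where "\<And>s. s \<in> funvec.span S \<Longrightarrow> lin r l s = 0" "\<And>w. w \<in> W \<Longrightarrow> lin r l w \<noteq> 0"
proof -
  let ?F = "{lin r l | l. \<forall>s\<in>funvec.span S. lin r l s = 0}"
  have "\<exists>f\<in>?F. \<forall>w\<in>W. f w \<noteq> 0"
  proof (rule avoid_finite_zeros[OF W(1)])
    fix w assume "w \<in> W"
    then have "w \<in> vecs r" "w \<notin> funvec.span S" using W by auto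
    then obtain l where "\<And>s. s \<in> funvec.span S \<Longrightarrow> lin r l s = 0" "lin r l w = 1"
      using lin_separates[OF S] by blast
    then show "\<exists>f\<in>?F. f w \<noteq> 0" by force
  next
    show "?F \<noteq> {}" by (auto intro!: exI[of _ "\<lambda>_. 0"] simp: lin_def)
  next
    fix f g s assume "f \<in> ?F" "g \<in> ?F"
    then obtain k l where "f = lin r k" "g = lin r l" "\<forall>s\<in>funvec.span S. lin r k s = 0" "\<forall>s\<in>funvec.span S. lin r l s = 0"
      by auto
    then show "(\<lambda>x. f x + s * g x) \<in> ?F"
      using lin_coeff_add[of r 1 k s l] by (auto intro!: exI[of _ "\<lambda>j. 1 * k j + s * l j"])
  qed
  then show ?thesis using that by blast
qed

section \<open>Point sets carrying a relation between evaluations\<close>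

definition proj_points :: "nat \<Rightarrow> (nat \<Rightarrow> 'a::field) set \<Rightarrow> bool" where
  "proj_points r W \<longleftrightarrow> finite W \<and> W \<subseteq> vecs r \<and> (\<forall>v\<in>W. v \<noteq> 0) \<and>
     (\<forall>v\<in>W. \<forall>w\<in>W. v \<noteq> w \<longrightarrow> w \<notin> funvec.span {v})"

text \<open>
  The Cayley-Bacharach property: since all coefficients are nonzero, a form of degree \<open>d\<close> vanishing at all
  points of \<open>W\<close> but one vanishes on all of \<open>W\<close>.
\<close>

definition CB :: "nat \<Rightarrow> nat \<Rightarrow> (nat \<Rightarrow> 'a::field) set \<Rightarrow> bool" where
  "CB r d W \<longleftrightarrow> (\<exists>c. (\<forall>w\<in>W. c w \<noteq> 0) \<and> (\<forall>f\<in>forms r d. (\<Sum>w\<in>W. c w * f w) = 0))"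

lemma proj_points_subset: "proj_points r W \<Longrightarrow> T \<subseteq> W \<Longrightarrow> proj_points r T"
  unfolding proj_points_def by (meson finite_subset subset_iff)

lemma CB_support:
  fixes W :: "(nat \<Rightarrow> 'a::field) set"
  assumes W: "finite W" and c: "\<forall>f\<in>forms r d. (\<Sum>w\<in>W. c w * f w) = 0"
  shows "CB r d {w\<in>W. c w \<noteq> 0}"
  unfolding CB_def
proof (intro exI[of _ c] conjI ballI)
  fix f :: "(nat \<Rightarrow> 'a) \<Rightarrow> 'a" assume "f \<in> forms r d"
  then have "(\<Sum>w\<in>W. c w * f w) = 0" using c by blast
  moreover have "(\<Sum>w\<in>{w\<in>W. c w \<noteq> 0}. c w * f w) = (\<Sum>w\<in>W. c w * f w)"
    by (rule sum.mono_neutral_left) (use W in auto)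
  ultimately show "(\<Sum>w\<in>{w\<in>W. c w \<noteq> 0}. c w * f w) = 0" by simp
qed auto

text \<open>
  The coefficients multiplied by the values of \<open>g\<close> form the relation on the residual set.
\<close>

lemma CB_residual:
  fixes W :: "(nat \<Rightarrow> 'a::field) set"
  assumes W: "finite W" and cb: "CB r d W" and g: "g \<in> forms r e" and e: "e \<le> d"
  shows "CB r (d - e) {w\<in>W. g w \<noteq> 0}"
proof -
  obtain c where c: "\<forall>w\<in>W. c w \<noteq> 0" "\<forall>f\<in>forms r d. (\<Sum>w\<in>W. c w * f w) = 0"
    using cb by (auto simp: CB_def)
  have "\<forall>f\<in>forms r (d - e). (\<Sum>w\<in>W. (c w * g w) * f w) = 0"
  proof
    fix f :: "(nat \<Rightarrow> 'a) \<Rightarrow> 'a" assume "f \<in> forms r (d - e)"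
    then have "(\<lambda>x. g x * f x) \<in> forms r d" using forms_mult[OF g, of f "d - e"] e by simp
    then show "(\<Sum>w\<in>W. (c w * g w) * f w) = 0" using c(2) by (force simp: mult.assoc)
  qed
  from CB_support[OF W this] have "CB r (d - e) {w\<in>W. c w * g w \<noteq> 0}" .
  moreover have "{w\<in>W. c w * g w \<noteq> 0} = {w\<in>W. g w \<noteq> 0}" using c(1) by auto
  ultimately show ?thesis by simp
qed

text \<open>
  Residuating at a hyperplane through one point of \<open>W\<close> lowers both the degree and the number of points.
\<close>

lemma CB_card_ge:
  assumes "proj_points r W" "CB r d W" "W \<noteq> {}"
  shows "card W \<ge> d + 2"
  using assms
proof (induction d arbitrary: W)
  case (0 W)
  obtain c where c: "\<forall>w\<in>W. c w \<noteq> 0" "\<forall>f\<in>forms r 0. (\<Sum>w\<in>W. c w * f w) = 0"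
    using 0 by (auto simp: CB_def)
  then have s: "(\<Sum>w\<in>W. c w) = 0" using forms_const[of 1 r] by force
  have fin: "finite W" using 0 by (auto simp: proj_points_def)
  have "card W \<noteq> 0" using 0 fin by auto
  moreover have "card W \<noteq> 1" using s c(1) by (auto simp: card_1_singleton_iff)
  ultimately show ?case by linarith
next
  case (Suc d W)
  have fin: "finite W" using Suc by (auto simp: proj_points_def)
  obtain w where w: "w \<in> W" using Suc by blast
  have "\<exists>w'\<in>W. w' \<noteq> w"
  proof (rule ccontr)
    assume "\<not> ?thesis"
    then have W: "W = {w}" using w by blast
    have "w \<in> vecs r" "w \<notin> funvec.span {}"
      using Suc.prems(1) w unfolding proj_points_def funvec.span_empty by blast+
    then obtain l where l: "lin r l w = 1" using lin_separates[of "{}" r w] by blast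
    obtain c where c: "\<forall>w\<in>W. c w \<noteq> 0" "\<forall>f\<in>forms r (Suc d). (\<Sum>w\<in>W. c w * f w) = 0"
      using Suc by (auto simp: CB_def)
    then show False using forms_lin_power[of r l "Suc d"] W l by force
  qed
  then obtain w' where w': "w' \<in> W" "w' \<noteq> w" by blast
  then have "w' \<in> vecs r" "w' \<notin> funvec.span {w}" "w \<in> vecs r"
    using Suc.prems w by (auto simp: proj_points_def)
  then obtain l where l: "lin r l w = 0" "lin r l w' = 1"
    using lin_separates[of "{w}" r w'] funvec.span_base[of w "{w}"] by auto
  let ?T = "{w\<in>W. lin r l w \<noteq> 0}"
  have "CB r d ?T" using CB_residual[OF fin Suc.prems(2) forms_lin] by simp
  moreover have "proj_points r ?T" using Suc.prems(1) by (rule proj_points_subset) auto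
  moreover have "?T \<noteq> {}" using w' l by auto
  ultimately have "card ?T \<ge> d + 2" using Suc.IH by blast
  moreover have "card ?T < card W" using w l fin by (intro psubset_card_mono) auto
  ultimately show ?case by linarith
qed

definition collinear_pts :: "(nat \<Rightarrow> 'a::field) set \<Rightarrow> bool" where
  "collinear_pts W \<longleftrightarrow> (\<exists>p\<in>W. \<exists>q\<in>W. p \<noteq> q \<and> W \<subseteq> funvec.span {p, q})"

text \<open>
  If \<open>W\<close> is not collinear, residuating at a hyperplane through two of its points leaves, by induction,
  many points on a line; residuating at a hyperplane through that line then leaves too few points.
\<close>

lemma CB_collinear:
  assumes "proj_points r W" "CB r d W" "W \<noteq> {}" "card W \<le> 2 * d + 1"
  shows "collinear_pts W"
  using assms
proof (induction d arbitrary: W)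
  case (0 W) then show ?case using CB_card_ge[of r W 0] by simp
next
  case (Suc d W)
  have fin: "finite W" and WV: "W \<subseteq> vecs r" using Suc by (auto simp: proj_points_def)
  show ?case
  proof (rule ccontr)
    assume nc: "\<not> collinear_pts W"
    have "card W \<ge> 2" using CB_card_ge[OF Suc.prems(1-3)] by simp
    then obtain p q where pq: "p \<in> W" "q \<in> W" "p \<noteq> q"
      using fin by (metis card_2_iff' obtain_subset_with_card_n subsetD)
    then obtain w where w: "w \<in> W" "w \<notin> funvec.span {p, q}" using nc unfolding collinear_pts_def by blast
    have "{p, q} \<subseteq> vecs r" "w \<in> vecs r" using pq w WV by auto
    from lin_separates[OF this w(2)] obtain l where
      l: "\<And>s. s \<in> funvec.span {p, q} \<Longrightarrow> lin r l s = 0" "lin r l w = 1" by blast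
    let ?T = "{w\<in>W. lin r l w \<noteq> 0}"
    have T: "CB r d ?T" "proj_points r ?T" "?T \<noteq> {}"
      using CB_residual[OF fin Suc.prems(2) forms_lin] Suc.prems(1) w l
      by (auto intro: proj_points_subset)
    have "?T \<subseteq> W - {p, q}" using l(1) by (auto intro: funvec.span_base)
    then have "card ?T \<le> card (W - {p, q})" using fin by (intro card_mono) auto
    also have "\<dots> = card W - 2" using pq fin by (subst card_Diff_subset) auto
    finally have "card ?T \<le> 2 * d + 1" using Suc.prems(4) by simp
    with T Suc.IH have "collinear_pts ?T" by blast
    then obtain p' q' where pq': "p' \<in> W" "q' \<in> W" "p' \<noteq> q'" "?T \<subseteq> funvec.span {p', q'}"
      unfolding collinear_pts_def by blast
    then obtain w' where w': "w' \<in> W" "w' \<notin> funvec.span {p', q'}" using nc unfolding collinear_pts_def by blast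
    have "{p', q'} \<subseteq> vecs r" "w' \<in> vecs r" using pq' w' WV by auto
    from lin_separates[OF this w'(2)] obtain l' where
      l': "\<And>s. s \<in> funvec.span {p', q'} \<Longrightarrow> lin r l' s = 0" "lin r l' w' = 1" by blast
    let ?U = "{w\<in>W. lin r l' w \<noteq> 0}"
    have U: "CB r d ?U" "proj_points r ?U" "?U \<noteq> {}"
      using CB_residual[OF fin Suc.prems(2) forms_lin] Suc.prems(1) w' l'
      by (auto intro: proj_points_subset)
    have "?U \<inter> ?T = {}" using pq'(4) l'(1) by auto
    then have "card ?U + card ?T \<le> card W"
      using fin by (subst card_Un_disjoint[symmetric]) (auto intro!: card_mono)
    moreover have "card ?U \<ge> d + 2" by (rule CB_card_ge[OF U(2,1,3)])
    moreover have "card ?T \<ge> d + 2" by (rule CB_card_ge[OF T(2,1,3)])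
    ultimately have "(d + 2) + (d + 2) \<le> card W" by (meson add_mono order_trans)
    then show False using Suc.prems(4) by simp
  qed
qed

section \<open>Lines, plane conics and the quadrics containing them\<close>

text \<open>
  Linear independence is expressed through dual linear forms, which are what the later computations
  use.
\<close>

definition frame2 :: "nat \<Rightarrow> (nat \<Rightarrow> 'a::field) \<Rightarrow> (nat \<Rightarrow> 'a) \<Rightarrow> bool" where
  "frame2 r p q \<longleftrightarrow> p \<in> vecs r \<and> q \<in> vecs r \<and>
     (\<exists>k l. lin r k p = 1 \<and> lin r k q = 0 \<and> lin r l p = 0 \<and> lin r l q = 1)"

definition frame3 :: "nat \<Rightarrow> (nat \<Rightarrow> 'a::field) \<Rightarrow> (nat \<Rightarrow> 'a) \<Rightarrow> (nat \<Rightarrow> 'a) \<Rightarrow> bool" where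
  "frame3 r a b c \<longleftrightarrow> a \<in> vecs r \<and> b \<in> vecs r \<and> c \<in> vecs r \<and>
     (\<exists>k l m. lin r k a = 1 \<and> lin r k b = 0 \<and> lin r k c = 0 \<and>
              lin r l a = 0 \<and> lin r l b = 1 \<and> lin r l c = 0 \<and>
              lin r m a = 0 \<and> lin r m b = 0 \<and> lin r m c = 1)"

text \<open>
  With \<open>a\<close>, \<open>b\<close>, \<open>c\<close> independent this is the affine cone over a smooth plane conic. The equation,
  unlike the parametrisation, gives a set closed under scaling at once.
\<close>

definition conic :: "(nat \<Rightarrow> 'a::field) \<Rightarrow> (nat \<Rightarrow> 'a) \<Rightarrow> (nat \<Rightarrow> 'a) \<Rightarrow> (nat \<Rightarrow> 'a) set" where
  "conic a b c = {fscale x a + fscale y b + fscale z c | x y z. y ^ 2 = x * z}"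

lemma frame2I:
  assumes "p \<in> vecs r" "q \<in> vecs r" "p \<notin> funvec.span {q}" "q \<notin> funvec.span {p}"
  shows "frame2 r p q"
  unfolding frame2_def
  using lin_separates_point[OF assms(2,1,3)] lin_separates_point[OF assms(1,2,4)] assms(1,2) by blast

lemma frame3I:
  assumes v: "a \<in> vecs r" "b \<in> vecs r" "c \<in> vecs r"
    and n: "a \<notin> funvec.span {b, c}" "b \<notin> funvec.span {a, c}" "c \<notin> funvec.span {a, b}"
  shows "frame3 r a b c"
  unfolding frame3_def
  using lin_separates_line[OF v(2,3,1) n(1)] lin_separates_line[OF v(1,3,2) n(2)]
    lin_separates_line[OF v(1,2,3) n(3)] v by blast

lemma proj_points_frame2:
  assumes "proj_points r W" "p \<in> W" "q \<in> W" "p \<noteq> q"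
  shows "frame2 r p q"
proof (rule frame2I)
  show "p \<in> vecs r" "q \<in> vecs r" using assms unfolding proj_points_def by blast+
  show "q \<notin> funvec.span {p}" using assms unfolding proj_points_def by blast
  have "q \<noteq> p" using assms by simp
  then show "p \<notin> funvec.span {q}" using assms unfolding proj_points_def by blast
qed

lemma span_pair_exchange:
  assumes xy: "x \<in> funvec.span {p, q}" "y \<in> funvec.span {p, q}" and x: "x \<noteq> 0" and y: "y \<notin> funvec.span {x}"
  shows "funvec.span {p, q} \<subseteq> funvec.span {x, y}"
proof -
  obtain a b c d where abcd: "x = fscale a p + fscale b q" "y = fscale c p + fscale d q"
    using xy unfolding span_pair by blast
  \<comment> \<open>Cramer's rule: \<open>x\<close> and \<open>y\<close> have an invertible coefficient matrix\<close>
  have 1: "fscale d x + fscale (- b) y = fscale (a * d - b * c) p"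
    "fscale (- c) x + fscale a y = fscale (a * d - b * c) q"
    unfolding abcd by (auto simp: fscale_def fun_eq_iff algebra_simps)
  have nz: "a * d - b * c \<noteq> 0"
  proof
    assume 0: "a * d - b * c = 0"
    show False
    proof (cases "a = 0 \<and> b = 0")
      case True then show False using x abcd by (auto simp: fscale_def fun_eq_iff)
    next
      case False
      have "y = fscale (if a = 0 then d / b else c / a) x"
        unfolding abcd using 0 False by (auto simp: fscale_def fun_eq_iff field_simps)
      then show False using y unfolding span_single by blast
    qed
  qed
  let ?e = "1 / (a * d - b * c)"
  have p: "fscale (?e * d) x + fscale (?e * - b) y = p"
  proof -
    have "fscale (?e * d) x + fscale (?e * - b) y = fscale ?e (fscale d x + fscale (- b) y)"
      by (simp only: funvec.scale_right_distrib funvec.scale_scale)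
    then show ?thesis unfolding 1 using nz by (simp add: fscale_def)
  qed
  have q: "fscale (?e * - c) x + fscale (?e * a) y = q"
  proof -
    have "fscale (?e * - c) x + fscale (?e * a) y = fscale ?e (fscale (- c) x + fscale a y)"
      by (simp only: funvec.scale_right_distrib funvec.scale_scale)
    then show ?thesis unfolding 1 using nz by (simp add: fscale_def)
  qed
  have "p \<in> funvec.span {x, y}" "q \<in> funvec.span {x, y}"
    unfolding span_pair using p q by metis+
  then show ?thesis by (intro funvec.span_minimal funvec.subspace_span) auto
qed

definition two_lines :: "nat \<Rightarrow> (nat \<Rightarrow> 'a::field) set \<Rightarrow> bool" where
  "two_lines r W \<longleftrightarrow> (\<exists>p q p' q'. frame2 r p q \<and> frame2 r p' q' \<and>
     W \<subseteq> funvec.span {p, q} \<union> funvec.span {p', q'})"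

definition on_conic :: "nat \<Rightarrow> (nat \<Rightarrow> 'a::field) set \<Rightarrow> bool" where
  "on_conic r W \<longleftrightarrow> (\<exists>a b c. frame3 r a b c \<and> W \<subseteq> conic a b c)"

lemma two_linesI:
  assumes "frame2 r p q" "frame2 r p' q'" "W \<subseteq> funvec.span {p, q} \<union> funvec.span {p', q'}"
  shows "two_lines r W"
  using assms unfolding two_lines_def by blast

lemma on_conicI: "frame3 r a b c \<Longrightarrow> W \<subseteq> conic a b c \<Longrightarrow> on_conic r W"
  unfolding on_conic_def by blast

lemma two_lines_quadric:
  assumes fr: "frame2 r p q" "frame2 r p' q'" and w: "w \<in> vecs r" "w \<notin> funvec.span {p, q} \<union> funvec.span {p', q'}"
  shows "\<exists>f\<in>forms r 2. (\<forall>x\<in>funvec.span {p, q} \<union> funvec.span {p', q'}. f x = 0) \<and> f w \<noteq> 0"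
proof -
  have "{p, q} \<subseteq> vecs r" "{p', q'} \<subseteq> vecs r" using fr unfolding frame2_def by blast+
  note V = this
  have nw: "w \<notin> funvec.span {p, q}" "w \<notin> funvec.span {p', q'}" using w(2) by blast+
  obtain k where k: "\<forall>s\<in>funvec.span {p, q}. lin r k s = 0" "lin r k w = 1"
    using lin_separates_ex[OF V(1) w(1) nw(1)] by blast
  obtain l where l: "\<forall>s\<in>funvec.span {p', q'}. lin r l s = 0" "lin r l w = 1"
    using lin_separates_ex[OF V(2) w(1) nw(2)] by blast
  have "(\<lambda>x. lin r k x * lin r l x) \<in> forms r (1 + 1)" by (intro forms_mult forms_lin)
  then have "(\<lambda>x. lin r k x * lin r l x) \<in> forms r 2" by (simp add: numeral_2_eq_2)
  then show ?thesis using k l by (intro bexI[of _ "\<lambda>x. lin r k x * lin r l x"]) auto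
qed

lemma conic_quadric:
  assumes fr: "frame3 r a b c" and w: "w \<in> vecs r" "w \<notin> conic a b c"
  shows "\<exists>f\<in>forms r 2. (\<forall>x\<in>conic a b c. f x = 0) \<and> f w \<noteq> 0"
proof (cases "w \<in> funvec.span {a, b, c}")
  case True
  then obtain x y z where xyz: "w = fscale x a + fscale y b + fscale z c" unfolding span_triple by blast
  then have ne: "y ^ 2 \<noteq> x * z" using w unfolding conic_def by blast
  obtain k l m where klm: "lin r k a = 1" "lin r k b = 0" "lin r k c = 0"
    "lin r l a = 0" "lin r l b = 1" "lin r l c = 0" "lin r m a = 0" "lin r m b = 0" "lin r m c = 1"
    using fr unfolding frame3_def by blast
  let ?f = "\<lambda>x. lin r l x * lin r l x + (-1) * (lin r k x * lin r m x)"
  have "?f \<in> forms r (1 + 1)" by (intro forms_add forms_scale forms_mult forms_lin)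
  then have "?f \<in> forms r 2" by (simp add: numeral_2_eq_2)
  moreover have "\<forall>x\<in>conic a b c. ?f x = 0"
    unfolding conic_def by (auto simp: klm power2_eq_square)
  moreover have "?f w \<noteq> 0" using ne by (simp add: xyz klm power2_eq_square)
  ultimately show ?thesis by (intro bexI[of _ ?f] conjI)
next
  case False
  have "{a, b, c} \<subseteq> vecs r" using fr unfolding frame3_def by blast
  then obtain k where k: "\<forall>s\<in>funvec.span {a, b, c}. lin r k s = 0" "lin r k w = 1"
    using lin_separates_ex[OF _ w(1) False] by blast
  have "conic a b c \<subseteq> funvec.span {a, b, c}"
  proof
    fix x assume "x \<in> conic a b c"
    then show "x \<in> funvec.span {a, b, c}" unfolding conic_def span_triple by blast
  qed
  then have "\<forall>x\<in>conic a b c. lin r k x ^ 2 = 0" using k(1) by auto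
  then show ?thesis using forms_lin_power[of r k 2] k(2)
    by (intro bexI[of _ "\<lambda>x. lin r k x ^ 2"]) auto
qed

text \<open>
  Both kinds of configuration are cut out by quadrics. This is all that residuation uses of them.
\<close>

lemma two_lines_or_conic_quadric:
  assumes "two_lines r W \<or> on_conic r W"
  obtains Q where "W \<subseteq> Q" "\<And>w. w \<in> vecs r \<Longrightarrow> w \<notin> Q \<Longrightarrow> \<exists>f\<in>forms r 2. (\<forall>x\<in>Q. f x = 0) \<and> f w \<noteq> 0"
    "\<And>V. V \<subseteq> Q \<Longrightarrow> two_lines r V \<or> on_conic r V"
  using assms
proof
  assume "two_lines r W"
  then obtain p q p' q' where *: "frame2 r p q" "frame2 r p' q'" "W \<subseteq> funvec.span {p, q} \<union> funvec.span {p', q'}"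
    unfolding two_lines_def by blast
  show ?thesis
    by (rule that[of "funvec.span {p, q} \<union> funvec.span {p', q'}"])
      (use * two_lines_quadric[OF *(1,2)] two_linesI in blast)+
next
  assume "on_conic r W"
  then obtain a b c where *: "frame3 r a b c" "W \<subseteq> conic a b c" unfolding on_conic_def by blast
  show ?thesis
    by (rule that[of "conic a b c"]) (use * conic_quadric[OF *(1)] on_conicI in blast)+
qed

text \<open>
  Let \<open>T\<close> be the part of \<open>W\<close> off the hyperplane. If \<open>T\<close> is collinear, it contains so many points that the
  part of \<open>W\<close> off that line is collinear too. Otherwise \<open>T\<close> has at least \<open>2 * d + 2\<close> points, on
  two lines or a conic by induction, and a quadric through \<open>T\<close> missing a point of \<open>W\<close> would leave a
  relation on fewer points than \<open>CB_card_ge\<close> permits.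
\<close>

lemma CB_many_on_hyperplane:
  fixes W :: "(nat \<Rightarrow> 'a::field_char_0) set"
  assumes W: "proj_points r W" "CB r (Suc d) W" "card W < 3 * d + 3"
    and IH: "\<And>T :: (nat \<Rightarrow> 'a) set. proj_points r T \<Longrightarrow> CB r d T \<Longrightarrow> T \<noteq> {} \<Longrightarrow> card T < 3 * d \<Longrightarrow> two_lines r T \<or> on_conic r T"
    and l: "card {w\<in>W. lin r l w = 0} \<ge> 3" "w1 \<in> W" "lin r l w1 \<noteq> 0"
  shows "two_lines r W \<or> on_conic r W"
proof -
  have fin: "finite W" and WV: "W \<subseteq> vecs r" using W(1) unfolding proj_points_def by blast+
  define T where "T = {w\<in>W. lin r l w \<noteq> 0}"
  have TW: "T \<subseteq> W" by (auto simp: T_def)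
  have T: "proj_points r T" "CB r d T" "T \<noteq> {}"
    using proj_points_subset[OF W(1), of T] CB_residual[OF fin W(2) forms_lin[of r l]] l by (auto simp: T_def)
  have "card {w\<in>W. lin r l w = 0} + card T = card W"
    using fin by (subst card_Un_disjoint[symmetric]) (auto simp: T_def intro: arg_cong[where f = card])
  then have Tle: "card T < 3 * d" using l(1) W(3) by simp
  show ?thesis
  proof (cases "card T \<le> 2 * d + 1")
    case True
    have Tge: "card T \<ge> d + 2" by (rule CB_card_ge[OF T])
    obtain p q where pq: "p \<in> T" "q \<in> T" "p \<noteq> q" "T \<subseteq> funvec.span {p, q}"
      using CB_collinear[OF T True] unfolding collinear_pts_def by blast
    have fr: "frame2 r p q" using proj_points_frame2[OF T(1) pq(1-3)] .
    define U where "U = W - funvec.span {p, q}"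
    show ?thesis
    proof (cases "U = {}")
      case True
      then have "W \<subseteq> funvec.span {p, q} \<union> funvec.span {p, q}" by (auto simp: U_def)
      then show ?thesis using fr two_linesI by blast
    next
      case False
      have pqV: "{p, q} \<subseteq> vecs r" using pq WV TW by blast
      have UV: "finite U" "U \<subseteq> vecs r" "U \<inter> funvec.span {p, q} = {}" using fin WV by (auto simp: U_def)
      obtain m where m: "\<And>s. s \<in> funvec.span {p, q} \<Longrightarrow> lin r m s = 0" "\<And>w. w \<in> U \<Longrightarrow> lin r m w \<noteq> 0"
        using lin_separates_many[OF pqV UV] by blast
      have "{w\<in>W. lin r m w \<noteq> 0} = U" using m by (auto simp: U_def)
      then have "CB r d U" using CB_residual[OF fin W(2) forms_lin[of r m]] by simp
      moreover have "proj_points r U" by (rule proj_points_subset[OF W(1)]) (auto simp: U_def)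
      moreover have "card U \<le> 2 * d + 1"
      proof -
        have "card U + card T = card (U \<union> T)"
          using fin pq(4) TW finite_subset[OF TW] by (subst card_Un_disjoint) (auto simp: U_def)
        also have "\<dots> \<le> card W" using fin TW by (intro card_mono) (auto simp: U_def)
        finally show ?thesis using Tge W(3) by linarith
      qed
      ultimately have "collinear_pts U" using CB_collinear False by blast
      then obtain p' q' where pq': "p' \<in> U" "q' \<in> U" "p' \<noteq> q'" "U \<subseteq> funvec.span {p', q'}"
        unfolding collinear_pts_def by blast
      then have "frame2 r p' q'" by (intro proj_points_frame2[OF W(1)]) (auto simp: U_def)
      moreover have "W \<subseteq> funvec.span {p, q} \<union> funvec.span {p', q'}" using pq'(4) by (auto simp: U_def)
      ultimately show ?thesis using fr two_linesI by blast
    qed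
  next
    case False
    obtain Q where Q: "T \<subseteq> Q" "\<And>w. w \<in> vecs r \<Longrightarrow> w \<notin> Q \<Longrightarrow> \<exists>f\<in>forms r 2. (\<forall>x\<in>Q. f x = 0) \<and> f w \<noteq> 0"
      "\<And>V. V \<subseteq> Q \<Longrightarrow> two_lines r V \<or> on_conic r V"
      using two_lines_or_conic_quadric[OF IH[OF T Tle]] by blast
    have "W \<subseteq> Q"
    proof
      fix w assume w: "w \<in> W"
      show "w \<in> Q"
      proof (rule ccontr)
        assume "w \<notin> Q"
        then obtain f where f: "f \<in> forms r 2" "\<forall>x\<in>Q. f x = 0" "f w \<noteq> 0" using Q(2) w WV by blast
        define U where "U = {w\<in>W. f w \<noteq> 0}"
        have "d \<ge> 3" using False Tle by linarith
        then have "CB r (Suc d - 2) U" using CB_residual[OF fin W(2) f(1)] by (simp add: U_def)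
        moreover have "proj_points r U" by (rule proj_points_subset[OF W(1)]) (auto simp: U_def)
        moreover have "U \<noteq> {}" using f w by (auto simp: U_def)
        ultimately have "card U \<ge> (Suc d - 2) + 2" using CB_card_ge by blast
        moreover have "card U + card T = card (U \<union> T)"
          using fin Q(1) f(2) finite_subset[OF TW] by (subst card_Un_disjoint) (auto simp: U_def)
        moreover have "card (U \<union> T) \<le> card W" using fin TW by (intro card_mono) (auto simp: U_def)
        ultimately show False using False W(3) \<open>d \<ge> 3\<close> by linarith
      qed
    qed
    then show ?thesis using Q(3) by blast
  qed
qed

text \<open>
  Restricted to a conic, quadratic forms become binary quartic forms, which have five coefficients.
\<close>

lemma quadrics_on_conic:
  assumes "f \<in> forms r 2"
  shows "\<exists>c. \<forall>x y z. y ^ 2 = x * z \<longrightarrow> f (fscale x u + fscale y v + fscale z w)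
    = (\<Sum>j<5::nat. c j * [x ^ 2, x * y, x * z, y * z, z ^ 2] ! j)"
proof -
  have "(d = 0 \<longrightarrow> (\<exists>k. \<forall>x y z. f (fscale x u + fscale y v + fscale z w) = k)) \<and>
    (d = 1 \<longrightarrow> (\<exists>k l m. \<forall>x y z. f (fscale x u + fscale y v + fscale z w) = k * x + l * y + m * z)) \<and>
    (d = 2 \<longrightarrow> (\<exists>c0 c1 c2 c3 c4. \<forall>x y z. y ^ 2 = x * z \<longrightarrow> f (fscale x u + fscale y v + fscale z w)
      = c0 * x ^ 2 + c1 * (x * y) + c2 * (x * z) + c3 * (y * z) + c4 * z ^ 2))" if "f \<in> forms r d" for d
    using that
  proof (induction rule: forms_induct)
    case (const c) then show ?case by auto
  next
    case (lin_mult f d l)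
    let ?L = "\<lambda>x y z. lin r l (fscale x u + fscale y v + fscale z w)"
    obtain k1 k2 k3 where L: "\<And>x y z. ?L x y z = k1 * x + k2 * y + k3 * z"
      by (rule that[of "lin r l u" "lin r l v" "lin r l w"]) (simp add: mult.commute)
    consider "d = 0" | "d = 1" | "d \<ge> 2" by linarith
    then show ?case
    proof cases
      case 1
      then obtain k where k: "\<And>x y z. f (fscale x u + fscale y v + fscale z w) = k" using lin_mult by blast
      have "\<forall>x y z. (k1 * x + k2 * y + k3 * z) * k = (k1 * k) * x + (k2 * k) * y + (k3 * k) * z"
        by (simp add: algebra_simps)
      then show ?thesis using 1 unfolding L k by simp blast
    next
      case 2
      then obtain l1 l2 l3 where *: "\<And>x y z. f (fscale x u + fscale y v + fscale z w) = l1 * x + l2 * y + l3 * z"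
        using lin_mult by blast
      have "(k1 * x + k2 * y + k3 * z) * (l1 * x + l2 * y + l3 * z) = (k1 * l1) * x\<^sup>2 + (k1 * l2 + k2 * l1) * (x * y)
        + (k1 * l3 + k3 * l1 + k2 * l2) * (x * z) + (k2 * l3 + k3 * l2) * (y * z) + (k3 * l3) * z\<^sup>2" if "y\<^sup>2 = x * z" for x y z
      proof -
        have "(k1 * x + k2 * y + k3 * z) * (l1 * x + l2 * y + l3 * z) = (k1 * l1) * x\<^sup>2 + (k1 * l2 + k2 * l1) * (x * y)
          + (k1 * l3 + k3 * l1) * (x * z) + (k2 * l2) * y\<^sup>2 + (k2 * l3 + k3 * l2) * (y * z) + (k3 * l3) * z\<^sup>2" by algebra
        then show ?thesis unfolding that by (simp add: algebra_simps)
      qed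
      then show ?thesis using 2 unfolding L * by simp blast
    next
      case 3 then show ?thesis by simp
    qed
  next
    case (add f d g)
    show ?case
    proof (intro conjI impI)
      assume "d = 0"
      then obtain k l where "\<And>x y z. f (fscale x u + fscale y v + fscale z w) = k"
        "\<And>x y z. g (fscale x u + fscale y v + fscale z w) = l" using add by blast
      then show "\<exists>k. \<forall>x y z. f (fscale x u + fscale y v + fscale z w) + g (fscale x u + fscale y v + fscale z w) = k"
        by simp
    next
      assume "d = 1"
      then obtain k l m k' l' m' where *: "\<And>x y z. f (fscale x u + fscale y v + fscale z w) = k * x + l * y + m * z"
        "\<And>x y z. g (fscale x u + fscale y v + fscale z w) = k' * x + l' * y + m' * z" using add by metis
      then show "\<exists>k l m. \<forall>x y z. f (fscale x u + fscale y v + fscale z w) + g (fscale x u + fscale y v + fscale z w) = k * x + l * y + m * z"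
        by (intro exI[of _ "k + k'"] exI[of _ "l + l'"] exI[of _ "m + m'"] allI) (simp only: *, simp add: algebra_simps)
    next
      assume "d = 2"
      then obtain a0 a1 a2 a3 a4 where A: "\<And>x y z. y ^ 2 = x * z \<Longrightarrow> f (fscale x u + fscale y v + fscale z w)
        = a0 * x ^ 2 + a1 * (x * y) + a2 * (x * z) + a3 * (y * z) + a4 * z ^ 2" using add.IH(1) by blast
      obtain b0 b1 b2 b3 b4 where B: "\<And>x y z. y ^ 2 = x * z \<Longrightarrow> g (fscale x u + fscale y v + fscale z w)
        = b0 * x ^ 2 + b1 * (x * y) + b2 * (x * z) + b3 * (y * z) + b4 * z ^ 2" using add.IH(2) \<open>d = 2\<close> by blast
      show "\<exists>c0 c1 c2 c3 c4. \<forall>x y z. y ^ 2 = x * z \<longrightarrow> f (fscale x u + fscale y v + fscale z w) + g (fscale x u + fscale y v + fscale z w)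
        = c0 * x ^ 2 + c1 * (x * y) + c2 * (x * z) + c3 * (y * z) + c4 * z ^ 2"
        by (intro exI[of _ "a0 + b0"] exI[of _ "a1 + b1"] exI[of _ "a2 + b2"] exI[of _ "a3 + b3"] exI[of _ "a4 + b4"])
          (intro allI impI, simp only: A B, simp add: algebra_simps)
    qed
  qed
  from this[OF assms] obtain c0 c1 c2 c3 c4 where *: "\<And>x y z. y ^ 2 = x * z \<Longrightarrow> f (fscale x u + fscale y v + fscale z w)
      = c0 * x ^ 2 + c1 * (x * y) + c2 * (x * z) + c3 * (y * z) + c4 * z ^ 2" by blast
  show ?thesis
    by (intro exI[of _ "\<lambda>j. [c0, c1, c2, c3, c4] ! j"]) (simp add: * eval_nat_numeral)
qed

text \<open>
  Six points impose six conditions on a space of dimension five.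
\<close>

lemma six_on_conic_dependent:
  fixes T :: "(nat \<Rightarrow> 'a::field) set"
  assumes T: "finite T" "T \<subseteq> conic a b c" "card T \<ge> 6"
  shows "\<exists>U\<subseteq>T. U \<noteq> {} \<and> CB r 2 U \<and> card U \<le> 6"
proof -
  obtain S where S: "S \<subseteq> T" "card S = 6" "finite S" using T(3) by (rule obtain_subset_with_card_n)
  have "\<forall>w\<in>S. \<exists>x y z. w = fscale x a + fscale y b + fscale z c \<and> y ^ 2 = x * z"
    using S T unfolding conic_def by blast
  then obtain x y z where xyz: "\<And>w. w \<in> S \<Longrightarrow> w = fscale (x w) a + fscale (y w) b + fscale (z w) c \<and> y w ^ 2 = x w * z w"
    by metis
  define M where "M w j = [x w ^ 2, x w * y w, x w * z w, y w * z w, z w ^ 2] ! j" for w j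
  have "\<exists>e. (\<exists>w\<in>S. e w \<noteq> 0) \<and> (\<forall>j\<in>{..<5}. (\<Sum>w\<in>S. e w * M w j) = 0)"
    by (rule nontrivial_solution) (use S in auto)
  then obtain e where e: "\<exists>w\<in>S. e w \<noteq> 0" "\<And>j. j < 5 \<Longrightarrow> (\<Sum>w\<in>S. e w * M w j) = 0" by auto
  have "(\<Sum>w\<in>S. e w * f w) = 0" if f: "f \<in> forms r 2" for f :: "(nat \<Rightarrow> 'a) \<Rightarrow> 'a"
  proof -
    obtain k where k: "\<forall>x y z. y ^ 2 = x * z \<longrightarrow> f (fscale x a + fscale y b + fscale z c)
      = (\<Sum>j<5::nat. k j * [x ^ 2, x * y, x * z, y * z, z ^ 2] ! j)"
      using quadrics_on_conic[OF f, of a b c] by blast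
    have "f w = (\<Sum>j<5. k j * M w j)" if "w \<in> S" for w
      using k xyz[OF that] unfolding M_def by metis
    then have "(\<Sum>w\<in>S. e w * f w) = (\<Sum>w\<in>S. \<Sum>j<5. k j * (e w * M w j))"
      by (intro sum.cong) (auto simp: sum_distrib_left mult_ac)
    also have "\<dots> = (\<Sum>j<5. k j * (\<Sum>w\<in>S. e w * M w j))"
      by (subst sum.swap) (simp add: sum_distrib_left)
    also have "\<dots> = 0" using e(2) by simp
    finally show ?thesis .
  qed
  then have "CB r 2 {w\<in>S. e w \<noteq> 0}" using CB_support[OF S(3)] by blast
  moreover have "card {w\<in>S. e w \<noteq> 0} \<le> card S" using S by (intro card_mono) auto
  ultimately show ?thesis using S e(1) by (intro exI[of _ "{w\<in>S. e w \<noteq> 0}"]) auto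
qed

section \<open>Standard monomials of a finite set in the affine plane\<close>

text \<open>
  The monomials in \<open>x\<close> and \<open>y\<close>, restricted to \<open>W\<close>, are ordered by degree and then by the exponent of \<open>x\<close>.
  A monomial is standard if it is not a combination of smaller ones. The number \<open>hilbert_fun j\<close> of
  standard monomials of degree at most \<open>j\<close> is the affine Hilbert function of \<open>W\<close>.
\<close>

locale affine_points =
  fixes W :: "'b set" and x y :: "'b \<Rightarrow> 'a::field"
  assumes fin: "finite W"
begin

text \<open>
  The exponent of \<open>x\<close> is \<open>k\<close>, that of \<open>y\<close> is \<open>n - k\<close>. The value outside \<open>W\<close> is fixed to be zero,
  since linear dependence is tested on functions.
\<close>

definition mon :: "nat \<Rightarrow> nat \<Rightarrow> 'b \<Rightarrow> 'a" where
  "mon n k = (\<lambda>w. if w \<in> W then x w ^ k * y w ^ (n - k) else 0)"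

definition lower_span :: "nat \<Rightarrow> nat \<Rightarrow> ('b \<Rightarrow> 'a) set" where
  "lower_span n k = funvec.span ({mon n' k' | n' k'. n' < n \<and> k' \<le> n'} \<union> {mon n k' | k'. k' < k})"

definition std_exps :: "nat \<Rightarrow> nat set" where
  "std_exps n = {k. k \<le> n \<and> mon n k \<notin> lower_span n k}"

definition hilbert_fun :: "nat \<Rightarrow> nat" where
  "hilbert_fun j = (\<Sum>n\<le>j. card (std_exps n))"

lemma finite_std_exps [simp]: "finite (std_exps n)"
  by (rule finite_subset[of _ "{..n}"]) (auto simp: std_exps_def)

lemma subspace_mult: "funvec.subspace S \<Longrightarrow> funvec.subspace {f. (\<lambda>w. g w * f w) \<in> S}" for g :: "'b \<Rightarrow> 'a"
proof (rule funvec.subspaceI)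
  assume S: "funvec.subspace S"
  show "0 \<in> {f. (\<lambda>w. g w * f w) \<in> S}" using funvec.subspace_0[OF S] by (simp add: zero_fun_def)
  fix f f' :: "'b \<Rightarrow> 'a" and c assume f: "f \<in> {f. (\<lambda>w. g w * f w) \<in> S}"
  have "fscale c (\<lambda>w. g w * f w) = (\<lambda>w. g w * fscale c f w)" by (simp add: fscale_def fun_eq_iff)
  then show "fscale c f \<in> {f. (\<lambda>w. g w * f w) \<in> S}"
    using funvec.subspace_scale[OF S, of "\<lambda>w. g w * f w" c] f by simp
  assume f': "f' \<in> {f. (\<lambda>w. g w * f w) \<in> S}"
  have "(\<lambda>w. g w * f w) + (\<lambda>w. g w * f' w) = (\<lambda>w. g w * (f + f') w)" by (simp add: fun_eq_iff distrib_left)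
  then show "f + f' \<in> {f. (\<lambda>w. g w * f w) \<in> S}"
    using funvec.subspace_add[OF S, of "\<lambda>w. g w * f w" "\<lambda>w. g w * f' w"] f f' by simp
qed

lemma mult_x_mon: "k \<le> n \<Longrightarrow> (\<lambda>w. x w * mon n k w) = mon (Suc n) (Suc k)"
  by (auto simp: mon_def fun_eq_iff)

lemma mult_y_mon: "k \<le> n \<Longrightarrow> (\<lambda>w. y w * mon n k w) = mon (Suc n) k"
  by (auto simp: mon_def fun_eq_iff Suc_diff_le)

lemma mult_x_lower:
  assumes "k \<le> n" "f \<in> lower_span n k"
  shows "(\<lambda>w. x w * f w) \<in> lower_span (Suc n) (Suc k)"
proof -
  have "lower_span n k \<subseteq> {f. (\<lambda>w. x w * f w) \<in> lower_span (Suc n) (Suc k)}"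
    unfolding lower_span_def[of n k]
  proof (rule funvec.span_minimal)
    show "funvec.subspace {f. (\<lambda>w. x w * f w) \<in> lower_span (Suc n) (Suc k)}"
      by (rule subspace_mult) (simp add: lower_span_def)
    have "mon (Suc n') (Suc k') \<in> lower_span (Suc n) (Suc k)" if "n' < n" "k' \<le> n'" for n' k'
      unfolding lower_span_def using that by (intro funvec.span_base) auto
    moreover have "mon (Suc n) (Suc k') \<in> lower_span (Suc n) (Suc k)" if "k' < k" for k'
      unfolding lower_span_def using that by (intro funvec.span_base) auto
    ultimately show "{mon n' k' |n' k'. n' < n \<and> k' \<le> n'} \<union> {mon n k' |k'. k' < k} \<subseteq>
      {f. (\<lambda>w. x w * f w) \<in> lower_span (Suc n) (Suc k)}"
      using assms(1) by (auto simp: mult_x_mon)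
  qed
  then show ?thesis using assms(2) by blast
qed

lemma mult_y_lower:
  assumes "k \<le> n" "f \<in> lower_span n k"
  shows "(\<lambda>w. y w * f w) \<in> lower_span (Suc n) k"
proof -
  have "lower_span n k \<subseteq> {f. (\<lambda>w. y w * f w) \<in> lower_span (Suc n) k}"
    unfolding lower_span_def[of n k]
  proof (rule funvec.span_minimal)
    show "funvec.subspace {f. (\<lambda>w. y w * f w) \<in> lower_span (Suc n) k}"
      by (rule subspace_mult) (simp add: lower_span_def)
    have "mon (Suc n') k' \<in> lower_span (Suc n) k" if "n' < n" "k' \<le> n'" for n' k'
      unfolding lower_span_def using that by (intro funvec.span_base UnI1 CollectI exI[of _ "Suc n'"] exI[of _ k']) auto
    moreover have "mon (Suc n) k' \<in> lower_span (Suc n) k" if "k' < k" for k'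
      unfolding lower_span_def using that by (intro funvec.span_base) auto
    ultimately show "{mon n' k' |n' k'. n' < n \<and> k' \<le> n'} \<union> {mon n k' |k'. k' < k} \<subseteq>
      {f. (\<lambda>w. y w * f w) \<in> lower_span (Suc n) k}"
      using assms(1) by (auto simp: mult_y_mon)
  qed
  then show ?thesis using assms(2) by blast
qed

lemma std_exps_div_x: "Suc k \<in> std_exps (Suc n) \<Longrightarrow> k \<in> std_exps n"
  using mult_x_lower[of k n "mon n k"] by (auto simp: std_exps_def mult_x_mon)

lemma std_exps_div_y: "k \<in> std_exps (Suc n) \<Longrightarrow> k \<le> n \<Longrightarrow> k \<in> std_exps n"
  using mult_y_lower[of k n "mon n k"] by (auto simp: std_exps_def mult_y_mon)

text \<open>
  This is the special case of Macaulay's bound that governs curves of degree two. Divisors of standard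
  monomials are standard, so three standard exponents in degree \<open>n + 1\<close> produce three in degree \<open>n\<close>,
  unless they are \<open>0, 1, 2\<close> and \<open>n = 1\<close>.
\<close>

lemma card_std_exps_Suc_le_2:
  assumes n: "n \<ge> 2" and le: "card (std_exps n) \<le> 2"
  shows "card (std_exps (Suc n)) \<le> 2"
proof (rule ccontr)
  assume "\<not> ?thesis"
  then have "3 \<le> card (std_exps (Suc n))" by simp
  then obtain T where T: "T \<subseteq> std_exps (Suc n)" "card T = 3" "finite T"
    by (rule obtain_subset_with_card_n)
  have "\<exists>a b c. a < b \<and> b < c \<and> {a, b, c} \<subseteq> std_exps (Suc n)"
  proof -
    have "T \<noteq> {}" using T by auto
    define a where "a = Min T"
    define c where "c = Max T"
    have "a \<in> T" "c \<in> T" using T \<open>T \<noteq> {}\<close> by (auto simp: a_def c_def)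
    have "card (T - {a, c}) \<ge> 1"
      using T card_Diff_subset[of "{a, c}" T] card_insert_le_m1[of 2 "{c}" a] \<open>a \<in> T\<close> \<open>c \<in> T\<close> by (auto simp: card_insert_if)
    then obtain b where b: "b \<in> T - {a, c}" by (metis card.empty equals0I not_one_le_zero)
    then have "a \<le> b" "b \<le> c" using T by (auto simp: a_def c_def)
    then show ?thesis using b \<open>a \<in> T\<close> \<open>c \<in> T\<close> T by (intro exI[of _ a] exI[of _ b] exI[of _ c]) auto
  qed
  then obtain a b c where abc: "a < b" "b < c" "a \<in> std_exps (Suc n)" "b \<in> std_exps (Suc n)" "c \<in> std_exps (Suc n)"
    by blast
  have c: "c \<le> Suc n" using abc by (auto simp: std_exps_def)
  have ab: "a \<in> std_exps n" "b \<in> std_exps n" using abc c by (auto intro!: std_exps_div_y)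
  have only: "k = a \<or> k = b" if "k \<in> std_exps n" for k
  proof (rule ccontr)
    assume "\<not> ?thesis"
    then have "card {a, b, k} = 3" using abc by auto
    moreover have "card {a, b, k} \<le> card (std_exps n)" using ab that by (intro card_mono) auto
    ultimately show False using le by simp
  qed
  have "b - 1 \<in> std_exps n" using std_exps_div_x[of "b - 1" n] abc by simp
  then have b: "b = Suc a" using only abc by force
  have "c - 1 \<in> std_exps n" using std_exps_div_x[of "c - 1" n] abc by simp
  then have c': "c = Suc b" using only abc by force
  have a: "a = 0"
  proof (rule ccontr)
    assume "a \<noteq> 0"
    then have "a - 1 \<in> std_exps n" using std_exps_div_x[of "a - 1" n] abc by simp
    then show False using only \<open>a \<noteq> 0\<close> b by fastforce
  qed
  have "c \<le> n" using n by (simp add: a b c')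
  then have "c \<in> std_exps n" using std_exps_div_y abc by blast
  then show False using only abc by fastforce
qed

definition std_index :: "nat \<Rightarrow> (nat \<times> nat) set" where
  "std_index j = (SIGMA n:{..j}. std_exps n)"

lemma card_std_index: "card (std_index j) = hilbert_fun j"
  unfolding std_index_def hilbert_fun_def by (subst card_SigmaI) auto

lemma finite_std_index [simp]: "finite (std_index j)"
  by (simp add: std_index_def)

lemma mon_in_span_std:
  assumes "k \<le> n" "n \<le> j"
  shows "mon n k \<in> funvec.span ((\<lambda>(n, k). mon n k) ` std_index j)"
  using assms
proof (induction "(n, k)" arbitrary: n k rule: wf_induct_rule[OF wf_lex_prod[OF wf_less_than wf_less_than]])
  case (1 n k)
  let ?S = "funvec.span ((\<lambda>(n, k). mon n k) ` std_index j)"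
  show ?case
  proof (cases "k \<in> std_exps n")
    case True
    then show ?thesis using 1(3) by (intro funvec.span_base) (force simp: std_index_def)
  next
    case False
    then have "mon n k \<in> lower_span n k" using 1 by (auto simp: std_exps_def)
    moreover have "lower_span n k \<subseteq> ?S"
      unfolding lower_span_def
    proof (rule funvec.span_minimal)
      show "{mon n' k' |n' k'. n' < n \<and> k' \<le> n'} \<union> {mon n k' |k'. k' < k} \<subseteq> ?S"
        using 1 by auto
    qed simp
    ultimately show ?thesis by blast
  qed
qed

definition polyfun :: "nat \<Rightarrow> ('b \<Rightarrow> 'a) set" where
  "polyfun j = funvec.span {mon n k | n k. n \<le> j \<and> k \<le> n}"

lemma polyfun_subset_std: "polyfun j \<subseteq> funvec.span ((\<lambda>(n, k). mon n k) ` std_index j)"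
  unfolding polyfun_def by (rule funvec.span_minimal) (auto intro: mon_in_span_std)

lemma polyfun_mono: "i \<le> j \<Longrightarrow> polyfun i \<subseteq> polyfun j"
  unfolding polyfun_def by (rule funvec.span_mono) force

lemma polyfun_mult:
  assumes "f \<in> polyfun j"
  shows "(\<lambda>w. x w * f w) \<in> polyfun (Suc j)" "(\<lambda>w. y w * f w) \<in> polyfun (Suc j)"
proof -
  have m: "mon n k \<in> polyfun (Suc j)" if "n \<le> Suc j" "k \<le> n" for n k
    unfolding polyfun_def using that by (intro funvec.span_base) blast
  have "polyfun j \<subseteq> {f. (\<lambda>w. x w * f w) \<in> polyfun (Suc j)}"
    unfolding polyfun_def[of j]
  proof (rule funvec.span_minimal)
    show "funvec.subspace {f. (\<lambda>w. x w * f w) \<in> polyfun (Suc j)}"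
      by (rule subspace_mult) (simp add: polyfun_def)
  qed (auto simp: mult_x_mon intro!: m)
  then show "(\<lambda>w. x w * f w) \<in> polyfun (Suc j)" using assms by blast
  have "polyfun j \<subseteq> {f. (\<lambda>w. y w * f w) \<in> polyfun (Suc j)}"
    unfolding polyfun_def[of j]
  proof (rule funvec.span_minimal)
    show "funvec.subspace {f. (\<lambda>w. y w * f w) \<in> polyfun (Suc j)}"
      by (rule subspace_mult) (simp add: polyfun_def)
  qed (auto simp: mult_y_mon intro!: m)
  then show "(\<lambda>w. y w * f w) \<in> polyfun (Suc j)" using assms by blast
qed

text \<open>
  In a dependency the largest monomial with a nonzero coefficient would not be standard. The map
  \<open>(n, k) \<mapsto> n * n + k\<close> embeds the monomial order, on the pairs with \<open>k \<le> n\<close>, into the natural numbers.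
\<close>

lemma std_independent:
  assumes z: "\<And>w. w \<in> W \<Longrightarrow> (\<Sum>(n, k)\<in>std_index j. c (n, k) * mon n k w) = 0" and i: "i \<in> std_index j"
  shows "c i = 0"
proof (rule ccontr)
  assume "c i \<noteq> 0"
  define I where "I = {i \<in> std_index j. c i \<noteq> 0}"
  define \<mu> where "\<mu> = (\<lambda>(n, k). n * n + k :: nat)"
  have "i \<in> I" using i \<open>c i \<noteq> 0\<close> unfolding I_def by blast
  then have I: "finite I" "I \<noteq> {}" by (simp add: I_def, blast)
  then have "Max (\<mu> ` I) \<in> \<mu> ` I" by (intro Max_in) auto
  then obtain m where m: "m \<in> I" "\<mu> m = Max (\<mu> ` I)" by auto
  obtain n k where nk: "m = (n, k)" by (cases m)
  have k: "k \<in> std_exps n" "k \<le> n" "c (n, k) \<noteq> 0" using m by (auto simp: I_def nk std_index_def std_exps_def)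
  have smaller: "mon n' k' \<in> lower_span n k" if "(n', k') \<in> I" "(n', k') \<noteq> (n, k)" for n' k'
  proof -
    have k': "k' \<le> n'" using that by (auto simp: I_def std_index_def std_exps_def)
    have "\<mu> (n', k') \<le> \<mu> (n, k)" using that I m nk by simp
    then have le: "n' * n' + k' \<le> n * n + k" by (simp add: \<mu>_def)
    have "n' \<le> n"
    proof (rule ccontr)
      assume "\<not> n' \<le> n"
      then have "Suc n \<le> n'" by simp
      then have "Suc n * Suc n \<le> n' * n'" by (intro mult_le_mono)
      then show False using le k by simp
    qed
    have "k' < k" if "n' = n" using le that \<open>(n', k') \<noteq> (n, k)\<close> by simp
    then consider "n' < n" | "n' = n" "k' < k" using \<open>n' \<le> n\<close> by linarith
    then show ?thesis
    proof cases
      case 1 then show ?thesis unfolding lower_span_def using k' by (intro funvec.span_base) auto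
    next
      case 2 then show ?thesis unfolding lower_span_def by (intro funvec.span_base) auto
    qed
  qed
  have "mon n k = (\<Sum>i\<in>I - {m}. fscale (- c i / c m) ((\<lambda>(n, k). mon n k) i))"
  proof
    fix w
    show "mon n k w = (\<Sum>i\<in>I - {m}. fscale (- c i / c m) ((\<lambda>(n, k). mon n k) i)) w"
    proof (cases "w \<in> W")
      case True
      have "0 = (\<Sum>i\<in>std_index j. c i * (case i of (n, k) \<Rightarrow> mon n k) w)"
        using z[OF True] by (simp add: case_prod_beta)
      also have "\<dots> = (\<Sum>i\<in>I. c i * (case i of (n, k) \<Rightarrow> mon n k) w)"
        unfolding I_def by (rule sum.mono_neutral_right) auto
      also have "\<dots> = c m * mon n k w + (\<Sum>i\<in>I - {m}. c i * (case i of (n, k) \<Rightarrow> mon n k) w)"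
        using sum.remove[OF I(1) m(1), of "\<lambda>i. c i * (case i of (n, k) \<Rightarrow> mon n k) w"] by (simp add: nk)
      finally have *: "c m * mon n k w = - (\<Sum>i\<in>I - {m}. c i * (case i of (n, k) \<Rightarrow> mon n k) w)"
        by (simp add: eq_neg_iff_add_eq_0)
      have "mon n k w = (c m * mon n k w) / c m" using k nk by simp
      also have "\<dots> = (\<Sum>i\<in>I - {m}. (- c i / c m) * (case i of (n, k) \<Rightarrow> mon n k) w)"
        unfolding * by (simp add: sum_divide_distrib sum_negf)
      finally show ?thesis by (simp add: sum_fun_apply fscale_def)
    next
      case False
      then show ?thesis by (auto simp: sum_fun_apply fscale_def mon_def case_prod_beta intro!: sum.neutral[symmetric])
    qed
  qed
  also have "\<dots> \<in> lower_span n k"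
  proof -
    have "(case i of (n, k) \<Rightarrow> mon n k) \<in> lower_span n k" if "i \<in> I - {m}" for i
      using that smaller nk by (cases i) auto
    then show ?thesis
      unfolding lower_span_def by (intro funvec.span_sum funvec.span_scale) auto
  qed
  finally show False using k by (simp add: std_exps_def)
qed

end

section \<open>Plane point sets without three collinear points\<close>

text \<open>
  A hyperplane containing three points of \<open>W\<close> contains all of \<open>W\<close>. For a noncollinear \<open>W\<close> this means that \<open>W\<close>
  lies in a plane and has no three collinear points.
\<close>

definition gen_pos :: "nat \<Rightarrow> (nat \<Rightarrow> 'a::field) set \<Rightarrow> bool" where
  "gen_pos r W \<longleftrightarrow> (\<forall>l. \<forall>p\<in>W. \<forall>q\<in>W. \<forall>s\<in>W. p \<noteq> q \<and> p \<noteq> s \<and> q \<noteq> s \<and>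
     lin r l p = 0 \<and> lin r l q = 0 \<and> lin r l s = 0 \<longrightarrow> (\<forall>w\<in>W. lin r l w = 0))"

lemma three_distinct:
  assumes "card T \<ge> 3"
  shows "\<exists>p\<in>T. \<exists>q\<in>T. \<exists>s\<in>T. p \<noteq> q \<and> p \<noteq> s \<and> q \<noteq> s"
proof -
  obtain U where U: "U \<subseteq> T" "card U = 3" "finite U" using assms by (rule obtain_subset_with_card_n)
  then obtain p q s where "U = {p, q, s}" "p \<noteq> q" "p \<noteq> s" "q \<noteq> s" unfolding card_3_iff by blast
  then show ?thesis using U by blast
qed

locale general_points =
  fixes r :: nat and W :: "(nat \<Rightarrow> 'a::{alg_closed_field, field_char_0}) set"
  assumes pp: "proj_points r W" and gp: "gen_pos r W" and nc: "\<not> collinear_pts W"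
begin

lemma fin: "finite W" and WV: "W \<subseteq> vecs r"
  using pp unfolding proj_points_def by blast+

lemma gpD:
  assumes "p \<in> W" "q \<in> W" "s \<in> W" "p \<noteq> q" "p \<noteq> s" "q \<noteq> s"
    "lin r l p = 0" "lin r l q = 0" "lin r l s = 0" "w \<in> W"
  shows "lin r l w = 0"
  using gp assms unfolding gen_pos_def by blast

lemma not_on_line:
  assumes "p \<in> W" "q \<in> W" "s \<in> W" "p \<noteq> q" "p \<noteq> s" "q \<noteq> s"
  shows "s \<notin> funvec.span {p, q}"
proof
  assume s: "s \<in> funvec.span {p, q}"
  obtain w where w: "w \<in> W" "w \<notin> funvec.span {p, q}"
    using nc assms unfolding collinear_pts_def by blast
  have V: "{p, q} \<subseteq> vecs r" "w \<in> vecs r" using assms w WV by blast+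
  obtain l where l: "\<forall>s\<in>funvec.span {p, q}. lin r l s = 0" "lin r l w = 1"
    using lin_separates_ex[OF V w(2)] by blast
  have "p \<in> funvec.span {p, q}" "q \<in> funvec.span {p, q}" by (auto intro: funvec.span_base)
  then have "lin r l w = 0" using gpD[OF assms _ _ _ w(1)] l(1) s by blast
  then show False using l(2) by simp
qed

lemma collinear_card_le_2:
  assumes T: "T \<subseteq> W" "collinear_pts T"
  shows "card T \<le> 2"
proof (rule ccontr)
  assume "\<not> card T \<le> 2"
  obtain p q where pq: "p \<in> T" "q \<in> T" "p \<noteq> q" "T \<subseteq> funvec.span {p, q}"
    using T unfolding collinear_pts_def by blast
  have "T \<subseteq> {p, q}"
  proof
    fix s assume "s \<in> T"
    then show "s \<in> {p, q}" using not_on_line[of p q s] pq T by blast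
  qed
  then have "card T \<le> card {p, q}" by (intro card_mono) auto
  then show False using \<open>\<not> card T \<le> 2\<close> pq by simp
qed

lemma span_card_le_2:
  assumes T: "T \<subseteq> W" "T \<subseteq> funvec.span {a, b}"
  shows "card T \<le> 2"
proof (rule ccontr)
  assume "\<not> card T \<le> 2"
  then obtain p q s where pqs: "p \<in> T" "q \<in> T" "s \<in> T" "p \<noteq> q" "p \<noteq> s" "q \<noteq> s"
    using three_distinct[of T] by auto
  have "p \<noteq> 0" "q \<notin> funvec.span {p}" using pqs T pp unfolding proj_points_def by blast+
  then have "funvec.span {a, b} \<subseteq> funvec.span {p, q}"
    using pqs T by (intro span_pair_exchange) blast+
  then show False using not_on_line[of p q s] pqs T by blast
qed

lemma two_lines_card_le_4:
  assumes T: "T \<subseteq> W" "two_lines r T"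
  shows "card T \<le> 4"
proof -
  obtain p q p' q' where "T \<subseteq> funvec.span {p, q} \<union> funvec.span {p', q'}"
    using T unfolding two_lines_def by blast
  then have "T = (T \<inter> funvec.span {p, q}) \<union> (T \<inter> funvec.span {p', q'})" by blast
  then have "card T \<le> card (T \<inter> funvec.span {p, q}) + card (T \<inter> funvec.span {p', q'})"
    by (metis card_Un_le)
  moreover have "card (T \<inter> funvec.span {p, q}) \<le> 2" "card (T \<inter> funvec.span {p', q'}) \<le> 2"
    using T by (intro span_card_le_2; blast)+
  ultimately show ?thesis by linarith
qed

text \<open>
  A smaller set would be collinear by \<open>CB_collinear\<close>.
\<close>

lemma CB_card_ge_gen:
  assumes "T \<subseteq> W" "CB r e T" "T \<noteq> {}" "e \<ge> 1"
  shows "card T \<ge> 2 * e + 2"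
proof (rule ccontr)
  assume *: "\<not> ?thesis"
  have T: "proj_points r T" using pp assms(1) by (rule proj_points_subset)
  have "collinear_pts T" by (rule CB_collinear[OF T assms(2,3)]) (use * in linarith)
  then have "card T \<le> 2" using collinear_card_le_2 assms(1) by blast
  moreover have "card T \<ge> e + 2" by (rule CB_card_ge[OF T assms(2,3)])
  ultimately show False using assms(4) by linarith
qed

lemma frame:
  assumes "p \<in> W" "q \<in> W" "s \<in> W" "p \<noteq> q" "p \<noteq> s" "q \<noteq> s"
  shows "frame3 r p q s"
  using assms WV by (intro frame3I not_on_line) auto

lemma in_plane:
  assumes "p \<in> W" "q \<in> W" "s \<in> W" "p \<noteq> q" "p \<noteq> s" "q \<noteq> s" "w \<in> W"
  shows "w \<in> funvec.span {p, q, s}"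
proof (rule ccontr)
  assume w: "w \<notin> funvec.span {p, q, s}"
  have V: "{p, q, s} \<subseteq> vecs r" "w \<in> vecs r" using assms WV by blast+
  obtain l where l: "\<forall>s\<in>funvec.span {p, q, s}. lin r l s = 0" "lin r l w = 1"
    using lin_separates_ex[OF V w] by blast
  have "p \<in> funvec.span {p, q, s}" "q \<in> funvec.span {p, q, s}" "s \<in> funvec.span {p, q, s}"
    by (auto intro: funvec.span_base)
  then have "lin r l w = 0" using gpD[OF assms(1-6) _ _ _ assms(7)] l(1) by blast
  then show False using l(2) by simp
qed

text \<open>
  In coordinates \<open>X, Y, Z\<close> with respect to the first three points, a conic through these has the equation
  \<open>A * Y * Z + B * X * Z + C * X * Y = 0\<close>. The Cremona transformation \<open>(1 / X, 1 / Y, 1 / Z)\<close> maps it to a line,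
  which gives the parametrisation, and the two remaining points determine that line. The coefficients
  are nonzero because no three of the five points are collinear.
\<close>

lemma conic_through_five:
  assumes W: "{p1, p2, p3, p4, p5} \<subseteq> W" and dist: "distinct [p1, p2, p3, p4, p5]"
  shows "\<exists>a b c. frame3 r a b c \<and> {p1, p2, p3, p4, p5} \<subseteq> conic a b c"
proof -
  have d: "p1 \<noteq> p2" "p1 \<noteq> p3" "p2 \<noteq> p3" "p4 \<noteq> p1" "p4 \<noteq> p2" "p4 \<noteq> p3" "p5 \<noteq> p1" "p5 \<noteq> p2" "p5 \<noteq> p3" "p4 \<noteq> p5"
    using dist by auto
  have iW: "p1 \<in> W" "p2 \<in> W" "p3 \<in> W" "p4 \<in> W" "p5 \<in> W" using W by auto
  have "frame3 r p1 p2 p3" by (rule frame) (use d iW in auto)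
  then obtain kX kY kZ where
    X: "lin r kX p1 = 1" "lin r kX p2 = 0" "lin r kX p3 = 0" and
    Y: "lin r kY p1 = 0" "lin r kY p2 = 1" "lin r kY p3 = 0" and
    Z: "lin r kZ p1 = 0" "lin r kZ p2 = 0" "lin r kZ p3 = 1" and V: "p1 \<in> vecs r" "p2 \<in> vecs r" "p3 \<in> vecs r"
    unfolding frame3_def by blast
  define X where "X = lin r kX"
  define Y where "Y = lin r kY"
  define Z where "Z = lin r kZ"
  note XYZ = X[folded X_def] Y[folded Y_def] Z[folded Z_def]
  have coord: "w = fscale (X w) p1 + fscale (Y w) p2 + fscale (Z w) p3" if w: "w \<in> W" for w
  proof -
    have "w \<in> funvec.span {p1, p2, p3}" by (rule in_plane) (use d iW w in auto)
    then obtain a b c where abc: "w = fscale a p1 + fscale b p2 + fscale c p3" unfolding span_triple by blast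
    have "X w = a" "Y w = b" "Z w = c"
      unfolding abc X_def Y_def Z_def by (auto simp: X Y Z)
    then show ?thesis using abc by simp
  qed
  have nzX: "X w \<noteq> 0" if "w \<in> W" "w \<noteq> p2" "w \<noteq> p3" for w
    using gpD[of p2 p3 w kX p1] that iW d X unfolding X_def by auto
  have nzY: "Y w \<noteq> 0" if "w \<in> W" "w \<noteq> p1" "w \<noteq> p3" for w
    using gpD[of p1 p3 w kY p2] that iW d Y unfolding Y_def by auto
  have nzZ: "Z w \<noteq> 0" if "w \<in> W" "w \<noteq> p1" "w \<noteq> p2" for w
    using gpD[of p1 p2 w kZ p3] that iW d Z unfolding Z_def by auto
  have "Y p4 * Z p5 - Z p4 * Y p5 \<noteq> 0"
  proof
    assume *: "Y p4 * Z p5 - Z p4 * Y p5 = 0"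
    let ?l = "\<lambda>j. Y p4 * kZ j - Z p4 * kY j"
    have l: "lin r ?l v = Y p4 * Z v - Z p4 * Y v" for v
      unfolding Y_def Z_def lin_coeff_diff by simp
    have "lin r ?l p2 = 0"
      by (rule gpD[of p1 p4 p5]) (use iW d * in \<open>auto simp: l XYZ\<close>)
    then show False using nzZ[of p4] iW d by (simp add: l XYZ)
  qed
  moreover have "X p4 * Z p5 - Z p4 * X p5 \<noteq> 0"
  proof
    assume *: "X p4 * Z p5 - Z p4 * X p5 = 0"
    let ?l = "\<lambda>j. X p4 * kZ j - Z p4 * kX j"
    have l: "lin r ?l v = X p4 * Z v - Z p4 * X v" for v
      unfolding X_def Z_def lin_coeff_diff by simp
    have "lin r ?l p1 = 0"
      by (rule gpD[of p2 p4 p5]) (use iW d * in \<open>auto simp: l XYZ\<close>)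
    then show False using nzZ[of p4] iW d by (simp add: l XYZ)
  qed
  moreover have "X p4 * Y p5 - Y p4 * X p5 \<noteq> 0"
  proof
    assume *: "X p4 * Y p5 - Y p4 * X p5 = 0"
    let ?l = "\<lambda>j. X p4 * kY j - Y p4 * kX j"
    have l: "lin r ?l v = X p4 * Y v - Y p4 * X v" for v
      unfolding X_def Y_def lin_coeff_diff by simp
    have "lin r ?l p1 = 0"
      by (rule gpD[of p3 p4 p5]) (use iW d * in \<open>auto simp: l XYZ\<close>)
    then show False using nzY[of p4] iW d by (simp add: l XYZ)
  qed
  ultimately obtain A B C where ABC: "A \<noteq> 0" "B \<noteq> 0" "C \<noteq> 0"
    and q4: "A * (Y p4 * Z p4) + B * (X p4 * Z p4) + C * (X p4 * Y p4) = 0"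
    and q5: "A * (Y p5 * Z p5) + B * (X p5 * Z p5) + C * (X p5 * Y p5) = 0"
  proof -
    assume n: "Y p4 * Z p5 - Z p4 * Y p5 \<noteq> 0" "X p4 * Z p5 - Z p4 * X p5 \<noteq> 0" "X p4 * Y p5 - Y p4 * X p5 \<noteq> 0"
    \<comment> \<open>the line through the Cremona images of \<open>p4\<close> and \<open>p5\<close>, as a cross product\<close>
    let ?A = "X p4 * X p5 * (Z p4 * Y p5 - Y p4 * Z p5)"
    let ?B = "Y p4 * Y p5 * (X p4 * Z p5 - Z p4 * X p5)"
    let ?C = "Z p4 * Z p5 * (Y p4 * X p5 - X p4 * Y p5)"
    assume that: "\<And>A B C. A \<noteq> 0 \<Longrightarrow> B \<noteq> 0 \<Longrightarrow> C \<noteq> 0 \<Longrightarrow>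
      A * (Y p4 * Z p4) + B * (X p4 * Z p4) + C * (X p4 * Y p4) = 0 \<Longrightarrow>
      A * (Y p5 * Z p5) + B * (X p5 * Z p5) + C * (X p5 * Y p5) = 0 \<Longrightarrow> thesis"
    show thesis
    proof (rule that[of ?A ?B ?C])
      show "?A \<noteq> 0" "?B \<noteq> 0" "?C \<noteq> 0" using n nzX[of p4] nzX[of p5] nzY[of p4] nzY[of p5] nzZ[of p4] nzZ[of p5] d iW by auto
      show "?A * (Y p4 * Z p4) + ?B * (X p4 * Z p4) + ?C * (X p4 * Y p4) = 0"
        "?A * (Y p5 * Z p5) + ?B * (X p5 * Z p5) + ?C * (X p5 * Y p5) = 0" by algebra+
    qed
  qed
  \<comment> \<open>the parametrisation \<open>X = - A * v * (u + v), Y = - B * u * (u + v), Z = C * u * v\<close>, sorted by monomials in \<open>u\<close> and \<open>v\<close>\<close>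
  define a where "a = fscale (- B) p2"
  define b where "b = fscale (- A) p1 + fscale (- B) p2 + fscale C p3"
  define c where "c = fscale (- A) p1"
  have fr: "frame3 r a b c"
    unfolding frame3_def
  proof (intro conjI)
    show "a \<in> vecs r" "b \<in> vecs r" "c \<in> vecs r" unfolding a_def b_def c_def by (intro vecs_closed V)+
    define k where "k = (\<lambda>j. (- 1 / B) * kY j + (- 1 / C) * kZ j)"
    define l where "l = (\<lambda>j. (1 / C) * kZ j)"
    define m where "m = (\<lambda>j. (- 1 / A) * kX j + (- 1 / C) * kZ j)"
    have klm: "lin r k v = (- 1 / B) * Y v + (- 1 / C) * Z v" "lin r m v = (- 1 / A) * X v + (- 1 / C) * Z v"
      "lin r l v = (1 / C) * Z v" for v
      unfolding X_def Y_def Z_def k_def l_def m_def lin_coeff_add lin_coeff_scale by simp_all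
    have abc: "X a = 0" "Y a = - B" "Z a = 0" "X b = - A" "Y b = - B" "Z b = C" "X c = - A" "Y c = 0" "Z c = 0"
      unfolding a_def b_def c_def X_def Y_def Z_def by (auto simp: X Y Z)
    show "\<exists>k l m. lin r k a = 1 \<and> lin r k b = 0 \<and> lin r k c = 0 \<and>
              lin r l a = 0 \<and> lin r l b = 1 \<and> lin r l c = 0 \<and>
              lin r m a = 0 \<and> lin r m b = 0 \<and> lin r m c = 1"
      by (rule exI[of _ k], rule exI[of _ l], rule exI[of _ m]) (simp add: klm abc ABC)
  qed
  have on: "w \<in> conic a b c" if w: "w \<in> W" and q: "A * (Y w * Z w) + B * (X w * Z w) + C * (X w * Y w) = 0" for w
  proof -
    let ?x = "- Y w / B - Z w / C" and ?y = "Z w / C" and ?z = "- X w / A - Z w / C"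
    have "fscale ?x a + fscale ?y b + fscale ?z c = fscale (X w) p1 + fscale (Y w) p2 + fscale (Z w) p3"
      unfolding a_def b_def c_def using ABC by (auto simp: fscale_def fun_eq_iff field_simps)
    then have "w = fscale ?x a + fscale ?y b + fscale ?z c" using coord[OF w] by simp
    moreover have "?y ^ 2 = ?x * ?z"
    proof -
      have "?x * ?z - ?y ^ 2 = (A * (Y w * Z w) + B * (X w * Z w) + C * (X w * Y w)) / (A * B * C)"
        using ABC by (simp add: field_simps power2_eq_square)
      then show ?thesis using q by simp
    qed
    ultimately show ?thesis unfolding conic_def by blast
  qed
  have "{p1, p2, p3, p4, p5} \<subseteq> conic a b c"
    using on[of p1] on[of p2] on[of p3] on[of p4] on[of p5] iW q4 q5 by (simp add: XYZ)
  then show ?thesis using fr by blast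
qed

text \<open>
  Residuating at the conic through five of the points would leave a relation in degree zero on a
  single point.
\<close>

lemma CB_2_on_conic:
  assumes T: "T \<subseteq> W" "CB r 2 T" "T \<noteq> {}" "card T \<le> 6"
  shows "card T = 6 \<and> on_conic r T"
proof -
  have "card T \<ge> 6" using CB_card_ge_gen[OF T(1-3)] by simp
  then have c6: "card T = 6" using T(4) by simp
  have finT: "finite T" using T fin finite_subset by blast
  obtain xs where xs: "set xs = T" "distinct xs" using finite_distinct_list[OF finT] by blast
  then have "length xs = 6" using c6 distinct_card by fastforce
  then obtain p1 p2 p3 p4 p5 p6 where l: "xs = [p1, p2, p3, p4, p5, p6]"
    by (auto simp: numeral_eq_Suc length_Suc_conv)
  have "{p1, p2, p3, p4, p5} \<subseteq> W" "distinct [p1, p2, p3, p4, p5]" using xs T l by auto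
  from conic_through_five[OF this] obtain a b c
    where abc: "frame3 r a b c" "{p1, p2, p3, p4, p5} \<subseteq> conic a b c" by blast
  have "p6 \<in> conic a b c"
  proof (rule ccontr)
    assume p6: "p6 \<notin> conic a b c"
    have "p6 \<in> vecs r" using xs l T WV by auto
    then obtain f where f: "f \<in> forms r 2" "\<forall>x\<in>conic a b c. f x = 0" "f p6 \<noteq> 0"
      using conic_quadric[OF abc(1) _ p6] by blast
    have U: "{w\<in>T. f w \<noteq> 0} = {p6}" using f abc xs l by auto
    have "CB r 0 {p6}" using CB_residual[OF finT T(2) f(1)] U by simp
    moreover have "proj_points r {p6}" by (rule proj_points_subset[OF pp]) (use xs l T in auto)
    ultimately show False using CB_card_ge[of r "{p6}" 0] by simp
  qed
  then have "T \<subseteq> conic a b c" using abc xs l by auto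
  then show ?thesis using c6 abc on_conicI by blast
qed

text \<open>
  If \<open>W\<close> does not lie on the conic through the six points, its residual set is so small that it lies on
  a second conic by induction. Each of the two residual sets has at least \<open>2 * (d - 2) + 2\<close> points, and
  they are disjoint, which is too much for \<open>W\<close>.
\<close>

lemma CB_on_conic_if_six_on_conic:
  assumes W: "CB r d W" "card W < 3 * d"
    and IH: "\<And>T e. T \<subseteq> W \<Longrightarrow> e < d \<Longrightarrow> CB r e T \<Longrightarrow> T \<noteq> {} \<Longrightarrow> card T < 3 * e \<Longrightarrow> two_lines r T \<or> on_conic r T"
    and T: "T \<subseteq> W" "CB r 2 T" "T \<noteq> {}" "card T \<le> 6"
  shows "on_conic r W"
proof -
  have T6: "card T = 6" "on_conic r T" using CB_2_on_conic[OF T] by auto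
  then obtain a b c where abc: "frame3 r a b c" "T \<subseteq> conic a b c" unfolding on_conic_def by blast
  have "card T \<le> card W" using T fin card_mono by blast
  then have d: "d \<ge> 3" using W T6 by linarith
  show ?thesis
  proof (cases "W \<subseteq> conic a b c")
    case True then show ?thesis using abc on_conicI by blast
  next
    case False
    then obtain w where w: "w \<in> W" "w \<notin> conic a b c" by blast
    then obtain f where f: "f \<in> forms r 2" "\<forall>x\<in>conic a b c. f x = 0" "f w \<noteq> 0"
      using conic_quadric[OF abc(1) _ w(2)] WV by blast
    define U where "U = {w\<in>W. f w \<noteq> 0}"
    have U: "U \<subseteq> W" "CB r (d - 2) U" "U \<noteq> {}"
      using CB_residual[OF fin W(1) f(1)] d w f by (auto simp: U_def)
    have finT: "finite T" "finite U" using T U fin finite_subset by blast+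
    have "card U + card T = card (U \<union> T)"
      using finT f abc by (subst card_Un_disjoint) (auto simp: U_def)
    also have "\<dots> \<le> card W" using fin U T by (intro card_mono) auto
    finally have Ule: "card U < 3 * (d - 2)" using T6 W by linarith
    have Uge: "card U \<ge> 2 * (d - 2) + 2" using CB_card_ge_gen[OF U] d by simp
    then have d5: "d \<ge> 5" using Ule by linarith
    have "two_lines r U \<or> on_conic r U" using IH[OF U(1) _ U(2,3) Ule] d by simp
    moreover have "\<not> two_lines r U" using two_lines_card_le_4[OF U(1)] Uge d5 by linarith
    ultimately obtain a' b' c' where abc': "frame3 r a' b' c'" "U \<subseteq> conic a' b' c'" unfolding on_conic_def by blast
    show ?thesis
    proof (cases "W \<subseteq> conic a' b' c'")
      case True then show ?thesis using abc' on_conicI by blast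
    next
      case False
      then obtain w' where w': "w' \<in> W" "w' \<notin> conic a' b' c'" by blast
      then obtain g where g: "g \<in> forms r 2" "\<forall>x\<in>conic a' b' c'. g x = 0" "g w' \<noteq> 0"
        using conic_quadric[OF abc'(1) _ w'(2)] WV by blast
      define V where "V = {w\<in>W. g w \<noteq> 0}"
      have V: "V \<subseteq> W" "CB r (d - 2) V" "V \<noteq> {}"
        using CB_residual[OF fin W(1) g(1)] d w' g by (auto simp: V_def)
      have Vge: "card V \<ge> 2 * (d - 2) + 2" using CB_card_ge_gen[OF V] d by simp
      have finV: "finite V" using V fin finite_subset by blast
      have "card U + card V = card (U \<union> V)"
        using finT finV g abc' by (subst card_Un_disjoint) (auto simp: V_def)
      also have "\<dots> \<le> card W" using fin U V by (intro card_mono) auto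
      finally show ?thesis using W Uge Vge d5 by linarith
    qed
  qed
qed

end

section \<open>Short relations live on two lines or on a conic\<close>

text \<open>
  The extremal situation, to be excluded: no conic contains six points of \<open>W\<close>. On a smooth cubic, sets of
  \<open>3 * d\<close> points with this property do exist, so the exclusion has to be sharp.
\<close>

locale no_conic_points = general_points r W for r and W :: "(nat \<Rightarrow> 'a::{alg_closed_field, field_char_0}) set" +
  fixes d :: nat
  assumes W: "CB r d W" "W \<noteq> {}" "card W < 3 * d" and d: "d \<ge> 1"
    and IH: "\<And>T e. T \<subseteq> W \<Longrightarrow> e < d \<Longrightarrow> CB r e T \<Longrightarrow> T \<noteq> {} \<Longrightarrow> card T < 3 * e \<Longrightarrow> two_lines r T \<or> on_conic r T"
    and N6: "\<And>T. T \<subseteq> W \<Longrightarrow> CB r 2 T \<Longrightarrow> card T \<le> 6 \<Longrightarrow> T = {}"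
begin

lemma CB_card_ge_3e:
  assumes T: "T \<subseteq> W" "CB r e T" "T \<noteq> {}" and e: "1 \<le> e" "e < d"
  shows "card T \<ge> 3 * e"
proof (rule ccontr)
  assume "\<not> ?thesis"
  then have lt: "card T < 3 * e" by simp
  have ge: "card T \<ge> 2 * e + 2" by (rule CB_card_ge_gen[OF T e(1)])
  have c: "card T \<ge> 6" using lt ge by linarith
  have finT: "finite T" using T fin finite_subset by blast
  have "two_lines r T \<or> on_conic r T" using IH T e lt by blast
  moreover have "\<not> two_lines r T" using two_lines_card_le_4[OF T(1)] c by linarith
  ultimately obtain a b c' where "T \<subseteq> conic a b c'" unfolding on_conic_def by blast
  from six_on_conic_dependent[OF finT this c] show False using N6 T(1) by blast
qed

lemma d_ge_3: "d \<ge> 3" and card_W_ge_6: "card W \<ge> 6"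
  using CB_card_ge_gen[OF order_refl W(1,2) d] W(3) by linarith+

lemma card_W_ge: "card W \<ge> 3 * d - 1"
proof -
  have "card W \<ge> 3" using card_W_ge_6 by linarith
  then obtain p q w where pqw: "p \<in> W" "q \<in> W" "w \<in> W" "p \<noteq> q" "p \<noteq> w" "q \<noteq> w"
    using three_distinct[of W] by blast
  have w: "w \<notin> funvec.span {p, q}" by (rule not_on_line) (use pqw in auto)
  have "p \<in> vecs r" "q \<in> vecs r" "w \<in> vecs r" using pqw WV by auto
  then obtain l where l: "lin r l w = 1" "lin r l p = 0" "lin r l q = 0"
    using lin_separates_line[OF _ _ _ w] by blast
  define T where "T = {w\<in>W. lin r l w \<noteq> 0}"
  have T: "T \<subseteq> W - {p, q}" "T \<noteq> {}" using pqw l by (auto simp: T_def)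
  have "CB r (d - 1) T" using CB_residual[OF fin W(1) forms_lin[of r l]] d by (simp add: T_def)
  moreover have "T \<subseteq> W" using T by blast
  ultimately have "card T \<ge> 3 * (d - 1)" using d_ge_3 T(2) by (intro CB_card_ge_3e) auto
  moreover have "card T \<le> card (W - {p, q})" using T fin by (intro card_mono) auto
  moreover have "card (W - {p, q}) = card W - 2" using pqw fin by (subst card_Diff_subset) auto
  ultimately show ?thesis using d_ge_3 by linarith
qed

text \<open>
  Let \<open>h\<close> be the Hilbert function of \<open>W\<close>. All relations of degree \<open>j < d\<close> inside \<open>W\<close> have at least \<open>3 * j\<close>
  points, whence \<open>h j \<ge> 3 * j - 1\<close>. If \<open>h\<close> fell below \<open>3 * j\<close> after having been at least \<open>3 * (j - 1)\<close>, the
  difference would be at most two, and by \<open>card_std_exps_Suc_le_2\<close> also the next one, contradicting the lower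
  bound in the next degree. So \<open>h (d - 2) \<ge> 3 * (d - 2)\<close>. On the other hand, the relation on \<open>W\<close> pairs degree
  \<open>2\<close> with degree \<open>d - 2\<close>, and six points independent in degree \<open>2\<close> give \<open>h (d - 2) \<le> card W - 6\<close>.
\<close>

lemma no_such_points: False
proof -
  have "card W \<ge> 3" using card_W_ge_6 by linarith
  then obtain p1 p2 p3 where p: "p1 \<in> W" "p2 \<in> W" "p3 \<in> W" "p1 \<noteq> p2" "p1 \<noteq> p3" "p2 \<noteq> p3"
    using three_distinct[of W] by blast
  have "frame3 r p1 p2 p3" by (rule frame) (use p in auto)
  then obtain kX kY kZ where
    X: "lin r kX p1 = 1" "lin r kX p2 = 0" "lin r kX p3 = 0" and
    Y: "lin r kY p1 = 0" "lin r kY p2 = 1" "lin r kY p3 = 0" and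
    Z: "lin r kZ p1 = 0" "lin r kZ p2 = 0" "lin r kZ p3 = 1"
    unfolding frame3_def by blast
  \<comment> \<open>dehomogenise with respect to a line that misses \<open>W\<close>\<close>
  have "W \<inter> funvec.span {} = {}" using pp unfolding proj_points_def funvec.span_empty by blast
  then have "\<exists>m. \<forall>w\<in>W. lin r m w \<noteq> 0"
    using lin_separates_many[of "{}" r W] fin WV by (metis empty_subsetI)
  then obtain m where m: "\<forall>w\<in>W. lin r m w \<noteq> 0" by blast
  define x where "x w = lin r kX w / lin r m w" for w
  define y where "y w = lin r kY w / lin r m w" for w
  interpret affine_points W x y by standard (rule fin)
  have lin_xy: "\<exists>\<alpha> \<beta> \<gamma>. \<forall>w\<in>W. lin r l w = lin r m w * (\<alpha> * x w + \<beta> * y w + \<gamma>)" for l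
  proof -
    define c where "c = lin r l p3 / lin r m p3"
    have m3: "lin r m p3 \<noteq> 0" using m p by blast
    have "lin r l w = lin r m w * ((lin r l p1 - c * lin r m p1) * x w + (lin r l p2 - c * lin r m p2) * y w + c)"
      if w: "w \<in> W" for w
    proof -
      have "w \<in> funvec.span {p1, p2, p3}" by (rule in_plane) (use p w in auto)
      then obtain e f g where efg: "w = fscale e p1 + fscale f p2 + fscale g p3" unfolding span_triple by blast
      have XY: "lin r kX w = e" "lin r kY w = f" unfolding efg by (auto simp: X Y)
      have mw: "lin r m w = e * lin r m p1 + f * lin r m p2 + g * lin r m p3" unfolding efg by simp
      have "lin r m w \<noteq> 0" using m w by blast
      then have "lin r m w * ((lin r l p1 - c * lin r m p1) * x w + (lin r l p2 - c * lin r m p2) * y w + c)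
        = (lin r l p1 - c * lin r m p1) * e + (lin r l p2 - c * lin r m p2) * f + c * lin r m w"
        by (simp add: x_def y_def XY distrib_left)
      also have "\<dots> = e * lin r l p1 + f * lin r l p2 + g * (c * lin r m p3)"
        unfolding mw by (simp add: algebra_simps)
      also have "c * lin r m p3 = lin r l p3" using m3 by (simp add: c_def)
      also have "e * lin r l p1 + f * lin r l p2 + g * lin r l p3 = lin r l w" unfolding efg by simp
      finally show ?thesis by simp
    qed
    then show ?thesis by blast
  qed
  have form_poly: "(\<lambda>w. if w \<in> W then f w / lin r m w ^ j else 0) \<in> polyfun j" if "f \<in> forms r j" for f j
    using that
  proof (induction rule: forms_induct)
    case (const c)
    have "fscale c (mon 0 0) \<in> polyfun 0"
      unfolding polyfun_def by (intro funvec.span_scale funvec.span_base) blast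
    moreover have "fscale c (mon 0 0) = (\<lambda>w. if w \<in> W then c / lin r m w ^ 0 else 0)"
      by (auto simp: fscale_def mon_def)
    ultimately show ?case by simp
  next
    case (lin_mult f j l)
    define g where "g = (\<lambda>w. if w \<in> W then f w / lin r m w ^ j else 0)"
    obtain \<alpha> \<beta> \<gamma> where L: "\<forall>w\<in>W. lin r l w = lin r m w * (\<alpha> * x w + \<beta> * y w + \<gamma>)" using lin_xy by blast
    have g: "g \<in> polyfun j" using lin_mult by (simp add: g_def)
    then have "fscale \<alpha> (\<lambda>w. x w * g w) + fscale \<beta> (\<lambda>w. y w * g w) + fscale \<gamma> g \<in> polyfun (Suc j)"
      using polyfun_mult[OF g] polyfun_mono[of j "Suc j"] unfolding polyfun_def
      by (intro funvec.span_add funvec.span_scale) auto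
    moreover have "fscale \<alpha> (\<lambda>w. x w * g w) + fscale \<beta> (\<lambda>w. y w * g w) + fscale \<gamma> g
      = (\<lambda>w. if w \<in> W then lin r l w * f w / lin r m w ^ Suc j else 0)"
      using m by (auto simp: fun_eq_iff fscale_def g_def L field_simps)
    ultimately show ?case by simp
  next
    case (add f j g)
    then have "(\<lambda>w. if w \<in> W then f w / lin r m w ^ j else 0) + (\<lambda>w. if w \<in> W then g w / lin r m w ^ j else 0) \<in> polyfun j"
      unfolding polyfun_def by (intro funvec.span_add)
    moreover have "(\<lambda>w. if w \<in> W then f w / lin r m w ^ j else 0) + (\<lambda>w. if w \<in> W then g w / lin r m w ^ j else 0)
      = (\<lambda>w. if w \<in> W then (f w + g w) / lin r m w ^ j else 0)"
      by (auto simp: fun_eq_iff add_divide_distrib)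
    ultimately show ?case by simp
  qed
  have mon_form: "\<exists>G\<in>forms r j. \<forall>w\<in>W. G w = lin r m w ^ j * mon n k w" if "k \<le> n" "n \<le> j" for n k j
  proof -
    let ?G = "\<lambda>w. lin r kX w ^ k * lin r kY w ^ (n - k) * lin r m w ^ (j - n)"
    have "?G \<in> forms r (k + (n - k) + (j - n))" by (intro forms_mult forms_lin_power)
    then have "?G \<in> forms r j" using that by simp
    moreover have "?G w = lin r m w ^ j * mon n k w" if w: "w \<in> W" for w
    proof -
      have mw: "lin r m w \<noteq> 0" using m w by blast
      have "j = k + (n - k) + (j - n)" using \<open>k \<le> n\<close> \<open>n \<le> j\<close> by simp
      then have "lin r m w ^ j = lin r m w ^ k * lin r m w ^ (n - k) * lin r m w ^ (j - n)"
        by (metis power_add)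
      then show ?thesis using w mw by (simp add: mon_def x_def y_def power_divide)
    qed
    ultimately show ?thesis by (intro bexI[of _ ?G] ballI)
  qed
  \<comment> \<open>independent points are at most as many as functions separating them\<close>
  have lower: "card T \<le> hilbert_fun j" if T: "T \<subseteq> W" and indep: "\<And>U. U \<subseteq> T \<Longrightarrow> CB r j U \<Longrightarrow> U = {}" for T j
  proof (rule ccontr)
    assume "\<not> ?thesis"
    then have lt: "card (std_index j) < card T" by (simp add: card_std_index)
    have finT: "finite T" using T fin finite_subset by blast
    obtain c where c: "\<exists>w\<in>T. c w \<noteq> 0" "\<forall>i\<in>std_index j. (\<Sum>w\<in>T. c w * (case i of (n, k) \<Rightarrow> mon n k w)) = 0"
      using nontrivial_solution[OF finite_std_index finT lt, where M = "\<lambda>w i. case i of (n, k) \<Rightarrow> mon n k w"]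
      by (elim exE conjE) (rule that)
    have "funvec.span ((\<lambda>(n, k). mon n k) ` std_index j) \<subseteq> {f. (\<Sum>w\<in>T. c w * f w) = 0}"
    proof (rule funvec.span_minimal)
      show "funvec.subspace {f. (\<Sum>w\<in>T. c w * f w) = 0}"
      proof (rule funvec.subspaceI)
        fix f g and e :: 'a
        assume f: "f \<in> {f. (\<Sum>w\<in>T. c w * f w) = 0}"
        then show "fscale e f \<in> {f. (\<Sum>w\<in>T. c w * f w) = 0}"
          by (simp add: fscale_def mult.left_commute[of _ e] sum_distrib_left[symmetric])
        assume "g \<in> {f. (\<Sum>w\<in>T. c w * f w) = 0}"
        then show "f + g \<in> {f. (\<Sum>w\<in>T. c w * f w) = 0}"
          using f by (simp add: distrib_left sum.distrib)
      qed simp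
      show "(\<lambda>(n, k). mon n k) ` std_index j \<subseteq> {f. (\<Sum>w\<in>T. c w * f w) = 0}"
        using c(2) by force
    qed
    then have z: "(\<Sum>w\<in>T. c w * f w) = 0" if "f \<in> polyfun j" for f using that polyfun_subset_std by blast
    have "\<forall>f\<in>forms r j. (\<Sum>w\<in>T. (c w / lin r m w ^ j) * f w) = 0"
    proof
      fix f :: "(nat \<Rightarrow> 'a) \<Rightarrow> 'a" assume "f \<in> forms r j"
      from z[OF form_poly[OF this]] have "(\<Sum>w\<in>T. c w * (if w \<in> W then f w / lin r m w ^ j else 0)) = 0" .
      moreover have "(\<Sum>w\<in>T. c w * (if w \<in> W then f w / lin r m w ^ j else 0)) = (\<Sum>w\<in>T. (c w / lin r m w ^ j) * f w)"
        using T by (intro sum.cong) auto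
      ultimately show "(\<Sum>w\<in>T. (c w / lin r m w ^ j) * f w) = 0" by simp
    qed
    from CB_support[OF finT this] have "{w\<in>T. c w / lin r m w ^ j \<noteq> 0} = {}" by (intro indep) auto
    then show False using c(1) m T by auto
  qed
  \<comment> \<open>a form of degree \<open>d - a\<close> vanishing off \<open>T\<close> makes \<open>T\<close> carry a relation of degree \<open>a\<close>, so it vanishes on all of \<open>W\<close>\<close>
  have upper: "hilbert_fun (d - a) \<le> card W - card T"
    if T: "T \<subseteq> W" and a: "a \<le> d" and indep: "\<And>U. U \<subseteq> T \<Longrightarrow> CB r a U \<Longrightarrow> U = {}" for T a
  proof (rule ccontr)
    assume "\<not> ?thesis"
    moreover have finT: "finite T" using T fin finite_subset by blast
    ultimately have lt: "card (W - T) < card (std_index (d - a))"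
      using T by (simp add: card_std_index card_Diff_subset)
    obtain c where c: "\<exists>i\<in>std_index (d - a). c i \<noteq> 0"
      "\<forall>w\<in>W - T. (\<Sum>i\<in>std_index (d - a). c i * (case i of (n, k) \<Rightarrow> mon n k w)) = 0"
      using nontrivial_solution[OF finite_Diff[OF fin] finite_std_index lt, where M = "\<lambda>i w. case i of (n, k) \<Rightarrow> mon n k w"]
      by (elim exE conjE) (rule that)
    have "\<forall>i\<in>std_index (d - a). \<exists>G\<in>forms r (d - a). \<forall>w\<in>W. G w = lin r m w ^ (d - a) * (case i of (n, k) \<Rightarrow> mon n k w)"
      using mon_form by (auto simp: std_index_def std_exps_def)
    then obtain G where G: "\<And>i. i \<in> std_index (d - a) \<Longrightarrow> G i \<in> forms r (d - a)"
      "\<And>i w. i \<in> std_index (d - a) \<Longrightarrow> w \<in> W \<Longrightarrow> G i w = lin r m w ^ (d - a) * (case i of (n, k) \<Rightarrow> mon n k w)"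
      by metis
    define F where "F = (\<lambda>w. \<Sum>i\<in>std_index (d - a). c i * G i w)"
    have F: "F \<in> forms r (d - a)" unfolding F_def by (intro forms_sum forms_scale G)
    have Fw: "F w = lin r m w ^ (d - a) * (\<Sum>i\<in>std_index (d - a). c i * (case i of (n, k) \<Rightarrow> mon n k w))" if "w \<in> W" for w
      unfolding F_def sum_distrib_left using G(2)[OF _ that] by (intro sum.cong) (auto simp: mult_ac)
    have "CB r (d - (d - a)) {w\<in>W. F w \<noteq> 0}" by (rule CB_residual[OF fin W(1) F]) simp
    then have "CB r a {w\<in>W. F w \<noteq> 0}" using a by simp
    moreover have "{w\<in>W. F w \<noteq> 0} \<subseteq> T"
    proof
      fix w assume w: "w \<in> {w\<in>W. F w \<noteq> 0}"
      show "w \<in> T"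
      proof (rule ccontr)
        assume "w \<notin> T"
        then have "F w = 0" using Fw[of w] c(2) w by simp
        then show False using w by simp
      qed
    qed
    ultimately have e: "{w\<in>W. F w \<noteq> 0} = {}" using indep by blast
    have "(\<Sum>(n, k)\<in>std_index (d - a). c (n, k) * mon n k w) = 0" if w: "w \<in> W" for w
    proof -
      have "F w = 0" using e w by blast
      then have "(\<Sum>i\<in>std_index (d - a). c i * (case i of (n, k) \<Rightarrow> mon n k w)) = 0" using Fw[OF w] m w by simp
      then show ?thesis by (simp add: case_prod_beta)
    qed
    then show False using std_independent c(1) by blast
  qed
  have small: "U = {}" if "U \<subseteq> T" "T \<subseteq> W" "card T < 3 * j" "1 \<le> j" "j < d" "CB r j U" for U T j
  proof (rule ccontr)
    assume "U \<noteq> {}"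
    then have "card U \<ge> 3 * j" using CB_card_ge_3e[of U j] that by blast
    moreover have "card U \<le> card T" using that fin by (meson card_mono finite_subset)
    ultimately show False using that by linarith
  qed
  have h: "hilbert_fun j \<ge> 3 * j - 1" if j: "1 \<le> j" "j < d" for j
  proof -
    have "3 * j - 1 \<le> card W" using card_W_ge j by linarith
    \<comment> \<open>a set of \<open>3 * j - 1\<close> points carries no relation of degree \<open>j\<close>\<close>
    then obtain T where T: "T \<subseteq> W" "card T = 3 * j - 1" by (rule obtain_subset_with_card_n)
    have "card T < 3 * j" using T j by linarith
    then have "card T \<le> hilbert_fun j" by (intro lower[OF T(1)]) (rule small[OF _ T(1) _ j])
    then show ?thesis using T by simp
  qed
  obtain T3 where T3: "T3 \<subseteq> W" "card T3 = 3" using \<open>card W \<ge> 3\<close> by (rule obtain_subset_with_card_n)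
  have h1: "hilbert_fun 1 \<ge> 3"
  proof -
    have "card T3 \<le> hilbert_fun 1"
    proof (rule lower[OF T3(1)])
      fix U assume U: "U \<subseteq> T3" "CB r 1 U"
      show "U = {}"
      proof (rule ccontr)
        assume "U \<noteq> {}"
        then have "card U \<ge> 2 * 1 + 2" using CB_card_ge_gen[of U 1] U T3 by auto
        moreover have "card U \<le> card T3" using U T3 fin by (meson card_mono finite_subset)
        ultimately show False using T3 by linarith
      qed
    qed
    then show ?thesis using T3 by simp
  qed
  \<comment> \<open>two consecutive differences of at most two would contradict the lower bound\<close>
  have grow: "hilbert_fun j \<ge> 3 * j" if "1 \<le> j" "j \<le> d - 2" for j
    using that
  proof (induction j rule: dec_induct)
    case base then show ?case using h1 by simp
  next
    case (step j)
    show ?case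
    proof (rule ccontr)
      assume *: "\<not> ?thesis"
      have hS: "hilbert_fun (Suc n) = hilbert_fun n + card (std_exps (Suc n))" for n by (simp add: hilbert_fun_def)
      have "hilbert_fun j \<ge> 3 * j" using step by simp
      then have "card (std_exps (Suc j)) \<le> 2" using * hS[of j] by simp
      then have "card (std_exps (Suc (Suc j))) \<le> 2" using step by (intro card_std_exps_Suc_le_2[of "Suc j"]) auto
      then have "hilbert_fun (Suc (Suc j)) \<le> 3 * j + 4" using * hS[of "Suc j"] by simp
      moreover have "hilbert_fun (Suc (Suc j)) \<ge> 3 * Suc (Suc j) - 1" using step by (intro h) auto
      ultimately show False by simp
    qed
  qed
  obtain T6 where T6: "T6 \<subseteq> W" "card T6 = 6" using card_W_ge_6 by (rule obtain_subset_with_card_n)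
  have "hilbert_fun (d - 2) \<le> card W - card T6"
  proof (rule upper[OF T6(1)])
    fix U assume U: "U \<subseteq> T6" "CB r 2 U"
    then have "card U \<le> card T6" using T6 fin by (meson card_mono finite_subset)
    then show "U = {}" using N6[of U] U T6 by simp
  qed (use d_ge_3 in simp)
  then show False using grow[of "d - 2"] T6 W(3) d_ge_3 card_W_ge by linarith
qed

end

lemma CB_two_lines_or_conic:
  fixes W :: "(nat \<Rightarrow> 'a::{alg_closed_field, field_char_0}) set"
  assumes "proj_points r W" "CB r d W" "W \<noteq> {}" "card W < 3 * d"
  shows "two_lines r W \<or> on_conic r W"
  using assms
proof (induction d arbitrary: W rule: less_induct)
  case (less d W)
  have fin: "finite W" and WV: "W \<subseteq> vecs r" using less.prems(1) unfolding proj_points_def by blast+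
  obtain e where e: "d = Suc e" using less.prems(4) by (cases d) auto
  have IH: "two_lines r T \<or> on_conic r T" if "T \<subseteq> W" "e' < d" "CB r e' T" "T \<noteq> {}" "card T < 3 * e'" for T e'
    using less.IH[of e' T] that proj_points_subset[OF less.prems(1)] by blast
  show ?case
  proof (cases "collinear_pts W")
    case True
    then obtain p q where pq: "p \<in> W" "q \<in> W" "p \<noteq> q" "W \<subseteq> funvec.span {p, q}" unfolding collinear_pts_def by blast
    have fr: "frame2 r p q" by (rule proj_points_frame2[OF less.prems(1) pq(1-3)])
    have "W \<subseteq> funvec.span {p, q} \<union> funvec.span {p, q}" using pq(4) by blast
    then show ?thesis using two_linesI[OF fr fr] by blast
  next
    case nc: False
    show ?thesis
    proof (cases "gen_pos r W")
      case True
      interpret general_points r W by standard (use less.prems True nc in auto)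
      show ?thesis
      proof (cases "\<exists>T\<subseteq>W. CB r 2 T \<and> T \<noteq> {} \<and> card T \<le> 6")
        case True
        then obtain T where T: "T \<subseteq> W" "CB r 2 T" "T \<noteq> {}" "card T \<le> 6" by blast
        have "on_conic r W" by (rule CB_on_conic_if_six_on_conic[OF less.prems(2,4) IH T])
        then show ?thesis by blast
      next
        case False
        interpret no_conic_points r W d
          by standard (use less.prems IH False e in auto)
        show ?thesis using no_such_points by blast
      qed
    next
      case False
      then obtain l p q s w where l: "p \<in> W" "q \<in> W" "s \<in> W" "p \<noteq> q" "p \<noteq> s" "q \<noteq> s"
        "lin r l p = 0" "lin r l q = 0" "lin r l s = 0" "w \<in> W" "lin r l w \<noteq> 0"
        unfolding gen_pos_def by blast
      have "card {p, q, s} \<le> card {w\<in>W. lin r l w = 0}"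
        using l fin by (intro card_mono) auto
      then have c: "card {w\<in>W. lin r l w = 0} \<ge> 3" using l by simp
      have lt: "card W < 3 * e + 3" using less.prems(4) e by simp
      show ?thesis
        by (rule CB_many_on_hyperplane[OF less.prems(1) less.prems(2)[unfolded e] lt _ c l(10,11)])
          (use less.IH[of e] e in blast)
    qed
  qed
qed

section \<open>Pencils of univariate polynomials\<close>

definition root_poly :: "'a::idom set \<Rightarrow> 'a poly" where
  "root_poly A = (\<Prod>a\<in>A. [:- a, 1:])"

lemma poly_root_poly: "poly (root_poly A) x = (\<Prod>a\<in>A. x - a)"
  by (simp add: root_poly_def poly_prod)

lemma root_poly_zero_iff: "finite A \<Longrightarrow> poly (root_poly A) x = 0 \<longleftrightarrow> x \<in> A"
  by (auto simp: poly_root_poly)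

lemma degree_root_poly: "degree (root_poly A) = card A"
  unfolding root_poly_def by (subst degree_prod_sum_eq) auto

lemma coeff_root_poly: "coeff (root_poly A) (card A) = 1"
  using lead_coeff_prod[of "\<lambda>a. [:- a, 1:]" A] by (simp add: degree_root_poly[symmetric] root_poly_def)

definition lagrange :: "'a::field set \<Rightarrow> 'a \<Rightarrow> 'a poly" where
  "lagrange R \<rho> = smult (1 / (\<Prod>\<sigma>\<in>R - {\<rho>}. \<rho> - \<sigma>)) (root_poly (R - {\<rho>}))"

definition lagrange_weight :: "'a::field set \<Rightarrow> 'a \<Rightarrow> 'a" where
  "lagrange_weight R \<rho> = 1 / (\<Prod>\<sigma>\<in>R - {\<rho>}. \<rho> - \<sigma>)"

lemma lagrange_weight_nonzero: "finite R \<Longrightarrow> lagrange_weight R \<rho> \<noteq> 0"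
  by (auto simp: lagrange_weight_def)

lemma poly_lagrange:
  assumes "finite R" "\<rho> \<in> R" "x \<in> R"
  shows "poly (lagrange R \<rho>) x = (if x = \<rho> then 1 else 0)"
  using assms by (auto simp: lagrange_def poly_root_poly)

lemma lagrange_interpolation:
  assumes R: "finite R" and p: "degree p < card R"
  shows "p = (\<Sum>\<rho>\<in>R. smult (poly p \<rho>) (lagrange R \<rho>))"
proof (rule poly_eqI_degree[of R])
  fix x assume x: "x \<in> R"
  have "poly (\<Sum>\<rho>\<in>R. smult (poly p \<rho>) (lagrange R \<rho>)) x = (\<Sum>\<rho>\<in>R. if x = \<rho> then poly p \<rho> else 0)"
    unfolding poly_sum using R x by (intro sum.cong) (auto simp: poly_lagrange)
  also have "\<dots> = poly p x" using R x by simp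
  finally show "poly p x = poly (\<Sum>\<rho>\<in>R. smult (poly p \<rho>) (lagrange R \<rho>)) x" by simp
next
  have "degree (smult (poly p \<rho>) (lagrange R \<rho>)) \<le> card R - 1" if "\<rho> \<in> R" for \<rho>
    using that R by (intro order.trans[OF degree_smult_le]) (auto simp: lagrange_def degree_root_poly)
  then have "degree (\<Sum>\<rho>\<in>R. smult (poly p \<rho>) (lagrange R \<rho>)) \<le> card R - 1"
    by (intro degree_sum_le R)
  then show "card R > degree (\<Sum>\<rho>\<in>R. smult (poly p \<rho>) (lagrange R \<rho>))" using p by linarith
qed (rule p)

text \<open>
  Compare the coefficients of degree \<open>card R - 1\<close> in the interpolation of \<open>x ^ n\<close>. The weight of \<open>\<rho>\<close> is the
  inverse of the derivative of \<open>root_poly R\<close> at \<open>\<rho>\<close>.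
\<close>

lemma weighted_power_sum_small:
  assumes R: "finite R" and n: "n < card R"
  shows "(\<Sum>\<rho>\<in>R. lagrange_weight R \<rho> * \<rho> ^ n) = (if Suc n = card R then 1 else 0)"
proof -
  have d: "degree (monom (1::'a) n) < card R" using n by (simp add: degree_monom_eq)
  have lc: "coeff (lagrange R \<rho>) (card R - 1) = lagrange_weight R \<rho>" if "\<rho> \<in> R" for \<rho>
  proof -
    have "card (R - {\<rho>}) = card R - 1" using that R by simp
    then show ?thesis using coeff_root_poly[of "R - {\<rho>}"] by (simp add: lagrange_def lagrange_weight_def)
  qed
  have "coeff (monom 1 n) (card R - 1) = (\<Sum>\<rho>\<in>R. \<rho> ^ n * coeff (lagrange R \<rho>) (card R - 1))"
    by (subst lagrange_interpolation[OF R d]) (simp add: coeff_sum poly_monom)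
  also have "\<dots> = (\<Sum>\<rho>\<in>R. lagrange_weight R \<rho> * \<rho> ^ n)"
  proof (intro sum.cong refl)
    fix \<rho> assume "\<rho> \<in> R"
    show "\<rho> ^ n * coeff (lagrange R \<rho>) (card R - 1) = lagrange_weight R \<rho> * \<rho> ^ n"
      unfolding lc[OF \<open>\<rho> \<in> R\<close>] by (rule mult.commute)
  qed
  finally have "(\<Sum>\<rho>\<in>R. lagrange_weight R \<rho> * \<rho> ^ n) = coeff (monom 1 n) (card R - 1)" by simp
  moreover have "n = card R - 1 \<longleftrightarrow> Suc n = card R" using n by linarith
  ultimately show ?thesis by (simp only: coeff_monom)
qed

lemma card_roots_eq_degree:
  fixes p :: "'a::{alg_closed_field, field_char_0} poly"
  assumes p: "p \<noteq> 0" and s: "\<And>x. poly p x = 0 \<Longrightarrow> poly (pderiv p) x \<noteq> 0"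
  shows "card {x. poly p x = 0} = degree p"
proof -
  obtain A where A: "size A = degree p" "p = smult (lead_coeff p) (\<Prod>x\<in>#A. [:-x, 1:])"
    using alg_closed_imp_factorization[OF p] by blast
  have cnt: "count A x \<le> 1" for x
  proof (rule ccontr)
    assume "\<not> ?thesis"
    then have "{#x, x#} \<subseteq># A" by (auto simp: subseteq_mset_def)
    then obtain B where B: "A = {#x, x#} + B" by (metis subset_mset.le_iff_add)
    have "(\<Prod>x\<in>#A. [:-x, 1:]) = [:-x, 1:] * ([:-x, 1:] * (\<Prod>x\<in>#B. [:-x, 1:]))"
      by (simp add: B del: mult_pCons_left)
    then have "p = [:-x, 1:] * ([:-x, 1:] * smult (lead_coeff p) (\<Prod>x\<in>#B. [:-x, 1:]))"
      using A(2) by (simp only: mult_smult_right)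
    then obtain q where q: "p = [:-x, 1:] * ([:-x, 1:] * q)" by blast
    have "poly p x = 0" "poly (pderiv p) x = 0"
      by (subst q, simp) (subst q, simp only: pderiv_mult poly_add poly_mult, simp)
    then show False using s by blast
  qed
  have "{x. poly p x = 0} = set_mset A"
    using p by (subst A(2)) (auto simp: poly_prod_mset prod_mset_zero_iff)
  moreover have "card (set_mset A) = size A"
  proof -
    have "size A = (\<Sum>x\<in>set_mset A. count A x)" by (simp add: size_multiset_overloaded_eq)
    also have "\<dots> = (\<Sum>x\<in>set_mset A. 1)"
    proof (rule sum.cong)
      fix x assume "x \<in> set_mset A"
      then have "count A x > 0" by simp
      then show "count A x = 1" using cnt[of x] by linarith
    qed simp
    finally show ?thesis by simp
  qed
  ultimately show ?thesis using A(1) by simp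
qed

definition pencil :: "'a::idom set \<Rightarrow> 'a set \<Rightarrow> 'a \<Rightarrow> 'a poly" where
  "pencil A B u = smult (1 - u) (root_poly A) + smult u (root_poly B)"

definition pencil_roots :: "'a::idom set \<Rightarrow> 'a set \<Rightarrow> 'a \<Rightarrow> 'a set" where
  "pencil_roots A B u = {x. poly (pencil A B u) x = 0}"

lemma pencil_roots_0: "finite A \<Longrightarrow> pencil_roots A B 0 = A"
  by (auto simp: pencil_roots_def pencil_def root_poly_zero_iff)

context
  fixes A B :: "'a::{alg_closed_field, field_char_0} set" and k :: nat
  assumes A: "finite A" "card A = k" and B: "finite B" "card B = k"
begin

lemma coeff_pencil: "coeff (pencil A B u) i = coeff (root_poly A) i + u * (coeff (root_poly B) i - coeff (root_poly A) i)"
  by (simp add: pencil_def algebra_simps)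

lemma coeff_pencil_top: "coeff (pencil A B u) k = 1"
  using coeff_root_poly[of A] coeff_root_poly[of B] A B by (simp add: coeff_pencil)

lemma degree_pencil: "degree (pencil A B u) = k"
proof (rule antisym)
  show "degree (pencil A B u) \<le> k"
    unfolding pencil_def using A B
    by (intro degree_add_le order.trans[OF degree_smult_le]) (auto simp: degree_root_poly)
  show "k \<le> degree (pencil A B u)" by (rule le_degree) (simp add: coeff_pencil_top)
qed

lemma pencil_nonzero: "pencil A B u \<noteq> 0"
  using coeff_pencil_top[of u] by auto

lemma finite_pencil_roots: "finite (pencil_roots A B u)"
  unfolding pencil_roots_def by (rule poly_roots_finite[OF pencil_nonzero])

lemma pencil_eq_root_poly:
  assumes "card (pencil_roots A B u) = k"
  shows "pencil A B u = root_poly (pencil_roots A B u)"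
proof (rule poly_eqI_degree_lead_coeff[of _ k _ "pencil_roots A B u"])
  show "coeff (pencil A B u) k = coeff (root_poly (pencil_roots A B u)) k"
    using coeff_pencil_top coeff_root_poly[of "pencil_roots A B u"] assms by simp
  show "poly (pencil A B u) z = poly (root_poly (pencil_roots A B u)) z" if "z \<in> pencil_roots A B u" for z
    using that root_poly_zero_iff[OF finite_pencil_roots] by (simp add: pencil_roots_def)
qed (use assms in \<open>auto simp: degree_pencil degree_root_poly\<close>)

lemma root_poly_neq:
  assumes "A \<noteq> B"
  shows "root_poly A \<noteq> root_poly B"
proof
  assume "root_poly A = root_poly B"
  then have "x \<in> A \<longleftrightarrow> x \<in> B" for x using root_poly_zero_iff A B by metis
  then show False using assms by blast
qed

lemma pencil_roots_inj:
  assumes "A \<noteq> B" "card (pencil_roots A B u) = k" "card (pencil_roots A B v) = k"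
    "pencil_roots A B u = pencil_roots A B v"
  shows "u = v"
proof -
  have "pencil A B u = pencil A B v" using pencil_eq_root_poly assms by metis
  moreover have "pencil A B u - pencil A B v = smult (u - v) (root_poly B - root_poly A)"
    by (rule poly_eqI) (simp add: coeff_pencil algebra_simps)
  ultimately have "smult (u - v) (root_poly B - root_poly A) = 0" by simp
  then show ?thesis using root_poly_neq[OF assms(1)] by auto
qed

lemma root_poly_pderiv_nonzero:
  fixes R :: "'a set"
  assumes "finite R" "x \<in> R"
  shows "poly (pderiv (root_poly R)) x \<noteq> 0"
proof -
  have "root_poly R = [:- x, 1:] * root_poly (R - {x})"
    unfolding root_poly_def by (rule prod.remove[OF assms])
  then have "poly (pderiv (root_poly R)) x = poly (root_poly (R - {x})) x"
    by (simp only: pderiv_mult poly_add poly_mult) (simp add: pderiv_pCons)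
  then show ?thesis using root_poly_zero_iff[of "R - {x}" x] assms by simp
qed

text \<open>
  A multiple root \<open>x\<close> of \<open>g + u * \<delta>\<close> is a zero of the Wronskian of \<open>g\<close> and \<open>\<delta>\<close>, and \<open>x\<close> determines \<open>u\<close> because the
  roots of \<open>g\<close> are simple.
\<close>

lemma finite_degenerate: "finite {u. card (pencil_roots A B u) \<noteq> k}"
proof (cases "A = B")
  case True
  then have "pencil_roots A B u = A" for u
    using A by (simp add: pencil_roots_def pencil_def root_poly_zero_iff algebra_simps)
  then show ?thesis using A by simp
next
  case False
  define g where "g = root_poly A"
  define \<delta> where "\<delta> = root_poly B - root_poly A"
  have pen: "pencil A B u = g + smult u \<delta>" for u
    by (rule poly_eqI) (simp add: coeff_pencil g_def \<delta>_def)
  have "\<delta> \<noteq> 0" using root_poly_neq[OF False] by (auto simp: \<delta>_def)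
  have "coeff \<delta> k = 0" using coeff_root_poly[of A] coeff_root_poly[of B] A B by (simp add: \<delta>_def)
  have deg: "degree \<delta> < k \<or> k = 0"
  proof (rule disjCI)
    assume "k \<noteq> 0"
    have "degree \<delta> \<le> k" unfolding \<delta>_def by (rule degree_diff_le) (use A B in \<open>auto simp: degree_root_poly\<close>)
    moreover have "degree \<delta> \<noteq> k" using \<open>coeff \<delta> k = 0\<close> \<open>\<delta> \<noteq> 0\<close> by auto
    ultimately show "degree \<delta> < k" by simp
  qed
  have k: "k \<noteq> 0" using A B False by auto
  \<comment> \<open>the Wronskian; it is nonzero since \<open>\<delta>\<close> has smaller degree than \<open>g\<close> and so cannot vanish at all roots of \<open>g\<close>\<close>
  define w where "w = g * pderiv \<delta> - pderiv g * \<delta>"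
  have "w \<noteq> 0"
  proof
    assume "w = 0"
    have "poly \<delta> a = 0" if "a \<in> A" for a
    proof -
      have "poly g a = 0" using that A by (simp add: g_def root_poly_zero_iff)
      moreover have "poly w a = 0" using \<open>w = 0\<close> by simp
      ultimately have "poly (pderiv g) a * poly \<delta> a = 0" by (simp add: w_def)
      then show ?thesis using root_poly_pderiv_nonzero[OF A(1) that] by (simp add: g_def)
    qed
    then have "\<delta> = 0" using A deg k by (intro poly_eqI_degree[of A]) auto
    then show False using \<open>\<delta> \<noteq> 0\<close> by simp
  qed
  then have "finite {x. poly w x = 0}" by (rule poly_roots_finite)
  moreover have "{u. card (pencil_roots A B u) \<noteq> k} \<subseteq>
    (\<lambda>x. - poly g x / poly \<delta> x) ` {x. poly w x = 0} \<union>
    (\<lambda>x. - poly (pderiv g) x / poly (pderiv \<delta>) x) ` {x. poly w x = 0}"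
  proof
    fix u assume "u \<in> {u. card (pencil_roots A B u) \<noteq> k}"
    then have "card {x. poly (pencil A B u) x = 0} \<noteq> degree (pencil A B u)"
      by (simp add: degree_pencil pencil_roots_def)
    then obtain x where "poly (pencil A B u) x = 0" "poly (pderiv (pencil A B u)) x = 0"
      using card_roots_eq_degree[OF pencil_nonzero[of u]] by blast
    then have x: "poly g x + u * poly \<delta> x = 0" "poly (pderiv g) x + u * poly (pderiv \<delta>) x = 0"
      by (auto simp: pen pderiv_add pderiv_smult)
    have gx: "poly g x = - (u * poly \<delta> x)" "poly (pderiv g) x = - (u * poly (pderiv \<delta>) x)"
      using x by (simp_all add: eq_neg_iff_add_eq_0)
    have w: "poly w x = 0" by (simp add: w_def gx)
    show "u \<in> (\<lambda>x. - poly g x / poly \<delta> x) ` {x. poly w x = 0} \<union>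
      (\<lambda>x. - poly (pderiv g) x / poly (pderiv \<delta>) x) ` {x. poly w x = 0}"
    proof (cases "poly \<delta> x = 0")
      case True
      then have "x \<in> A" using gx A by (simp add: g_def root_poly_zero_iff)
      then have "poly (pderiv g) x \<noteq> 0" unfolding g_def by (rule root_poly_pderiv_nonzero[OF A(1)])
      then have "poly (pderiv \<delta>) x \<noteq> 0" using gx by auto
      then have "u = - poly (pderiv g) x / poly (pderiv \<delta>) x" unfolding gx by simp
      then show ?thesis using w by blast
    next
      case False
      then have "u = - poly g x / poly \<delta> x" unfolding gx by simp
      then show ?thesis using w by blast
    qed
  qed
  ultimately show ?thesis by (meson finite_UnI finite_imageI finite_subset)
qed

text \<open>
  With the weights the power sums of degree less than \<open>k\<close> are constants, and the equation of the roots
  gives a recursion, polynomial in \<open>u\<close>, for the higher ones. Unweighted power sums would need Newton's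
  identities.
\<close>

lemma weighted_sum_polynomial:
  "\<exists>Q. \<forall>u. card (pencil_roots A B u) = k \<longrightarrow>
     (\<Sum>\<rho>\<in>pencil_roots A B u. lagrange_weight (pencil_roots A B u) \<rho> * poly q \<rho>) = poly Q u"
proof -
  define S where "S n u = (\<Sum>\<rho>\<in>pencil_roots A B u. lagrange_weight (pencil_roots A B u) \<rho> * \<rho> ^ n)" for n u
  have "\<exists>Q. \<forall>u. card (pencil_roots A B u) = k \<longrightarrow> S n u = poly Q u" for n
  proof (induction n rule: less_induct)
    case (less n)
    show ?case
    proof (cases "n < k")
      case True
      then have "S n u = poly [:if Suc n = k then 1 else 0:] u" if "card (pencil_roots A B u) = k" for u
        using weighted_power_sum_small[OF finite_pencil_roots[of u], of n] that by (simp add: S_def)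
      then show ?thesis by blast
    next
      case False
      then have "\<forall>i\<in>{..<k}. \<exists>Q. \<forall>u. card (pencil_roots A B u) = k \<longrightarrow> S (n - k + i) u = poly Q u"
        using less by auto
      then obtain Q where Q: "\<And>i u. i < k \<Longrightarrow> card (pencil_roots A B u) = k \<Longrightarrow> S (n - k + i) u = poly (Q i) u"
        by (metis lessThan_iff)
      define C where "C i = [:coeff (root_poly A) i, coeff (root_poly B) i - coeff (root_poly A) i:]" for i
      have C: "poly (C i) u = coeff (pencil A B u) i" for i u by (simp add: C_def coeff_pencil)
      have "S n u = poly (- (\<Sum>i<k. C i * Q i)) u" if u: "card (pencil_roots A B u) = k" for u
      proof -
        have rec: "\<rho> ^ n = - (\<Sum>i<k. poly (C i) u * \<rho> ^ (n - k + i))" if "\<rho> \<in> pencil_roots A B u" for \<rho>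
        proof -
          have "0 = poly (pencil A B u) \<rho>" using that by (simp add: pencil_roots_def)
          also have "\<dots> = (\<Sum>i\<le>k. coeff (pencil A B u) i * \<rho> ^ i)"
            by (simp add: poly_altdef degree_pencil)
          also have "\<dots> = (\<Sum>i<k. poly (C i) u * \<rho> ^ i) + \<rho> ^ k"
            by (simp add: lessThan_Suc_atMost[symmetric] coeff_pencil_top C)
          finally have *: "\<rho> ^ k = - (\<Sum>i<k. poly (C i) u * \<rho> ^ i)"
            by (simp add: eq_neg_iff_add_eq_0 add.commute)
          have "\<rho> ^ n = \<rho> ^ (n - k) * \<rho> ^ k" using False by (simp add: power_add[symmetric])
          also have "\<dots> = - (\<Sum>i<k. poly (C i) u * \<rho> ^ (n - k + i))"
            unfolding * by (simp add: sum_distrib_left power_add mult_ac)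
          finally show ?thesis .
        qed
        let ?R = "pencil_roots A B u"
        have "S n u = (\<Sum>\<rho>\<in>?R. lagrange_weight ?R \<rho> * - (\<Sum>i<k. poly (C i) u * \<rho> ^ (n - k + i)))"
          unfolding S_def by (intro sum.cong refl arg_cong2[where f = "(*)"] rec)
        also have "\<dots> = - (\<Sum>\<rho>\<in>?R. \<Sum>i<k. poly (C i) u * (lagrange_weight ?R \<rho> * \<rho> ^ (n - k + i)))"
          by (simp add: sum_distrib_left sum_negf mult_ac)
        also have "\<dots> = - (\<Sum>i<k. poly (C i) u * S (n - k + i) u)"
          by (subst sum.swap) (simp add: S_def sum_distrib_left)
        also have "\<dots> = poly (- (\<Sum>i<k. C i * Q i)) u"
          using Q[OF _ u] by (simp add: poly_sum)
        finally show ?thesis .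
      qed
      then show ?thesis by blast
    qed
  qed
  then obtain Q where Q: "\<And>n u. card (pencil_roots A B u) = k \<Longrightarrow> S n u = poly (Q n) u" by metis
  have "(\<Sum>\<rho>\<in>pencil_roots A B u. lagrange_weight (pencil_roots A B u) \<rho> * poly q \<rho>)
     = poly (\<Sum>n\<le>degree q. smult (coeff q n) (Q n)) u" if u: "card (pencil_roots A B u) = k" for u
  proof -
    let ?R = "pencil_roots A B u"
    have "(\<Sum>\<rho>\<in>?R. lagrange_weight ?R \<rho> * poly q \<rho>)
      = (\<Sum>\<rho>\<in>?R. \<Sum>n\<le>degree q. coeff q n * (lagrange_weight ?R \<rho> * \<rho> ^ n))"
      by (simp add: poly_altdef sum_distrib_left mult_ac)
    also have "\<dots> = (\<Sum>n\<le>degree q. coeff q n * S n u)"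
      by (subst sum.swap) (simp add: S_def sum_distrib_left)
    also have "\<dots> = poly (\<Sum>n\<le>degree q. smult (coeff q n) (Q n)) u"
      using Q[OF u] by (simp add: poly_sum)
    finally show ?thesis .
  qed
  then show ?thesis by blast
qed

text \<open>
  For \<open>\<mu> = 0\<close> the functional given by \<open>\<alpha>\<close> vanishes on the multiples of both generators of the pencil,
  hence on the multiples of \<open>pencil A B u\<close>, and modulo this polynomial it is a combination of evaluations by
  Lagrange interpolation. The term \<open>coeff q D\<close> is the evaluation at infinity; it enters linearly in \<open>u\<close>
  because all members of the pencil are monic.
\<close>

lemma pencil_apolar:
  fixes D :: nat and \<mu> :: 'a
  assumes rel: "\<And>q. degree q \<le> D \<Longrightarrow> (\<Sum>a\<in>A. \<alpha> a * poly q a) = (\<Sum>b\<in>B. \<beta> b * poly q b) + \<mu> * coeff q D"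
    and u: "card (pencil_roots A B u) = k"
  shows "\<exists>\<gamma>. \<forall>q. degree q \<le> D \<longrightarrow>
     (\<Sum>\<rho>\<in>pencil_roots A B u. \<gamma> \<rho> * poly q \<rho>) = (\<Sum>a\<in>A. \<alpha> a * poly q a) - u * \<mu> * coeff q D"
proof -
  let ?R = "pencil_roots A B u" and ?g = "pencil A B u"
  define M where "M q = (\<Sum>a\<in>A. \<alpha> a * poly q a) - u * \<mu> * coeff q D" for q
  have M_add: "M (p + q) = M p + M q" for p q
    by (simp add: M_def sum.distrib algebra_simps)
  have M_smult: "M (smult c q) = c * M q" for c q
    by (simp add: M_def sum_distrib_left right_diff_distrib mult_ac)
  have M_0: "M 0 = 0" by (simp add: M_def)
  have M_sum: "M (\<Sum>i\<in>I. f i) = (\<Sum>i\<in>I. M (f i))" for I :: "'a set" and f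
    by (induction I rule: infinite_finite_induct) (auto simp: M_add M_0)
  have M_mult: "M (?g * h) = 0" if h: "degree (?g * h) \<le> D" for h
  proof (cases "h = 0")
    case True then show ?thesis by (simp add: M_0)
  next
    case False
    then have dh: "k + degree h \<le> D" using h pencil_nonzero[of u] by (simp add: degree_mult_eq degree_pencil)
    have "degree (root_poly B * h) \<le> D" "degree (?g * h) \<le> D" "degree (root_poly A * h) \<le> D"
      using dh A B degree_mult_le[of "root_poly B" h] degree_mult_le[of "root_poly A" h] degree_mult_le[of ?g h]
      by (auto simp: degree_root_poly degree_pencil)
    note dB = this(1)
    have c: "coeff (p * h) D = (if D = k + degree h then lead_coeff h else 0)" if "degree p = k" "coeff p k = 1" for p
    proof (cases "D = k + degree h")
      case True then show ?thesis using coeff_mult_degree_sum[of p h] that by simp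
    next
      case False
      then have "degree (p * h) < D" using degree_mult_le[of p h] that dh by linarith
      then show ?thesis using False by (simp add: coeff_eq_0)
    qed
    \<comment> \<open>both factors are monic of degree \<open>k\<close>, so the leading coefficient of \<open>h\<close> decides\<close>
    have cc: "coeff (root_poly B * h) D = coeff (?g * h) D"
      using c[of "root_poly B"] c[of ?g] degree_root_poly[of B] coeff_root_poly[of B] B degree_pencil coeff_pencil_top by simp
    have "(\<Sum>a\<in>A. \<alpha> a * poly (?g * h) a) = (\<Sum>a\<in>A. u * (\<alpha> a * poly (root_poly B * h) a))"
      using A by (intro sum.cong) (auto simp: pencil_def root_poly_zero_iff)
    also have "\<dots> = u * (\<Sum>a\<in>A. \<alpha> a * poly (root_poly B * h) a)" by (simp add: sum_distrib_left)
    also have "(\<Sum>a\<in>A. \<alpha> a * poly (root_poly B * h) a) = (\<Sum>b\<in>B. \<beta> b * poly (root_poly B * h) b) + \<mu> * coeff (root_poly B * h) D"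
      by (rule rel[OF dB])
    also have "(\<Sum>b\<in>B. \<beta> b * poly (root_poly B * h) b) = 0"
      using B by (intro sum.neutral) (auto simp: root_poly_zero_iff)
    finally show ?thesis unfolding M_def cc by simp
  qed
  have main: "(\<Sum>\<rho>\<in>?R. M (lagrange ?R \<rho>) * poly q \<rho>) = M q" if q: "degree q \<le> D" for q
  proof -
    have mod: "poly (q mod ?g) \<rho> = poly q \<rho>" if "\<rho> \<in> ?R" for \<rho>
    proof -
      have "poly q \<rho> = poly (?g * (q div ?g) + q mod ?g) \<rho>" by simp
      also have "\<dots> = poly (q mod ?g) \<rho>" using that by (simp only: poly_add poly_mult) (simp add: pencil_roots_def)
      finally show ?thesis by simp
    qed
    have "q mod ?g = (\<Sum>\<rho>\<in>?R. smult (poly (q mod ?g) \<rho>) (lagrange ?R \<rho>))"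
    proof (cases "k = 0")
      case True
      then have "q mod ?g = 0" using degree_mod_less[OF pencil_nonzero, of q u] by (simp add: degree_pencil)
      then show ?thesis by simp
    next
      case False
      then have "degree (q mod ?g) < card ?R" using degree_mod_less[OF pencil_nonzero, of q u] u by (auto simp: degree_pencil)
      then show ?thesis by (rule lagrange_interpolation[OF finite_pencil_roots])
    qed
    then have "M (q mod ?g) = (\<Sum>\<rho>\<in>?R. poly (q mod ?g) \<rho> * M (lagrange ?R \<rho>))"
      using M_sum[of "\<lambda>\<rho>. smult (poly (q mod ?g) \<rho>) (lagrange ?R \<rho>)" ?R] by (simp add: M_smult)
    also have "\<dots> = (\<Sum>\<rho>\<in>?R. M (lagrange ?R \<rho>) * poly q \<rho>)"
      by (intro sum.cong) (auto simp: mod mult.commute)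
    finally have 1: "M (q mod ?g) = (\<Sum>\<rho>\<in>?R. M (lagrange ?R \<rho>) * poly q \<rho>)" .
    have "degree (?g * (q div ?g)) \<le> D"
    proof (cases "q div ?g = 0")
      case False
      have "degree (q mod ?g) < degree (?g * (q div ?g)) \<or> q mod ?g = 0"
        using degree_mod_less[OF pencil_nonzero, of q u] False pencil_nonzero[of u] by (auto simp: degree_mult_eq)
      then have "degree (?g * (q div ?g) + q mod ?g) = degree (?g * (q div ?g))"
        by (elim disjE) (rule degree_add_eq_left, assumption, simp only: add_0_right)
      then show ?thesis using q by simp
    qed simp
    then have "M (?g * (q div ?g)) = 0" by (rule M_mult)
    then have "M (?g * (q div ?g) + q mod ?g) = M (q mod ?g)"
      by (simp only: M_add add_0_left)
    then show ?thesis using 1 by simp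
  qed
  show ?thesis by (rule exI[of _ "\<lambda>\<rho>. M (lagrange ?R \<rho>)"]) (use main in \<open>simp add: M_def\<close>)
qed

end

section \<open>Irreducible families of point sets\<close>

inductive_set vector_poly :: "nat \<Rightarrow> ((nat \<Rightarrow> 'a::field) \<Rightarrow> 'a) set" for r :: nat where
  const: "(\<lambda>x. c) \<in> vector_poly r"
| coord: "j \<le> r \<Longrightarrow> (\<lambda>x. x j) \<in> vector_poly r"
| add: "f \<in> vector_poly r \<Longrightarrow> g \<in> vector_poly r \<Longrightarrow> (\<lambda>x. f x + g x) \<in> vector_poly r"
| mult: "f \<in> vector_poly r \<Longrightarrow> g \<in> vector_poly r \<Longrightarrow> (\<lambda>x. f x * g x) \<in> vector_poly r"

inductive_set tuple_poly :: "nat \<Rightarrow> nat \<Rightarrow> ((nat \<Rightarrow> nat \<Rightarrow> 'a::field) \<Rightarrow> 'a) set" for r t :: nat where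
  const: "(\<lambda>x. c) \<in> tuple_poly r t"
| coord: "i < t \<Longrightarrow> j \<le> r \<Longrightarrow> (\<lambda>x. x i j) \<in> tuple_poly r t"
| add: "f \<in> tuple_poly r t \<Longrightarrow> g \<in> tuple_poly r t \<Longrightarrow> (\<lambda>x. f x + g x) \<in> tuple_poly r t"
| mult: "f \<in> tuple_poly r t \<Longrightarrow> g \<in> tuple_poly r t \<Longrightarrow> (\<lambda>x. f x * g x) \<in> tuple_poly r t"

lemma tuple_poly_prod:
  assumes "\<And>i. i \<in> I \<Longrightarrow> f i \<in> tuple_poly r t"
  shows "(\<lambda>x. \<Prod>i\<in>I. f i x) \<in> tuple_poly r t"
  using assms by (induction I rule: infinite_finite_induct) (auto intro: tuple_poly.intros)

lemma tuple_poly_sum: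
  assumes "\<And>i. i \<in> I \<Longrightarrow> f i \<in> tuple_poly r t"
  shows "(\<lambda>x. \<Sum>i\<in>I. f i x) \<in> tuple_poly r t"
  using assms by (induction I rule: infinite_finite_induct) (auto intro: tuple_poly.intros)

lemma tuple_poly_power:
  assumes "f \<in> tuple_poly r t"
  shows "(\<lambda>x. f x ^ n) \<in> tuple_poly r t"
  using assms by (induction n) (auto intro: tuple_poly.intros)

lemma tuple_poly_lin: "i < t \<Longrightarrow> (\<lambda>x. lin r l (x i)) \<in> tuple_poly r t"
  unfolding lin_def by (intro tuple_poly_sum tuple_poly.intros) auto

lemma tuple_poly_poly_eval:
  assumes "multihomogeneous r t f"
  shows "(\<lambda>x. poly_eval f (\<lambda>(i, j). x i j)) \<in> tuple_poly r t"
proof -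
  have *: "Poly_Mapping.keys m \<subseteq> {..<t} \<times> {..r}" if "m \<in> Poly_Mapping.keys f" for m
    using assms that by (auto simp: multihomogeneous_def)
  show ?thesis
    unfolding poly_eval_def
  proof (intro tuple_poly_sum tuple_poly.mult tuple_poly.const tuple_poly_prod tuple_poly_power)
    fix m v assume "m \<in> Poly_Mapping.keys f" "v \<in> Poly_Mapping.keys m"
    then have "v \<in> {..<t} \<times> {..r}" using * by blast
    then show "(\<lambda>x. case v of (i, j) \<Rightarrow> x i j) \<in> tuple_poly r t" by (auto intro: tuple_poly.intros)
  qed
qed

text \<open>
  A monomial of multidegree \<open>e\<close> acquires the factor \<open>\<Prod>i<t. c i ^ e i\<close>, so vanishing can be tested on any
  representatives of the points.
\<close>

lemma poly_eval_scale:
  fixes f :: "(nat \<times> nat \<Rightarrow>\<^sub>0 nat) \<Rightarrow>\<^sub>0 'a::field"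
  assumes f: "multihomogeneous r t f" and zero: "poly_eval f (\<lambda>(i, j). x i j) = 0"
  shows "poly_eval f (\<lambda>(i, j). c i * x i j) = 0"
proof -
  obtain e where e: "\<And>m. m \<in> Poly_Mapping.keys f \<Longrightarrow> Poly_Mapping.keys m \<subseteq> {..<t} \<times> {..r}"
    "\<And>m i. m \<in> Poly_Mapping.keys f \<Longrightarrow> i < t \<Longrightarrow> (\<Sum>j\<le>r. Poly_Mapping.lookup m (i, j)) = e i"
    using f unfolding multihomogeneous_def by blast
  have mono: "(\<Prod>v\<in>Poly_Mapping.keys m. (case v of (i, j) \<Rightarrow> c i * x i j) ^ Poly_Mapping.lookup m v)
     = (\<Prod>i<t. c i ^ e i) * (\<Prod>v\<in>Poly_Mapping.keys m. (case v of (i, j) \<Rightarrow> x i j) ^ Poly_Mapping.lookup m v)"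
    if m: "m \<in> Poly_Mapping.keys f" for m
  proof -
    have "(\<Prod>v\<in>Poly_Mapping.keys m. c (fst v) ^ Poly_Mapping.lookup m v)
      = (\<Prod>v\<in>{..<t} \<times> {..r}. c (fst v) ^ Poly_Mapping.lookup m v)"
      by (rule prod.mono_neutral_left) (use e(1)[OF m] in \<open>auto simp: in_keys_iff\<close>)
    also have "\<dots> = (\<Prod>i<t. \<Prod>j\<le>r. c i ^ Poly_Mapping.lookup m (i, j))"
      by (subst prod.cartesian_product) (simp add: case_prod_beta)
    also have "\<dots> = (\<Prod>i<t. c i ^ e i)"
      using e(2)[OF m] by (intro prod.cong) (auto simp: power_sum[symmetric])
    finally have "(\<Prod>v\<in>Poly_Mapping.keys m. c (fst v) ^ Poly_Mapping.lookup m v) = (\<Prod>i<t. c i ^ e i)" .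
    then show ?thesis by (simp add: case_prod_beta power_mult_distrib prod.distrib)
  qed
  have "poly_eval f (\<lambda>(i, j). c i * x i j) = (\<Prod>i<t. c i ^ e i) * poly_eval f (\<lambda>(i, j). x i j)"
    unfolding poly_eval_def sum_distrib_left
    by (intro sum.cong refl) (simp add: mono mult.left_commute)
  then show ?thesis using zero by simp
qed

text \<open>
  Separating the slots is what lets a sum over tuples factor into sums over single points.
\<close>

lemma tuple_poly_expand:
  assumes "F \<in> tuple_poly r t" "t > 0"
  shows "\<exists>L. (\<forall>q\<in>set L. \<forall>i. q i \<in> vector_poly r) \<and> (\<forall>x. F x = (\<Sum>q\<leftarrow>L. \<Prod>i<t. q i (x i)))"
  using assms
proof (induction rule: tuple_poly.induct)
  case (const c)
  have "(\<Prod>i<t. if i = 0 then c else 1) = c" using \<open>t > 0\<close> by simp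
  then show ?case
    by (intro exI[of _ "[\<lambda>i x. if i = 0 then c else 1]"]) (auto intro: vector_poly.const)
next
  case (coord k j)
  have "(\<lambda>x. if i = k then x j else 1) \<in> vector_poly r" for i :: nat
    using coord by (cases "i = k") (auto intro: vector_poly.intros)
  moreover have "(\<Prod>i<t. if i = k then x i j else 1) = x k j" for x :: "nat \<Rightarrow> nat \<Rightarrow> 'a"
    using coord by simp
  ultimately show ?case
    by (intro exI[of _ "[\<lambda>i x. if i = k then x j else 1]"]) auto
next
  case (add f g)
  then obtain L M where "\<forall>q\<in>set L. \<forall>i. q i \<in> vector_poly r" "\<forall>x. f x = (\<Sum>q\<leftarrow>L. \<Prod>i<t. q i (x i))"
    "\<forall>q\<in>set M. \<forall>i. q i \<in> vector_poly r" "\<forall>x. g x = (\<Sum>q\<leftarrow>M. \<Prod>i<t. q i (x i))" by blast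
  then show ?case by (intro exI[of _ "L @ M"]) auto
next
  case (mult f g)
  then obtain L M where L: "\<forall>q\<in>set L. \<forall>i. q i \<in> vector_poly r" "\<forall>x. f x = (\<Sum>q\<leftarrow>L. \<Prod>i<t. q i (x i))"
    and M: "\<forall>q\<in>set M. \<forall>i. q i \<in> vector_poly r" "\<forall>x. g x = (\<Sum>q\<leftarrow>M. \<Prod>i<t. q i (x i))" by blast
  define N where "N = concat (map (\<lambda>p. map (\<lambda>q i x. p i x * q i x) M) L)"
  have "(\<Sum>q\<leftarrow>N. \<Prod>i<t. q i (x i)) = f x * g x" for x
  proof -
    have "(\<Sum>q\<leftarrow>N. \<Prod>i<t. q i (x i)) = (\<Sum>p\<leftarrow>L. (\<Prod>i<t. p i (x i)) * (\<Sum>q\<leftarrow>M. \<Prod>i<t. q i (x i)))"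
      unfolding N_def by (induction L) (auto simp: o_def prod.distrib sum_list_const_mult)
    then show ?thesis using L M by (simp add: sum_list_mult_const)
  qed
  moreover have "\<forall>q\<in>set N. \<forall>i. q i \<in> vector_poly r"
    using L M by (auto simp: N_def intro!: vector_poly.mult)
  ultimately show ?case by (intro exI[of _ N]) auto
qed

lemma openin_generated_neighbourhood:
  assumes "openin (topology_generated_by S) V" "x \<in> V"
  shows "\<exists>\<F>. finite \<F> \<and> \<F> \<subseteq> S \<and> (\<forall>s\<in>\<F>. x \<in> s) \<and> (\<forall>y. (\<forall>s\<in>\<F>. y \<in> s) \<longrightarrow> y \<in> V)"
proof -
  have "generate_topology_on S V" using assms(1) by (simp add: openin_topology_generated_by_iff)
  then show ?thesis using assms(2)
  proof induction
    case Empty then show ?case by simp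
  next
    case (Int a b)
    then obtain F G where "finite F" "F \<subseteq> S" "\<forall>s\<in>F. x \<in> s" "\<forall>y. (\<forall>s\<in>F. y \<in> s) \<longrightarrow> y \<in> a"
      "finite G" "G \<subseteq> S" "\<forall>s\<in>G. x \<in> s" "\<forall>y. (\<forall>s\<in>G. y \<in> s) \<longrightarrow> y \<in> b" by auto
    then show ?case by (intro exI[of _ "F \<union> G"]) auto
  next
    case (UN K)
    then obtain k where k: "k \<in> K" "x \<in> k" by blast
    obtain F where "finite F" "F \<subseteq> S" "\<forall>s\<in>F. x \<in> s" "\<forall>y. (\<forall>s\<in>F. y \<in> s) \<longrightarrow> y \<in> k"
      using UN.IH[OF k] by (elim exE conjE) (rule that)
    then show ?case using k by (intro exI[of _ F]) auto
  next
    case (Basis s)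
    then show ?case by (intro exI[of _ "{s}"]) auto
  qed
qed

lemma openin_hilb:
  "openin (hilb_topology r k) V \<longleftrightarrow> V \<subseteq> reduced_subsets r k \<and>
     openin (ordered_config_topology r k) {ps \<in> ordered_configs r k. set ps \<in> V}"
  unfolding hilb_topology_def by (subst topology_inverse'[OF istopology_hilb]) (rule refl)

lemma nonzero_minor:
  fixes v w :: "nat \<Rightarrow> 'a::field"
  assumes "v \<in> vecs r" "w \<in> vecs r" "v \<noteq> 0" "w \<notin> funvec.span {v}"
  shows "\<exists>a\<le>r. \<exists>b\<le>r. v a * w b - v b * w a \<noteq> 0"
proof (rule ccontr)
  assume *: "\<not> ?thesis"
  obtain a where a: "v a \<noteq> 0" using assms(3) by (auto simp: fun_eq_iff)
  then have ar: "a \<le> r" using assms(1) by (auto simp: vecs_def)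
  have "w = fscale (w a / v a) v"
  proof
    fix b
    show "w b = fscale (w a / v a) v b"
    proof (cases "b \<le> r")
      case True
      then have "v a * w b = v b * w a" using * ar by auto
      then show ?thesis using a by (simp add: fscale_def field_simps)
    next
      case False
      then show ?thesis using assms(1,2) by (simp add: vecs_def fscale_def)
    qed
  qed
  then show False using assms(4) unfolding span_single by blast
qed

lemma span_in_proj_space: "v \<in> vecs r \<Longrightarrow> v \<noteq> 0 \<Longrightarrow> funvec.span {v} \<in> proj_space {..r}"
  unfolding proj_space_def vecs_def by blast

text \<open>
  The points \<open>X u i\<close> are arbitrary functions of \<open>u\<close>, like a chosen ordering of the roots of a polynomial;
  algebraicity enters through their weighted symmetric sums.
\<close>

locale config_family =
  fixes r t :: nat and U :: "'a::{alg_closed_field, field_char_0} set"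
    and X :: "'a \<Rightarrow> nat \<Rightarrow> nat \<Rightarrow> 'a" and \<omega> :: "'a \<Rightarrow> nat \<Rightarrow> 'a"
  assumes t: "t > 0" and inf: "infinite U"
    and X: "\<And>u i. u \<in> U \<Longrightarrow> i < t \<Longrightarrow> X u i \<in> vecs r" "\<And>u i. u \<in> U \<Longrightarrow> i < t \<Longrightarrow> X u i \<noteq> 0"
    and dist: "\<And>u i j. u \<in> U \<Longrightarrow> i < t \<Longrightarrow> j < t \<Longrightarrow> i \<noteq> j \<Longrightarrow> X u j \<notin> funvec.span {X u i}"
    and \<omega>: "\<And>u i. u \<in> U \<Longrightarrow> i < t \<Longrightarrow> \<omega> u i \<noteq> 0"
    and weighted: "\<And>q. q \<in> vector_poly r \<Longrightarrow> \<exists>Q. \<forall>u\<in>U. (\<Sum>i<t. \<omega> u i * q (X u i)) = poly Q u"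
begin

definition config :: "'a \<Rightarrow> (nat \<Rightarrow> 'a) set set" where
  "config u = (\<lambda>i. funvec.span {X u i}) ` {..<t}"

lemma inj_point: "u \<in> U \<Longrightarrow> inj_on (\<lambda>i. funvec.span {X u i}) {..<t}"
proof (rule inj_onI, rule ccontr)
  fix i j assume "u \<in> U" "i \<in> {..<t}" "j \<in> {..<t}" "funvec.span {X u i} = funvec.span {X u j}" "i \<noteq> j"
  then show False using dist[of u i j] span_single_eq_imp[of "X u i" "X u j"] by simp
qed

lemma config_reduced: "u \<in> U \<Longrightarrow> config u \<in> reduced_subsets r t"
  unfolding reduced_subsets_def config_def
  using card_image[OF inj_point[of u]] X[of u] by (auto intro!: span_in_proj_space)

text \<open>
  After expanding \<open>F\<close> by \<open>tuple_poly_expand\<close>, the sum over all maps is a product of weighted sums over single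
  points. Summing over all maps instead of all permutations is what makes it factor.
\<close>

lemma maps_sum_polynomial:
  assumes F: "F \<in> tuple_poly r t"
  shows "\<exists>Q. \<forall>u\<in>U. (\<Sum>\<phi>\<in>{..<t} \<rightarrow>\<^sub>E {..<t}. (\<Prod>i<t. \<omega> u (\<phi> i)) * F (\<lambda>i. X u (\<phi> i))) = poly Q u"
proof -
  obtain L where L: "\<forall>q\<in>set L. \<forall>i. q i \<in> vector_poly r" "\<forall>x. F x = (\<Sum>q\<leftarrow>L. \<Prod>i<t. q i (x i))"
    using tuple_poly_expand[OF F t] by blast
  obtain P where P: "\<And>q u. q \<in> vector_poly r \<Longrightarrow> u \<in> U \<Longrightarrow> (\<Sum>i<t. \<omega> u i * q (X u i)) = poly (P q) u"
    using weighted by metis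
  have "(\<Sum>\<phi>\<in>{..<t} \<rightarrow>\<^sub>E {..<t}. (\<Prod>i<t. \<omega> u (\<phi> i)) * F (\<lambda>i. X u (\<phi> i))) = poly (\<Sum>q\<leftarrow>L. \<Prod>i<t. P (q i)) u"
    if u: "u \<in> U" for u
  proof -
    have "(\<Prod>i<t. \<omega> u (\<phi> i)) * F (\<lambda>i. X u (\<phi> i)) = (\<Sum>q\<leftarrow>L. \<Prod>i<t. \<omega> u (\<phi> i) * q i (X u (\<phi> i)))" for \<phi> :: "nat \<Rightarrow> nat"
      using L(2) by (simp add: sum_list_const_mult[symmetric] prod.distrib)
    then have "(\<Sum>\<phi>\<in>{..<t} \<rightarrow>\<^sub>E {..<t}. (\<Prod>i<t. \<omega> u (\<phi> i)) * F (\<lambda>i. X u (\<phi> i)))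
      = (\<Sum>\<phi>\<in>{..<t} \<rightarrow>\<^sub>E {..<t}. \<Sum>q\<leftarrow>L. \<Prod>i<t. \<omega> u (\<phi> i) * q i (X u (\<phi> i)))" by simp
    also have "\<dots> = (\<Sum>q\<leftarrow>L. \<Sum>\<phi>\<in>{..<t} \<rightarrow>\<^sub>E {..<t}. \<Prod>i<t. \<omega> u (\<phi> i) * q i (X u (\<phi> i)))"
      by (induction L) (auto simp: sum.distrib)
    also have "\<dots> = (\<Sum>q\<leftarrow>L. \<Prod>i<t. \<Sum>k<t. \<omega> u k * q i (X u k))"
      by (subst prod_sum_PiE) auto
    also have "\<dots> = (\<Sum>q\<leftarrow>L. \<Prod>i<t. poly (P (q i)) u)"
      using L(1) P u by (intro arg_cong[of _ _ sum_list] map_cong prod.cong) auto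
    also have "\<dots> = poly (\<Sum>q\<leftarrow>L. \<Prod>i<t. P (q i)) u"
      by (induction L) (auto simp: poly_prod)
    finally show ?thesis .
  qed
  then show ?thesis by blast
qed

text \<open>
  The polynomial is the sum from \<open>maps_sum_polynomial\<close> of a product \<open>E * H * D\<close>. Here \<open>E\<close> is a product of forms
  nonzero at the ordered points of \<open>config s\<close> and vanishing, for every ordering, on configurations in
  \<open>C\<close>. The factor \<open>D\<close> kills tuples with a repeated point, and \<open>H\<close> kills all arrangements of the points of
  \<open>config s\<close> except the given one, so that at \<open>s\<close> a single nonzero summand remains.
\<close>

lemma closed_avoiding_polynomial:
  assumes C: "closedin (hilb_topology r t) C" and s: "s \<in> U" "config s \<notin> C"
  shows "\<exists>Q. poly Q s \<noteq> 0 \<and> (\<forall>u\<in>U. config u \<in> C \<longrightarrow> poly Q u = 0)"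
proof -
  define V where "V = reduced_subsets r t - C"
  define point where "point u i = funvec.span {X u i}" for u i
  have "openin (hilb_topology r t) V" using C by (simp add: closedin_def V_def)
  then have op: "openin (ordered_config_topology r t) {ps \<in> ordered_configs r t. set ps \<in> V}"
    by (simp add: openin_hilb)
  have ord: "map (\<lambda>i. point u (\<phi> i)) [0..<t] \<in> ordered_configs r t" "set (map (\<lambda>i. point u (\<phi> i)) [0..<t]) = config u"
    if u: "u \<in> U" and \<phi>: "\<phi> ` {..<t} = {..<t}" for u \<phi>
  proof -
    have inj\<phi>: "inj_on \<phi> {..<t}" using \<phi> by (intro eq_card_imp_inj_on) auto
    have "inj_on (\<lambda>i. point u (\<phi> i)) {..<t}"
      using comp_inj_on[OF inj\<phi>, of "\<lambda>i. funvec.span {X u i}"] inj_point[OF u] \<phi> by (simp add: o_def point_def)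
    moreover have im: "(\<lambda>i. point u (\<phi> i)) ` {..<t} = config u"
    proof -
      have "(\<lambda>i. point u (\<phi> i)) ` {..<t} = (\<lambda>i. funvec.span {X u i}) ` (\<phi> ` {..<t})"
        unfolding point_def by (simp only: image_image)
      then show ?thesis unfolding \<phi> config_def .
    qed
    moreover have "config u \<subseteq> proj_space {..r}" using config_reduced[OF u] by (simp add: reduced_subsets_def)
    ultimately show "map (\<lambda>i. point u (\<phi> i)) [0..<t] \<in> ordered_configs r t" "set (map (\<lambda>i. point u (\<phi> i)) [0..<t]) = config u"
      by (auto simp: ordered_configs_def distinct_map atLeast0LessThan)
  qed
  have "map (\<lambda>i. point s i) [0..<t] \<in> {ps \<in> ordered_configs r t. set ps \<in> V}"
    using ord[OF s(1), of id] s config_reduced[OF s(1)] by (simp add: V_def)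
  from openin_generated_neighbourhood[OF op[unfolded ordered_config_topology_def] this]
  obtain \<F> where \<F>: "finite \<F>" "\<F> \<subseteq> {nonvanishing r t f | f. multihomogeneous r t f}"
    "\<forall>N\<in>\<F>. map (\<lambda>i. point s i) [0..<t] \<in> N"
    "\<forall>ps. (\<forall>N\<in>\<F>. ps \<in> N) \<longrightarrow> ps \<in> {ps \<in> ordered_configs r t. set ps \<in> V}"
    by (elim exE conjE) (rule that)
  have "\<forall>N\<in>\<F>. \<exists>f. multihomogeneous r t f \<and> N = nonvanishing r t f" using \<F>(2) by blast
  then obtain f where f: "\<And>N. N \<in> \<F> \<Longrightarrow> multihomogeneous r t (f N)" "\<And>N. N \<in> \<F> \<Longrightarrow> N = nonvanishing r t (f N)"
    by metis
  \<comment> \<open>\<open>l i j\<close> vanishes at the point \<open>j\<close> but not at the point \<open>i\<close>; the minors with columns \<open>a i j\<close>, \<open>b i j\<close> detect coincidences\<close>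
  have "\<forall>i\<in>{..<t}. \<forall>j\<in>{..<t} - {i}. \<exists>l. lin r l (X s i) = 1 \<and> lin r l (X s j) = 0"
    using X(1)[OF s(1)] dist[OF s(1)] by (intro ballI lin_separates_point) auto
  then obtain l where l: "\<And>i j. i < t \<Longrightarrow> j < t \<Longrightarrow> i \<noteq> j \<Longrightarrow> lin r (l i j) (X s i) = 1 \<and> lin r (l i j) (X s j) = 0"
    by (metis DiffI lessThan_iff singletonD)
  have "\<forall>i\<in>{..<t}. \<forall>j\<in>{..<t} - {i}. \<exists>a b. a \<le> r \<and> b \<le> r \<and> X s i a * X s j b - X s i b * X s j a \<noteq> 0"
  proof (intro ballI)
    fix i j assume "i \<in> {..<t}" "j \<in> {..<t} - {i}"
    then have "\<exists>a\<le>r. \<exists>b\<le>r. X s i a * X s j b - X s i b * X s j a \<noteq> 0"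
      using X[OF s(1)] dist[OF s(1)] by (intro nonzero_minor) auto
    then show "\<exists>a b. a \<le> r \<and> b \<le> r \<and> X s i a * X s j b - X s i b * X s j a \<noteq> 0" by blast
  qed
  then obtain a b where ab: "\<And>i j. i < t \<Longrightarrow> j < t \<Longrightarrow> i \<noteq> j \<Longrightarrow> a i j \<le> r \<and> b i j \<le> r \<and>
      X s i (a i j) * X s j (b i j) - X s i (b i j) * X s j (a i j) \<noteq> 0"
    by (metis DiffI lessThan_iff singletonD)
  define E where "E x = (\<Prod>N\<in>\<F>. poly_eval (f N) (\<lambda>(i, j). x i j))" for x :: "nat \<Rightarrow> nat \<Rightarrow> 'a"
  define H where "H x = (\<Prod>i<t. \<Prod>j\<in>{..<t} - {i}. lin r (l i j) (x i))" for x :: "nat \<Rightarrow> nat \<Rightarrow> 'a"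
  define D where "D x = (\<Prod>i<t. \<Prod>j\<in>{..<t} - {i}. x i (a i j) * x j (b i j) + (-1) * (x i (b i j) * x j (a i j)))"
    for x :: "nat \<Rightarrow> nat \<Rightarrow> 'a"
  have "E \<in> tuple_poly r t" unfolding E_def by (intro tuple_poly_prod tuple_poly_poly_eval f(1))
  moreover have "H \<in> tuple_poly r t" unfolding H_def by (intro tuple_poly_prod tuple_poly_lin) auto
  moreover have "D \<in> tuple_poly r t" unfolding D_def using ab by (intro tuple_poly_prod tuple_poly.intros) auto
  ultimately have "(\<lambda>x. E x * (H x * D x)) \<in> tuple_poly r t" by (intro tuple_poly.mult)
  from maps_sum_polynomial[OF this] obtain Q where
    Q: "\<And>u. u \<in> U \<Longrightarrow> (\<Sum>\<phi>\<in>{..<t} \<rightarrow>\<^sub>E {..<t}. (\<Prod>i<t. \<omega> u (\<phi> i)) *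
      (E (\<lambda>i. X u (\<phi> i)) * (H (\<lambda>i. X u (\<phi> i)) * D (\<lambda>i. X u (\<phi> i))))) = poly Q u"
    by blast
  have "poly Q u = 0" if u: "u \<in> U" "config u \<in> C" for u
  proof -
    have "E (\<lambda>i. X u (\<phi> i)) * (H (\<lambda>i. X u (\<phi> i)) * D (\<lambda>i. X u (\<phi> i))) = 0"
      if \<phi>: "\<phi> \<in> {..<t} \<rightarrow>\<^sub>E {..<t}" for \<phi>
    proof (cases "inj_on \<phi> {..<t}")
      case False
      then obtain i j where ij: "i < t" "j < t" "i \<noteq> j" "\<phi> i = \<phi> j" by (auto simp: inj_on_def)
      then have "D (\<lambda>i. X u (\<phi> i)) = 0"
        unfolding D_def
        by (intro prod_zero[OF finite_lessThan] bexI[of _ i] prod_zero[OF finite_Diff[OF finite_lessThan]] bexI[of _ j]) auto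
      then show ?thesis by simp
    next
      case True
      have "\<phi> ` {..<t} \<subseteq> {..<t}" using \<phi> by (auto simp: PiE_def)
      then have im: "\<phi> ` {..<t} = {..<t}" using True by (simp add: endo_inj_surj)
      let ?ps = "map (\<lambda>i. point u (\<phi> i)) [0..<t]"
      have ps: "?ps \<in> ordered_configs r t" "set ?ps = config u" using ord[OF u(1) im] by blast+
      have "set ?ps \<notin> V" using ps(2) u(2) by (simp add: V_def)
      then obtain N where N: "N \<in> \<F>" "?ps \<notin> N" using \<F>(4) by blast
      then have "?ps \<notin> nonvanishing r t (f N)" using f(2) by blast
      then obtain x where x: "\<forall>i<t. x i \<in> ?ps ! i \<and> x i \<noteq> 0" "poly_eval (f N) (\<lambda>(i, j). x i j) = 0"
        using ps(1) unfolding nonvanishing_def by blast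
      have "\<forall>i<t. \<exists>c. X u (\<phi> i) = fscale c (x i)"
      proof (intro allI impI)
        fix i assume i: "i < t"
        then have "x i \<in> funvec.span {X u (\<phi> i)}" "x i \<noteq> 0" using x(1) by (auto simp: point_def)
        then obtain c where c: "x i = fscale c (X u (\<phi> i))" unfolding span_single by blast
        have "c \<noteq> 0" using c \<open>x i \<noteq> 0\<close> by (auto simp: fscale_def zero_fun_def)
        then have "X u (\<phi> i) = fscale (1 / c) (x i)" unfolding c by (simp add: fscale_def)
        then show "\<exists>c. X u (\<phi> i) = fscale c (x i)" by blast
      qed
      then obtain c where c: "\<And>i. i < t \<Longrightarrow> X u (\<phi> i) = fscale (c i) (x i)" by metis
      have "poly_eval (f N) (\<lambda>(i, j). X u (\<phi> i) j) = poly_eval (f N) (\<lambda>(i, j). c i * x i j)"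
      proof -
        have "Poly_Mapping.keys m \<subseteq> {..<t} \<times> {..r}" if "m \<in> Poly_Mapping.keys (f N)" for m
          using f(1)[OF N(1)] that by (auto simp: multihomogeneous_def)
        then show ?thesis
          unfolding poly_eval_def
          by (intro sum.cong prod.cong refl arg_cong2[where f = "(*)"] arg_cong2[where f = "(^)"])
            (force simp: c fscale_def)
      qed
      also have "\<dots> = 0" by (rule poly_eval_scale[OF f(1)[OF N(1)] x(2)])
      finally have "E (\<lambda>i. X u (\<phi> i)) = 0" unfolding E_def using N(1) \<F>(1) by (intro prod_zero) auto
      then show ?thesis by simp
    qed
    then have "(\<Sum>\<phi>\<in>{..<t} \<rightarrow>\<^sub>E {..<t}. (\<Prod>i<t. \<omega> u (\<phi> i)) *
      (E (\<lambda>i. X u (\<phi> i)) * (H (\<lambda>i. X u (\<phi> i)) * D (\<lambda>i. X u (\<phi> i))))) = 0"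
      by (intro sum.neutral) simp
    then show ?thesis using Q[OF u(1)] by simp
  qed
  moreover have "poly Q s \<noteq> 0"
  proof -
    define \<iota> where "\<iota> = restrict (\<lambda>i. i) {..<t}"
    have \<iota>: "\<iota> \<in> {..<t} \<rightarrow>\<^sub>E {..<t}" by (auto simp: \<iota>_def)
    have "H (\<lambda>i. X s (\<phi> i)) = 0" if \<phi>: "\<phi> \<in> {..<t} \<rightarrow>\<^sub>E {..<t}" "\<phi> \<noteq> \<iota>" for \<phi>
    proof -
      have "\<exists>i<t. \<phi> i \<noteq> i"
      proof (rule ccontr)
        assume "\<not> ?thesis"
        then have "\<phi> = \<iota>" using \<phi>(1) by (intro PiE_ext[OF \<phi>(1) \<iota>]) (auto simp: \<iota>_def)
        then show False using \<phi>(2) by simp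
      qed
      then obtain i where i: "i < t" "\<phi> i \<noteq> i" by blast
      have "\<phi> i < t" using \<phi>(1) i by auto
      then show ?thesis
        unfolding H_def using i l[of i "\<phi> i"]
        by (intro prod_zero[OF finite_lessThan] bexI[of _ i] prod_zero[OF finite_Diff[OF finite_lessThan]] bexI[of _ "\<phi> i"]) auto
    qed
    then have "poly Q s = (\<Prod>i<t. \<omega> s (\<iota> i)) * (E (\<lambda>i. X s (\<iota> i)) * (H (\<lambda>i. X s (\<iota> i)) * D (\<lambda>i. X s (\<iota> i))))"
      unfolding Q[OF s(1), symmetric]
      by (subst sum.remove[OF _ \<iota>]) (auto intro!: finite_PiE sum.neutral)
    moreover have "(\<Prod>i<t. \<omega> s (\<iota> i)) \<noteq> 0" using \<omega>[OF s(1)] by (auto simp: \<iota>_def)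
    moreover have "H (\<lambda>i. X s (\<iota> i)) \<noteq> 0" using l by (auto simp: H_def \<iota>_def)
    moreover have "D (\<lambda>i. X s (\<iota> i)) \<noteq> 0" using ab by (auto simp: D_def \<iota>_def)
    moreover have "E (\<lambda>i. X s (\<iota> i)) \<noteq> 0"
    proof -
      have "poly_eval (f N) (\<lambda>(i, j). X s (\<iota> i) j) \<noteq> 0" if N: "N \<in> \<F>" for N
      proof -
        have "map (\<lambda>i. point s i) [0..<t] \<in> nonvanishing r t (f N)" using bspec[OF \<F>(3) N] f(2)[OF N] by blast
        then have "\<forall>x. (\<forall>i<t. x i \<in> map (\<lambda>i. point s i) [0..<t] ! i \<and> x i \<noteq> 0) \<longrightarrow> poly_eval (f N) (\<lambda>(i, j). x i j) \<noteq> 0"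
          unfolding nonvanishing_def by blast
        moreover have "\<forall>i<t. X s (\<iota> i) \<in> map (\<lambda>i. point s i) [0..<t] ! i \<and> X s (\<iota> i) \<noteq> 0"
          using X(2)[OF s(1)] by (auto simp: \<iota>_def point_def intro: funvec.span_base)
        ultimately show ?thesis by (elim allE[of _ "\<lambda>i. X s (\<iota> i)"]) blast
      qed
      then show ?thesis unfolding E_def using \<F>(1) by simp
    qed
    ultimately show ?thesis by simp
  qed
  ultimately show ?thesis by blast
qed

text \<open>
  If two closed sets covered the family, each missing a member, the product of the two separating
  polynomials would be nonzero with infinitely many zeros.
\<close>

lemma irreducible_config: "irreducible_in (hilb_topology r t) (config ` U)"
  unfolding irreducible_in_def
proof (intro conjI allI impI)
  show "config ` U \<subseteq> topspace (hilb_topology r t)" using config_reduced by auto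
  show "config ` U \<noteq> {}" using inf by auto
  fix C D assume CD: "closedin (hilb_topology r t) C \<and> closedin (hilb_topology r t) D \<and> config ` U \<subseteq> C \<union> D"
  show "config ` U \<subseteq> C \<or> config ` U \<subseteq> D"
  proof (rule ccontr)
    assume "\<not> ?thesis"
    then obtain u v where u: "u \<in> U" "config u \<notin> C" and v: "v \<in> U" "config v \<notin> D" by blast
    obtain P where P: "poly P u \<noteq> 0" "\<forall>u\<in>U. config u \<in> C \<longrightarrow> poly P u = 0"
      using closed_avoiding_polynomial[OF _ u] CD by blast
    obtain Q where Q: "poly Q v \<noteq> 0" "\<forall>u\<in>U. config u \<in> D \<longrightarrow> poly Q u = 0"
      using closed_avoiding_polynomial[OF _ v] CD by blast
    have "P * Q \<noteq> 0" using P Q by auto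
    then have "finite {x. poly (P * Q) x = 0}" by (rule poly_roots_finite)
    moreover have "U \<subseteq> {x. poly (P * Q) x = 0}" using P Q CD by auto
    ultimately show False using inf finite_subset by blast
  qed
qed

end

lemma rank_sets_reduced: "rank_sets r d P \<subseteq> reduced_subsets r (symmetric_rank r d P)"
  by (auto simp: rank_sets_def reduced_subsets_def)

lemma not_isolated_if_in_irreducible:
  assumes "D \<subseteq> rank_sets r d P" "irreducible_in (hilb_topology r (symmetric_rank r d P)) D" "Z \<in> D" "infinite D"
  shows "\<not> isolated_rank_set r d P Z"
proof
  let ?X = "hilb_topology r (symmetric_rank r d P)"
  assume "isolated_rank_set r d P Z"
  then have "irreducible_component_of ?X (?X closure_of rank_sets r d P) {Z}"
    by (simp add: isolated_rank_set_def)
  moreover have "rank_sets r d P \<subseteq> ?X closure_of rank_sets r d P"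
    by (rule closure_of_subset) (use rank_sets_reduced in simp)
  ultimately have "D = {Z}" using assms unfolding irreducible_component_of_def by blast
  then show False using assms(4) by simp
qed

section \<open>Points of the ambient space as functionals on forms\<close>

definition rep :: "('i \<Rightarrow> 'a::field) set \<Rightarrow> 'i \<Rightarrow> 'a" where
  "rep a = (SOME v. v \<noteq> 0 \<and> a = funvec.span {v})"

lemma rep:
  assumes "a \<in> proj_space {..r}"
  shows "rep a \<noteq> 0" "funvec.span {rep a} = a" "rep a \<in> vecs r"
proof -
  obtain v where v: "a = funvec.span {v}" "v \<noteq> 0" "v \<in> vecs r" using assms unfolding proj_space_def vecs_def by blast
  then have "rep a \<noteq> 0 \<and> a = funvec.span {rep a}"
    unfolding rep_def by (intro someI[of "\<lambda>v. v \<noteq> 0 \<and> a = funvec.span {v}" v]) blast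
  then show 1: "rep a \<noteq> 0" "funvec.span {rep a} = a" by auto
  then have "rep a \<in> funvec.span {v}" using funvec.span_base[of "rep a" "{rep a}"] v by auto
  then show "rep a \<in> vecs r" using v unfolding span_single by auto
qed

definition mono_val :: "nat \<Rightarrow> (nat \<Rightarrow>\<^sub>0 nat) \<Rightarrow> (nat \<Rightarrow> 'a::field) \<Rightarrow> 'a" where
  "mono_val r m x = (\<Prod>j\<le>r. x j ^ Poly_Mapping.lookup m j)"

lemma veronese_vec_apply: "m \<in> monomials r d \<Longrightarrow> veronese_vec r d x m = mono_val r m x"
  by (simp add: veronese_vec_def mono_val_def)

lemma veronese_vec_apply_0: "m \<notin> monomials r d \<Longrightarrow> veronese_vec r d x m = 0"
  by (simp add: veronese_vec_def)

lemma veronese_vec_scale: "veronese_vec r d (fscale c x) = fscale (c ^ d) (veronese_vec r d x)"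
proof
  fix m
  show "veronese_vec r d (fscale c x) m = fscale (c ^ d) (veronese_vec r d x) m"
  proof (cases "m \<in> monomials r d")
    case True
    then have "(\<Prod>j\<le>r. c ^ Poly_Mapping.lookup m j) = c ^ d"
      by (simp add: monomials_def power_sum[symmetric])
    then show ?thesis using True by (simp add: veronese_vec_def fscale_def power_mult_distrib prod.distrib)
  next
    case False then show ?thesis by (simp add: veronese_vec_def fscale_def)
  qed
qed

lemma mono_val_form:
  fixes m :: "nat \<Rightarrow>\<^sub>0 nat"
  assumes "m \<in> monomials r d"
  shows "(mono_val r m :: (nat \<Rightarrow> 'a::field) \<Rightarrow> 'a) \<in> forms r d"
proof -
  have "(\<lambda>x::nat \<Rightarrow> 'a. x j ^ n) \<in> forms r n" if "j \<le> r" for j n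
    using forms_lin_power[of r "\<lambda>i. if i = j then 1::'a else 0" n] unfolding lin_unit[OF that] .
  then have "(\<lambda>x::nat \<Rightarrow> 'a. \<Prod>j\<le>r. x j ^ Poly_Mapping.lookup m j) \<in> forms r (\<Sum>j\<le>r. Poly_Mapping.lookup m j)"
    by (intro forms_prod) auto
  then show ?thesis using assms by (simp add: monomials_def mono_val_def[abs_def])
qed

lemma monomials_add_single:
  assumes "m \<in> monomials r n" "j \<le> r"
  shows "m + Poly_Mapping.single j 1 \<in> monomials r (Suc n)"
    "mono_val r (m + Poly_Mapping.single j 1) x = x j * mono_val r m x"
proof -
  have l: "Poly_Mapping.lookup (m + Poly_Mapping.single j 1) i = Poly_Mapping.lookup m i + (if i = j then 1 else 0)" for i
    by (simp add: lookup_add lookup_single when_def)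
  have "(\<Sum>i\<le>r. Poly_Mapping.lookup (m + Poly_Mapping.single j 1) i)
    = (\<Sum>i\<le>r. Poly_Mapping.lookup m i + (if i = j then 1 else 0))" by (intro sum.cong refl l)
  also have "\<dots> = Suc n" using assms by (simp add: sum.distrib monomials_def)
  finally have "(\<Sum>i\<le>r. Poly_Mapping.lookup (m + Poly_Mapping.single j 1) i) = Suc n" .
  moreover have "Poly_Mapping.keys (m + Poly_Mapping.single j 1) \<subseteq> {..r}"
    using assms Poly_Mapping.keys_add[of m "Poly_Mapping.single j 1"] by (auto simp: monomials_def)
  ultimately show "m + Poly_Mapping.single j 1 \<in> monomials r (Suc n)" by (simp add: monomials_def)
  show "mono_val r (m + Poly_Mapping.single j 1) x = x j * mono_val r m x"
  proof -
    have "mono_val r (m + Poly_Mapping.single j 1) x = (\<Prod>i\<le>r. x i ^ (Poly_Mapping.lookup m i + (if i = j then 1 else 0)))"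
      unfolding mono_val_def l ..
    also have "\<dots> = (\<Prod>i\<le>r. x i ^ Poly_Mapping.lookup m i * (if i = j then x i else 1))"
      by (intro prod.cong) (auto simp: power_add)
    also have "\<dots> = mono_val r m x * x j"
      using assms(2) by (simp add: prod.distrib mono_val_def)
    finally show ?thesis by (simp add: mult.commute)
  qed
qed

text \<open>
  The linear factors of \<open>f\<close> are traded one at a time for variables of the monomial.
\<close>

lemma forms_vanish_if_monomials:
  assumes c: "\<And>m. m \<in> monomials r d \<Longrightarrow> (\<Sum>i\<in>I. c i * mono_val r m (X i)) = 0" and f: "f \<in> forms r d"
  shows "(\<Sum>i\<in>I. c i * f (X i)) = 0"
proof -
  have "\<forall>n m. n + e = d \<longrightarrow> m \<in> monomials r n \<longrightarrow> (\<Sum>i\<in>I. c i * (f (X i) * mono_val r m (X i))) = 0"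
    if "f \<in> forms r e" for f e
    using that
  proof (induction rule: forms_induct)
    case (const k)
    then show ?case using c by (auto simp: mult.left_commute[of _ k] sum_distrib_left[symmetric])
  next
    case (lin_mult f e l)
    show ?case
    proof (intro allI impI)
      fix n m assume n: "n + Suc e = d" and m: "m \<in> monomials r n"
      have "(\<Sum>i\<in>I. c i * (lin r l (X i) * f (X i) * mono_val r m (X i)))
        = (\<Sum>i\<in>I. \<Sum>j\<le>r. l j * (c i * (f (X i) * mono_val r (m + Poly_Mapping.single j 1) (X i))))"
      proof (intro sum.cong refl)
        fix i
        have "c i * (lin r l (X i) * f (X i) * mono_val r m (X i))
          = (\<Sum>j\<le>r. l j * (c i * (f (X i) * (X i j * mono_val r m (X i)))))"
          by (simp add: lin_def sum_distrib_left sum_distrib_right mult_ac)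
        also have "\<dots> = (\<Sum>j\<le>r. l j * (c i * (f (X i) * mono_val r (m + Poly_Mapping.single j 1) (X i))))"
          by (intro sum.cong refl) (simp only: monomials_add_single(2)[OF m] atMost_iff)
        finally show "c i * (lin r l (X i) * f (X i) * mono_val r m (X i))
          = (\<Sum>j\<le>r. l j * (c i * (f (X i) * mono_val r (m + Poly_Mapping.single j 1) (X i))))" .
      qed
      also have "\<dots> = (\<Sum>j\<le>r. l j * (\<Sum>i\<in>I. c i * (f (X i) * mono_val r (m + Poly_Mapping.single j 1) (X i))))"
        by (subst sum.swap) (simp add: sum_distrib_left)
      also have "\<dots> = 0"
        using lin_mult.IH n monomials_add_single(1)[OF m] by (intro sum.neutral) auto
      finally show "(\<Sum>i\<in>I. c i * (lin r l (X i) * f (X i) * mono_val r m (X i))) = 0" .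
    qed
  next
    case (add f e g)
    then show ?case by (simp add: distrib_right distrib_left sum.distrib)
  qed
  from this[OF f] have "(\<Sum>i\<in>I. c i * (f (X i) * mono_val r 0 (X i))) = 0"
    by (auto simp: monomials_def)
  then show ?thesis by (simp add: mono_val_def)
qed

lemma veronese_sum_eq_iff:
  fixes a :: "'i \<Rightarrow> 'a::field" and b :: "'j \<Rightarrow> 'a"
  assumes fin: "finite I" "finite J"
  shows "(\<Sum>i\<in>I. fscale (a i) (veronese_vec r d (X i))) = (\<Sum>j\<in>J. fscale (b j) (veronese_vec r d (Y j))) \<longleftrightarrow>
   (\<forall>f\<in>forms r d. (\<Sum>i\<in>I. a i * f (X i)) = (\<Sum>j\<in>J. b j * f (Y j)))"
proof
  assume *: "\<forall>f\<in>forms r d. (\<Sum>i\<in>I. a i * f (X i)) = (\<Sum>j\<in>J. b j * f (Y j))"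
  show "(\<Sum>i\<in>I. fscale (a i) (veronese_vec r d (X i))) = (\<Sum>j\<in>J. fscale (b j) (veronese_vec r d (Y j)))"
  proof
    fix m
    show "(\<Sum>i\<in>I. fscale (a i) (veronese_vec r d (X i))) m = (\<Sum>j\<in>J. fscale (b j) (veronese_vec r d (Y j))) m"
    proof (cases "m \<in> monomials r d")
      case True
      then show ?thesis using bspec[OF * mono_val_form[OF True]] by (simp add: sum_fun_apply fscale_def veronese_vec_apply)
    next
      case False then show ?thesis by (simp add: sum_fun_apply fscale_def veronese_vec_apply_0)
    qed
  qed
next
  assume *: "(\<Sum>i\<in>I. fscale (a i) (veronese_vec r d (X i))) = (\<Sum>j\<in>J. fscale (b j) (veronese_vec r d (Y j)))"
  show "\<forall>f\<in>forms r d. (\<Sum>i\<in>I. a i * f (X i)) = (\<Sum>j\<in>J. b j * f (Y j))"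
  proof
    fix f :: "(nat \<Rightarrow> 'a) \<Rightarrow> 'a" assume f: "f \<in> forms r d"
    define c where "c = case_sum a (\<lambda>j. - b j)"
    define Z where "Z = case_sum X Y"
    have split: "(\<Sum>k\<in>I <+> J. c k * g (Z k)) = (\<Sum>i\<in>I. a i * g (X i)) - (\<Sum>j\<in>J. b j * g (Y j))" for g
      using fin by (simp add: sum.Plus c_def Z_def sum_negf)
    have "(\<Sum>k\<in>I <+> J. c k * mono_val r m (Z k)) = 0" if m: "m \<in> monomials r d" for m
      using fun_cong[OF *, of m] m by (simp add: split sum_fun_apply fscale_def veronese_vec_apply)
    from forms_vanish_if_monomials[OF this f] show "(\<Sum>i\<in>I. a i * f (X i)) = (\<Sum>j\<in>J. b j * f (Y j))"
      by (simp add: split)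
  qed
qed

lemma in_span_image:
  fixes g :: "'i \<Rightarrow> 'j \<Rightarrow> 'b::field"
  assumes "finite A" "p \<in> funvec.span (g ` A)"
  shows "\<exists>\<alpha>. p = (\<Sum>a\<in>A. fscale (\<alpha> a) (g a))"
proof -
  have "funvec.span (g ` A) \<subseteq> {p. \<exists>\<alpha>. p = (\<Sum>a\<in>A. fscale (\<alpha> a) (g a))}"
  proof (rule funvec.span_minimal)
    show "g ` A \<subseteq> {p. \<exists>\<alpha>. p = (\<Sum>a\<in>A. fscale (\<alpha> a) (g a))}"
    proof
      fix x assume "x \<in> g ` A"
      then obtain a where a: "a \<in> A" "x = g a" by blast
      have "(\<Sum>b\<in>A. fscale (if b = a then 1 else 0) (g b)) = (\<Sum>b\<in>A. if b = a then g a else 0)"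
        by (intro sum.cong) auto
      then show "x \<in> {p. \<exists>\<alpha>. p = (\<Sum>a\<in>A. fscale (\<alpha> a) (g a))}"
        using a assms(1) by (intro CollectI exI[of _ "\<lambda>b. if b = a then 1 else 0"]) simp
    qed
    show "funvec.subspace {p. \<exists>\<alpha>. p = (\<Sum>a\<in>A. fscale (\<alpha> a) (g a))}"
    proof (rule funvec.subspaceI)
      show "0 \<in> {p. \<exists>\<alpha>. p = (\<Sum>a\<in>A. fscale (\<alpha> a) (g a))}"
        by (intro CollectI exI[of _ "\<lambda>_. 0"]) simp
      fix x y and c :: 'b
      assume "x \<in> {p. \<exists>\<alpha>. p = (\<Sum>a\<in>A. fscale (\<alpha> a) (g a))}"
      then obtain \<alpha> where \<alpha>: "x = (\<Sum>a\<in>A. fscale (\<alpha> a) (g a))" by blast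
      show "fscale c x \<in> {p. \<exists>\<alpha>. p = (\<Sum>a\<in>A. fscale (\<alpha> a) (g a))}"
        by (intro CollectI exI[of _ "\<lambda>a. c * \<alpha> a"]) (simp add: \<alpha> funvec.scale_sum_right)
      assume "y \<in> {p. \<exists>\<alpha>. p = (\<Sum>a\<in>A. fscale (\<alpha> a) (g a))}"
      then obtain \<beta> where \<beta>: "y = (\<Sum>a\<in>A. fscale (\<beta> a) (g a))" by blast
      show "x + y \<in> {p. \<exists>\<alpha>. p = (\<Sum>a\<in>A. fscale (\<alpha> a) (g a))}"
        by (intro CollectI exI[of _ "\<lambda>a. \<alpha> a + \<beta> a"]) (simp add: \<alpha> \<beta> funvec.scale_left_distrib sum.distrib)
    qed
  qed
  then show ?thesis using assms(2) by blast
qed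

lemma veronese_point: "veronese r d (funvec.span {v}) = funvec.span {veronese_vec r d v}"
proof (unfold veronese_def, rule antisym)
  show "funvec.span (veronese_vec r d ` funvec.span {v}) \<subseteq> funvec.span {veronese_vec r d v}"
  proof (intro funvec.span_minimal funvec.subspace_span subsetI)
    fix y assume "y \<in> veronese_vec r d ` funvec.span {v}"
    then obtain x where "x \<in> funvec.span {v}" "y = veronese_vec r d x" by blast
    then obtain c where "y = veronese_vec r d (fscale c v)" unfolding span_single by blast
    then show "y \<in> funvec.span {veronese_vec r d v}" unfolding veronese_vec_scale span_single by blast
  qed
  have "v \<in> funvec.span {v}" by (simp add: funvec.span_base)
  then show "funvec.span {veronese_vec r d v} \<subseteq> funvec.span (veronese_vec r d ` funvec.span {v})"
    by (intro funvec.span_mono) auto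
qed

lemma proj_span_decomposition:
  assumes A: "A \<subseteq> proj_space {..r}" "finite A"
    and P: "funvec.span {p} \<in> proj_span (monomials r d) (veronese r d ` A)"
  shows "\<exists>\<alpha>. p = (\<Sum>a\<in>A. fscale (\<alpha> a) (veronese_vec r d (rep a)))"
proof (rule in_span_image[OF A(2)])
  have "p \<in> funvec.span {p}" by (simp add: funvec.span_base)
  then have "p \<in> funvec.span (\<Union>(veronese r d ` A))" using P unfolding proj_span_def by blast
  moreover have "\<Union>(veronese r d ` A) \<subseteq> funvec.span ((\<lambda>a. veronese_vec r d (rep a)) ` A)"
  proof (rule Union_least)
    fix Y assume "Y \<in> veronese r d ` A"
    then obtain a where a: "a \<in> A" "Y = veronese r d a" by blast
    then have "funvec.span {rep a} = a" using rep(2)[of a r] A(1) by blast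
    then have "Y = funvec.span {veronese_vec r d (rep a)}" using a veronese_point[of r d "rep a"] by simp
    also have "\<dots> \<subseteq> funvec.span ((\<lambda>a. veronese_vec r d (rep a)) ` A)" using a by (intro funvec.span_mono) auto
    finally show "Y \<subseteq> funvec.span ((\<lambda>a. veronese_vec r d (rep a)) ` A)" .
  qed
  ultimately show "p \<in> funvec.span ((\<lambda>a. veronese_vec r d (rep a)) ` A)"
    using funvec.span_minimal[OF _ funvec.subspace_span] by blast
qed

locale rank_context =
  fixes r d t :: nat and p :: "(nat \<Rightarrow>\<^sub>0 nat) \<Rightarrow> 'a::{alg_closed_field, field_char_0}"
  assumes P: "funvec.span {p} \<in> proj_space (monomials r d)"
    and t: "symmetric_rank r d (funvec.span {p}) = t" and t0: "t > 0" and d0: "d \<ge> 1"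
begin

abbreviation "P \<equiv> funvec.span {p}"

definition represents :: "'i set \<Rightarrow> ('i \<Rightarrow> nat \<Rightarrow> 'a) \<Rightarrow> ('i \<Rightarrow> 'a) \<Rightarrow> bool" where
  "represents I X c \<longleftrightarrow> p = (\<Sum>i\<in>I. fscale (c i) (veronese_vec r d (X i)))"

lemma represents_transfer:
  assumes "represents I X a" "finite I" "finite J"
    "\<And>f. f \<in> forms r d \<Longrightarrow> (\<Sum>i\<in>I. a i * f (X i)) = (\<Sum>j\<in>J. b j * f (Y j))"
  shows "represents J Y b"
  using assms veronese_sum_eq_iff[OF assms(2,3), of a r d X b Y] unfolding represents_def by blast

lemma represents_eq:
  assumes "represents I X a" "represents J Y b" "finite I" "finite J" "f \<in> forms r d"
  shows "(\<Sum>i\<in>I. a i * f (X i)) = (\<Sum>j\<in>J. b j * f (Y j))"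
  using assms veronese_sum_eq_iff[OF assms(3,4), of a r d X b Y] unfolding represents_def by metis

lemma represents_rank_set:
  assumes rp: "represents I X c" and I: "finite I" "\<And>i. i \<in> I \<Longrightarrow> X i \<in> vecs r" "\<And>i. i \<in> I \<Longrightarrow> X i \<noteq> 0"
  defines "S \<equiv> (\<lambda>i. funvec.span {X i}) ` I"
  shows "t \<le> card S" "card S \<le> t \<Longrightarrow> S \<in> rank_sets r d P"
proof -
  have S: "S \<subseteq> proj_space {..r}" "finite S" unfolding S_def using I by (auto intro: span_in_proj_space)
  have "p \<in> funvec.span (\<Union>(veronese r d ` S))"
  proof -
    have "veronese_vec r d (X i) \<in> \<Union>(veronese r d ` S)" if "i \<in> I" for i
      using that unfolding S_def by (auto simp: veronese_point intro!: bexI[of _ i] funvec.span_base)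
    then show ?thesis
      using rp unfolding represents_def by (auto intro!: funvec.span_sum funvec.span_scale intro: funvec.span_base)
  qed
  then have "P \<subseteq> funvec.span (\<Union>(veronese r d ` S))"
    by (intro funvec.span_minimal funvec.subspace_span) auto
  then have PS: "P \<in> proj_span (monomials r d) (veronese r d ` S)" using P by (simp add: proj_span_def)
  have "symmetric_rank r d P \<le> card (veronese r d ` S)"
    unfolding symmetric_rank_def
    by (rule Least_le, rule exI[of _ "veronese r d ` S"]) (use S PS in \<open>auto simp: veronese_variety_def\<close>)
  also have "\<dots> \<le> card S" using S by (intro card_image_le)
  finally show "t \<le> card S" using t by simp
  then show "card S \<le> t \<Longrightarrow> S \<in> rank_sets r d P" using S PS t by (simp add: rank_sets_def)
qed

lemma rank_set_represents:
  assumes "A \<in> rank_sets r d P"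
  shows "\<exists>\<alpha>. represents A rep \<alpha>"
  using assms proj_span_decomposition[of A r p d] unfolding represents_def rank_sets_def by blast

end

section \<open>Parametrised lines and conics\<close>

text \<open>
  The last two clauses say that restriction to the curve identifies forms of degree \<open>d\<close>, up to those
  vanishing on the curve, with polynomials of degree at most \<open>D\<close>. The point at infinity of the curve
  is not in the image of \<open>\<gamma>\<close>.
\<close>

definition param_curve :: "nat \<Rightarrow> nat \<Rightarrow> ('a::field \<Rightarrow> nat \<Rightarrow> 'a) \<Rightarrow> nat \<Rightarrow> bool" where
  "param_curve r d \<gamma> D \<longleftrightarrow>
     (\<forall>x. \<gamma> x \<in> vecs r \<and> \<gamma> x \<noteq> 0) \<and> (\<forall>x y. x \<noteq> y \<longrightarrow> \<gamma> y \<notin> funvec.span {\<gamma> x}) \<and>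
     (\<exists>G. \<forall>x j. \<gamma> x j = poly (G j) x) \<and>
     (\<forall>f\<in>forms r d. \<exists>q. degree q \<le> D \<and> (\<forall>x. f (\<gamma> x) = poly q x)) \<and>
     (\<forall>q. degree q \<le> D \<longrightarrow> (\<exists>f\<in>forms r d. \<forall>x. f (\<gamma> x) = poly q x))"

lemma param_curveD:
  assumes "param_curve r d \<gamma> D"
  shows "\<gamma> x \<in> vecs r" "\<gamma> x \<noteq> 0" "x \<noteq> y \<Longrightarrow> \<gamma> y \<notin> funvec.span {\<gamma> x}"
    "\<exists>G. \<forall>x j. \<gamma> x j = poly (G j) x"
    "f \<in> forms r d \<Longrightarrow> \<exists>q. degree q \<le> D \<and> (\<forall>x. f (\<gamma> x) = poly q x)"
    "degree q \<le> D \<Longrightarrow> \<exists>f\<in>forms r d. \<forall>x. f (\<gamma> x) = poly q x"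
  using assms unfolding param_curve_def by (elim conjE; simp)+

lemma param_curve_vector_poly:
  assumes "param_curve r d \<gamma> D" "q \<in> vector_poly r"
  shows "\<exists>Q. \<forall>x. q (\<gamma> x) = poly Q x"
  using assms(2)
proof induction
  case (const c) then show ?case by (intro exI[of _ "[:c:]"]) simp
next
  case (coord j)
  obtain G where "\<forall>x j. \<gamma> x j = poly (G j) x" using param_curveD(4)[OF assms(1)] by (elim exE)
  then show ?case by (intro exI[of _ "G j"]) simp
next
  case (add f g)
  then obtain F G where "\<forall>x. f (\<gamma> x) = poly F x" "\<forall>x. g (\<gamma> x) = poly G x" by blast
  then show ?case by (intro exI[of _ "F + G"]) simp
next
  case (mult f g)
  then obtain F G where "\<forall>x. f (\<gamma> x) = poly F x" "\<forall>x. g (\<gamma> x) = poly G x" by blast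
  then show ?case by (intro exI[of _ "F * G"]) simp
qed

text \<open>
  The leading coefficient of the restriction is the value at the point at infinity.
\<close>

lemma line_pullback:
  assumes "f \<in> forms r d"
  shows "\<exists>q. degree q \<le> d \<and> coeff q d = f o' \<and> (\<forall>x. f (p + fscale x o') = poly q x)"
  using assms
proof (induction rule: forms_induct)
  case (const c) then show ?case by (intro exI[of _ "[:c:]"]) simp
next
  case (lin_mult f d l)
  then obtain q where q: "degree q \<le> d" "coeff q d = f o'" "\<And>x. f (p + fscale x o') = poly q x" by blast
  let ?q = "[:lin r l p, lin r l o':] * q"
  have "degree ?q \<le> Suc d" using degree_mult_le[of "[:lin r l p, lin r l o':]" q] q(1) by (auto split: if_splits)
  moreover have "coeff ?q (Suc d) = lin r l o' * f o'"
    using q coeff_eq_0[of q "Suc d"] by (simp add: coeff_pCons)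
  moreover have "lin r l (p + fscale x o') * f (p + fscale x o') = poly ?q x" for x
    by (simp only: q(3) lin_add lin_scale, simp add: algebra_simps)
  ultimately show ?case by blast
next
  case (add f d g)
  then obtain F G where "degree F \<le> d" "coeff F d = f o'" "\<forall>x. f (p + fscale x o') = poly F x"
    "degree G \<le> d" "coeff G d = g o'" "\<forall>x. g (p + fscale x o') = poly G x" by blast
  then show ?case
    by (intro exI[of _ "F + G"] conjI allI) (simp_all only: degree_add_le coeff_add poly_add)
qed

lemma poly_as_form:
  fixes q :: "'a::field poly"
  assumes "\<And>i. i \<le> D \<Longrightarrow> \<exists>f\<in>forms r d. \<forall>x. f (\<gamma> x) = x ^ i" "degree q \<le> D"
  shows "\<exists>f\<in>forms r d. \<forall>x. f (\<gamma> x) = poly q x"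
proof -
  obtain m where m: "\<And>i. i \<le> D \<Longrightarrow> m i \<in> forms r d \<and> (\<forall>x. m i (\<gamma> x) = x ^ i)" using assms(1) by metis
  let ?f = "\<lambda>v. \<Sum>i\<le>degree q. coeff q i * m i v"
  have "?f \<in> forms r d" using m assms(2) by (intro forms_sum forms_scale) auto
  moreover have "?f (\<gamma> x) = poly q x" for x
    unfolding poly_altdef using m assms(2) by (intro sum.cong) auto
  ultimately show ?thesis by (intro bexI[of _ ?f] allI)
qed

lemma not_prop_if_lin:
  assumes "lin r k v = 1" "lin r k w = 1" "lin r l v \<noteq> lin r l w"
  shows "w \<notin> funvec.span {v}"
proof
  assume "w \<in> funvec.span {v}"
  then obtain c where "w = fscale c v" unfolding span_single by blast
  then show False using assms by auto
qed

lemma param_curve_line: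
  assumes "frame2 r p q"
  shows "param_curve r d (\<lambda>x. p + fscale x q) d"
proof -
  obtain k l where V: "p \<in> vecs r" "q \<in> vecs r" and kl: "lin r k p = 1" "lin r k q = 0" "lin r l p = 0" "lin r l q = 1"
    using assms unfolding frame2_def by blast
  have kx: "lin r k (p + fscale x q) = 1" and lx: "lin r l (p + fscale x q) = x" for x by (simp_all add: kl)
  have "\<exists>f\<in>forms r d. \<forall>x. f (p + fscale x q) = x ^ i" if "i \<le> d" for i
  proof -
    have "(\<lambda>v. lin r l v ^ i * lin r k v ^ (d - i)) \<in> forms r (i + (d - i))" by (intro forms_mult forms_lin_power)
    then show ?thesis using that kx lx by (intro bexI[of _ "\<lambda>v. lin r l v ^ i * lin r k v ^ (d - i)"]) auto
  qed
  note pf = poly_as_form[OF this]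
  show ?thesis
    unfolding param_curve_def
  proof (intro conjI allI impI ballI)
    fix x show "p + fscale x q \<in> vecs r" using V by simp
    show "p + fscale x q \<noteq> 0" using kx[of x] by (metis lin_zero zero_neq_one)
  next
    fix x y :: 'a assume "x \<noteq> y"
    then have "lin r l (p + fscale x q) \<noteq> lin r l (p + fscale y q)" by (simp only: lx simp_thms)
    then show "p + fscale y q \<notin> funvec.span {p + fscale x q}" by (rule not_prop_if_lin[OF kx kx])
  next
    show "\<exists>G. \<forall>x j. (p + fscale x q) j = poly (G j) x"
      by (intro exI[of _ "\<lambda>j. [:p j, q j:]"]) (simp add: fscale_def)
  next
    fix f :: "(nat \<Rightarrow> 'a) \<Rightarrow> 'a" assume "f \<in> forms r d"
    then show "\<exists>qa. degree qa \<le> d \<and> (\<forall>x. f (p + fscale x q) = poly qa x)" using line_pullback by blast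
  next
    fix g :: "'a poly" assume "degree g \<le> d"
    then show "\<exists>f\<in>forms r d. \<forall>x. f (p + fscale x q) = poly g x" by (rule pf[rotated])
  qed
qed

lemma conic_pullback:
  assumes "f \<in> forms r d"
  shows "\<exists>q. degree q \<le> 2 * d \<and> (\<forall>x. f (c + fscale x b + fscale (x ^ 2) a) = poly q x)"
  using assms
proof (induction rule: forms_induct)
  case (const c) then show ?case by (intro exI[of _ "[:c:]"]) simp
next
  case (lin_mult f d l)
  then obtain q where q: "degree q \<le> 2 * d" "\<And>x. f (c + fscale x b + fscale (x ^ 2) a) = poly q x" by blast
  let ?q = "[:lin r l c, lin r l b, lin r l a:] * q"
  have "degree [:lin r l c, lin r l b, lin r l a:] \<le> 2" by simp
  then have "degree ?q \<le> 2 * Suc d" using degree_mult_le[of "[:lin r l c, lin r l b, lin r l a:]" q] q(1) by simp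
  moreover have "lin r l (c + fscale x b + fscale (x ^ 2) a) * f (c + fscale x b + fscale (x ^ 2) a) = poly ?q x" for x
    by (simp only: q(2) lin_add lin_scale, simp add: power2_eq_square algebra_simps)
  ultimately show ?case by blast
next
  case (add f d g)
  then obtain F G where "degree F \<le> 2 * d" "\<forall>x. f (c + fscale x b + fscale (x ^ 2) a) = poly F x"
    "degree G \<le> 2 * d" "\<forall>x. g (c + fscale x b + fscale (x ^ 2) a) = poly G x" by blast
  then show ?case
    by (intro exI[of _ "F + G"] conjI allI) (simp_all only: degree_add_le coeff_add poly_add)
qed

lemma param_curve_conic:
  assumes "frame3 r a b c"
  shows "param_curve r d (\<lambda>x. c + fscale x b + fscale (x ^ 2) a) (2 * d)"
proof -
  let ?g = "\<lambda>x. c + fscale x b + fscale (x ^ 2) a"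
  obtain k l m where V: "a \<in> vecs r" "b \<in> vecs r" "c \<in> vecs r" and klm: "lin r k a = 1" "lin r k b = 0" "lin r k c = 0"
    "lin r l a = 0" "lin r l b = 1" "lin r l c = 0" "lin r m a = 0" "lin r m b = 0" "lin r m c = 1"
    using assms unfolding frame3_def by blast
  have kx: "lin r k (?g x) = x ^ 2" and lx: "lin r l (?g x) = x" and mx: "lin r m (?g x) = 1" for x by (simp_all add: klm)
  have "\<exists>f\<in>forms r d. \<forall>x. f (?g x) = x ^ i" if "i \<le> 2 * d" for i
  proof -
    define e where "e = i div 2"
    have "i = 2 * e \<or> (i = 2 * e + 1 \<and> e + 1 \<le> d)" using that unfolding e_def by linarith
    then show ?thesis
    proof
      assume i: "i = 2 * e"
      have "(\<lambda>v. lin r k v ^ e * lin r m v ^ (d - e)) \<in> forms r (e + (d - e))" by (intro forms_mult forms_lin_power)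
      then show ?thesis using that i kx mx
        by (intro bexI[of _ "\<lambda>v. lin r k v ^ e * lin r m v ^ (d - e)"]) (auto simp: power_mult[symmetric])
    next
      assume i: "i = 2 * e + 1 \<and> e + 1 \<le> d"
      have "(\<lambda>v. lin r k v ^ e * (lin r l v * lin r m v ^ (d - e - 1))) \<in> forms r (e + (1 + (d - e - 1)))"
        by (intro forms_mult forms_lin_power forms_lin)
      then show ?thesis using i kx mx lx
        by (intro bexI[of _ "\<lambda>v. lin r k v ^ e * (lin r l v * lin r m v ^ (d - e - 1))"]) (auto simp: power_mult[symmetric])
    qed
  qed
  note pf = poly_as_form[OF this]
  show ?thesis
    unfolding param_curve_def
  proof (intro conjI allI impI ballI)
    fix x show "?g x \<in> vecs r" using V by simp
    show "?g x \<noteq> 0" using mx[of x] by (metis lin_zero zero_neq_one)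
  next
    fix x y :: 'a assume "x \<noteq> y"
    then have "lin r l (?g x) \<noteq> lin r l (?g y)" by (simp only: lx simp_thms)
    then show "?g y \<notin> funvec.span {?g x}" by (rule not_prop_if_lin[OF mx mx])
  next
    show "\<exists>G. \<forall>x j. (?g x) j = poly (G j) x"
      by (intro exI[of _ "\<lambda>j. [:c j, b j, a j:]"]) (simp add: fscale_def power2_eq_square algebra_simps)
  next
    fix f :: "(nat \<Rightarrow> 'a) \<Rightarrow> 'a" assume "f \<in> forms r d"
    then show "\<exists>q. degree q \<le> 2 * d \<and> (\<forall>x. f (?g x) = poly q x)" by (rule conic_pullback)
  next
    fix g :: "'a poly" assume "degree g \<le> 2 * d"
    then show "\<exists>f\<in>forms r d. \<forall>x. f (?g x) = poly g x" by (rule pf[rotated])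
  qed
qed

definition on_curve :: "('a::field \<Rightarrow> nat \<Rightarrow> 'a) \<Rightarrow> (nat \<Rightarrow> 'a) set \<Rightarrow> bool" where
  "on_curve \<gamma> F \<longleftrightarrow> (\<forall>v\<in>F. \<exists>c x. c \<noteq> 0 \<and> v = fscale c (\<gamma> x))"

text \<open>
  The parametrisation is chosen with its point at infinity outside \<open>F\<close>.
\<close>

lemma line_parametrization:
  fixes F :: "(nat \<Rightarrow> 'a::field_char_0) set"
  assumes fr: "frame2 r p q" and F: "finite F" "F \<subseteq> funvec.span {p, q}" "0 \<notin> F"
  shows "\<exists>\<gamma>. param_curve r d \<gamma> d \<and> on_curve \<gamma> F"
proof -
  obtain k l where V: "p \<in> vecs r" "q \<in> vecs r" and kl: "lin r k p = 1" "lin r k q = 0" "lin r l p = 0" "lin r l q = 1"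
    using fr unfolding frame2_def by blast
  have coord: "v = fscale (lin r k v) p + fscale (lin r l v) q" if v: "v \<in> F" for v
  proof -
    have "v \<in> funvec.span {p, q}" using v F by blast
    then obtain x y where "v = fscale x p + fscale y q" unfolding span_pair by blast
    then show ?thesis by (simp add: kl)
  qed
  have "finite ((\<lambda>v. lin r l v / lin r k v) ` F)" using F by simp
  then obtain s where s: "s \<notin> (\<lambda>v. lin r l v / lin r k v) ` F \<union> {0}"
    using ex_new_if_finite[OF infinite_UNIV_char_0] by (metis finite.emptyI finite_UnI finite_insert)
  \<comment> \<open>the point at infinity becomes \<open>p + s * q\<close>\<close>
  define q' where "q' = p + fscale s q"
  have "frame2 r q q'"
    unfolding frame2_def
  proof (intro conjI exI)
    show "q \<in> vecs r" "q' \<in> vecs r" using V by (auto simp: q'_def)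
    show "lin r (\<lambda>j. 1 * l j - s * k j) q = 1" "lin r (\<lambda>j. 1 * l j - s * k j) q' = 0" "lin r k q = 0" "lin r k q' = 1"
      unfolding lin_coeff_diff by (auto simp: q'_def kl)
  qed
  from param_curve_line[OF this] have "param_curve r d (\<lambda>x. q + fscale x q') d" .
  moreover have "on_curve (\<lambda>x. q + fscale x q') F"
    unfolding on_curve_def
  proof
    fix v assume v: "v \<in> F"
    \<comment> \<open>the coordinate of \<open>q\<close> in the new frame\<close>
    define \<kappa> where "\<kappa> = lin r l v - s * lin r k v"
    have "\<kappa> \<noteq> 0"
    proof
      assume "\<kappa> = 0"
      then have e: "lin r l v = s * lin r k v" by (simp add: \<kappa>_def)
      show False
      proof (cases "lin r k v = 0")
        case True
        then have "v = 0" using coord[OF v] e by simp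
        then show False using v F by blast
      next
        case False
        then have "s = lin r l v / lin r k v" using e by simp
        then show False using s v by blast
      qed
    qed
    moreover have "v = fscale \<kappa> (q + fscale (lin r k v / \<kappa>) q')"
    proof -
      have "fscale \<kappa> (q + fscale (lin r k v / \<kappa>) q') = fscale \<kappa> q + fscale (lin r k v) q'"
        using \<open>\<kappa> \<noteq> 0\<close> by (simp add: funvec.scale_right_distrib)
      also have "\<dots> = fscale (lin r k v) p + fscale (lin r l v) q"
        by (simp add: q'_def \<kappa>_def fscale_def fun_eq_iff algebra_simps)
      finally show ?thesis using coord[OF v] by simp
    qed
    ultimately show "\<exists>c x. c \<noteq> 0 \<and> v = fscale c (q + fscale x q')" by blast
  qed
  ultimately show ?thesis by blast
qed

lemma conic_parametrization:
  fixes F :: "(nat \<Rightarrow> 'a::field_char_0) set"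
  assumes fr: "frame3 r a b c" and F: "finite F" "F \<subseteq> conic a b c" "0 \<notin> F"
  shows "\<exists>\<gamma>. param_curve r d \<gamma> (2 * d) \<and> on_curve \<gamma> F"
proof -
  obtain k l m where V: "a \<in> vecs r" "b \<in> vecs r" "c \<in> vecs r" and klm: "lin r k a = 1" "lin r k b = 0" "lin r k c = 0"
    "lin r l a = 0" "lin r l b = 1" "lin r l c = 0" "lin r m a = 0" "lin r m b = 0" "lin r m c = 1"
    using fr unfolding frame3_def by blast
  have coord: "v = fscale (lin r k v) a + fscale (lin r l v) b + fscale (lin r m v) c \<and> lin r l v ^ 2 = lin r k v * lin r m v"
    if v: "v \<in> F" for v
  proof -
    obtain x y z where "v = fscale x a + fscale y b + fscale z c" "y ^ 2 = x * z"
      using v F unfolding conic_def by blast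
    then show ?thesis by (simp add: klm)
  qed
  have "finite ((\<lambda>v. lin r l v / lin r k v) ` F)" using F by simp
  then obtain s where s: "s \<notin> (\<lambda>v. lin r l v / lin r k v) ` F \<union> {0}"
    using ex_new_if_finite[OF infinite_UNIV_char_0] by (metis finite.emptyI finite_UnI finite_insert)
  \<comment> \<open>the point at infinity becomes \<open>a + s * b + s ^ 2 * c\<close>\<close>
  define a' where "a' = a + fscale s b + fscale (s ^ 2) c"
  define b' where "b' = b + fscale (2 * s) c"
  have "frame3 r a' b' c"
    unfolding frame3_def
  proof (intro conjI exI)
    show "a' \<in> vecs r" "b' \<in> vecs r" "c \<in> vecs r" using V by (auto simp: a'_def b'_def)
    let ?m = "\<lambda>j. 1 * (\<lambda>j. 1 * m j - 2 * s * l j) j + s ^ 2 * k j"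
    show "lin r k a' = 1" "lin r k b' = 0" "lin r k c = 0" by (auto simp: a'_def b'_def klm)
    show "lin r (\<lambda>j. 1 * l j - s * k j) a' = 0" "lin r (\<lambda>j. 1 * l j - s * k j) b' = 1" "lin r (\<lambda>j. 1 * l j - s * k j) c = 0"
      unfolding lin_coeff_diff by (auto simp: a'_def b'_def klm)
    show "lin r ?m a' = 0" "lin r ?m b' = 0" "lin r ?m c = 1"
      unfolding lin_coeff_add lin_coeff_diff by (auto simp: a'_def b'_def klm power2_eq_square)
  qed
  from param_curve_conic[OF this] have "param_curve r d (\<lambda>x. c + fscale x b' + fscale (x ^ 2) a') (2 * d)" .
  moreover have "on_curve (\<lambda>x. c + fscale x b' + fscale (x ^ 2) a') F"
    unfolding on_curve_def
  proof
    fix v assume v: "v \<in> F"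
    define X where "X = lin r k v"
    define Y where "Y = lin r l v"
    define Z where "Z = lin r m v"
    have vXYZ: "v = fscale X a + fscale Y b + fscale Z c" and YXZ: "Y ^ 2 = X * Z"
      using coord[OF v] by (auto simp: X_def Y_def Z_def)
    \<comment> \<open>the coordinate of \<open>c\<close> in the new frame; on the conic it vanishes only at infinity\<close>
    define \<kappa> where "\<kappa> = Z - 2 * s * Y + s ^ 2 * X"
    define y where "y = Y - s * X"
    have yX: "y ^ 2 = X * \<kappa>"
      using YXZ by (simp add: y_def \<kappa>_def power2_eq_square algebra_simps)
    have \<kappa>: "\<kappa> \<noteq> 0"
    proof
      assume "\<kappa> = 0"
      then have "y = 0" using yX by simp
      then have Y: "Y = s * X" by (simp add: y_def)
      have "X \<noteq> 0"
      proof
        assume "X = 0"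
        then have "Y = 0" "Z = 0" using Y \<open>\<kappa> = 0\<close> by (auto simp: \<kappa>_def)
        then have "v = 0" using vXYZ \<open>X = 0\<close> by simp
        then show False using v F by blast
      qed
      then have "s = Y / X" using Y by simp
      then show False using s v unfolding X_def Y_def by blast
    qed
    have "fscale \<kappa> (c + fscale (y / \<kappa>) b' + fscale ((y / \<kappa>) ^ 2) a') = fscale \<kappa> c + fscale y b' + fscale X a'"
    proof -
      have "\<kappa> * (y / \<kappa>) ^ 2 = X" using \<kappa> yX by (simp add: power_divide power2_eq_square[of \<kappa>])
      then show ?thesis using \<kappa> by (simp add: funvec.scale_right_distrib)
    qed
    also have "\<dots> = v"
      unfolding vXYZ by (simp add: a'_def b'_def \<kappa>_def y_def fscale_def fun_eq_iff power2_eq_square algebra_simps)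
    finally show "\<exists>ca x. ca \<noteq> 0 \<and> v = fscale ca (c + fscale x b' + fscale (x ^ 2) a')" using \<kappa> by metis
  qed
  ultimately show ?thesis by blast
qed

section \<open>Moving a rank set along a pencil\<close>

context rank_context
begin

text \<open>
  Replace the points with parameters in \<open>S1\<close> and \<open>S2\<close> on two curves by the roots of the members of the two pencils,
  with the same \<open>u\<close>, and keep \<open>R\<close>. The functional on the first curve changes by a multiple of the evaluation
  at infinity, the one on the second curve by the opposite multiple, and these cancel by \<open>glue\<close>. As
  only \<open>t\<close> points are used, minimality of the rank shows that they are distinct.
\<close>

lemma double_pencil_family:
  fixes \<gamma>1 \<gamma>2 :: "'a \<Rightarrow> nat \<Rightarrow> 'a" and \<mu> :: 'a
  assumes A: "A \<in> rank_sets r d P" "represents A rep \<alpha>"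
    and \<gamma>: "param_curve r d \<gamma>1 D1" "param_curve r d \<gamma>2 D2"
    and S: "finite S1" "finite T1" "card T1 = card S1" "finite S2" "finite T2" "card T2 = card S2"
    and R: "finite R" "R \<subseteq> vecs r" "0 \<notin> R"
    and A_eq: "A = (\<lambda>x. funvec.span {\<gamma>1 x}) ` S1 \<union> (\<lambda>x. funvec.span {\<gamma>2 x}) ` S2 \<union> (\<lambda>v. funvec.span {v}) ` R"
    and card: "card S1 + card S2 + card R = t"
    and \<alpha>: "\<And>f. f \<in> forms r d \<Longrightarrow> (\<Sum>a\<in>A. \<alpha> a * f (rep a))
      = (\<Sum>s\<in>S1. a1 s * f (\<gamma>1 s)) + (\<Sum>s\<in>S2. a2 s * f (\<gamma>2 s)) + (\<Sum>v\<in>R. a3 v * f v)"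
    and rel1: "\<And>q. degree q \<le> D1 \<Longrightarrow> (\<Sum>s\<in>S1. a1 s * poly q s) = (\<Sum>s\<in>T1. b1 s * poly q s) + \<mu> * coeff q D1"
    and rel2: "\<And>q. degree q \<le> D2 \<Longrightarrow> (\<Sum>s\<in>S2. a2 s * poly q s) = (\<Sum>s\<in>T2. b2 s * poly q s) + (- \<mu>) * coeff q D2"
    and glue: "\<And>f q1 q2. f \<in> forms r d \<Longrightarrow> degree q1 \<le> D1 \<Longrightarrow> degree q2 \<le> D2 \<Longrightarrow>
      \<forall>x. f (\<gamma>1 x) = poly q1 x \<Longrightarrow> \<forall>x. f (\<gamma>2 x) = poly q2 x \<Longrightarrow> \<mu> * coeff q1 D1 = \<mu> * coeff q2 D2"
    and neq: "S1 \<noteq> T1 \<or> S2 \<noteq> T2"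
  shows "infinite (rank_sets r d P) \<and> \<not> isolated_rank_set r d P A"
proof -
  note rank_P = t
  define k1 where "k1 = card S1"
  define k2 where "k2 = card S2"
  define k3 where "k3 = card R"
  have tk: "t = k1 + k2 + k3" using card by (simp add: k1_def k2_def k3_def)
  have cS: "card S1 = k1" "card T1 = k1" "card S2 = k2" "card T2 = k2" using S by (auto simp: k1_def k2_def)
  define g1 where "g1 = pencil_roots S1 T1"
  define g2 where "g2 = pencil_roots S2 T2"
  define U where "U = {u. card (g1 u) = k1 \<and> card (g2 u) = k2}"
  note pen1 = S(1) cS(1) S(2) cS(2)
  note pen2 = S(4) cS(3) S(5) cS(4)
  have fin_g: "finite (g1 u)" "finite (g2 u)" for u
    using finite_pencil_roots[OF pen1] finite_pencil_roots[OF pen2] by (simp_all add: g1_def g2_def)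
  have "finite (- U)"
  proof (rule finite_subset)
    show "- U \<subseteq> {u. card (pencil_roots S1 T1 u) \<noteq> k1} \<union> {u. card (pencil_roots S2 T2 u) \<noteq> k2}"
      by (auto simp: U_def g1_def g2_def)
    show "finite ({u. card (pencil_roots S1 T1 u) \<noteq> k1} \<union> {u. card (pencil_roots S2 T2 u) \<noteq> k2})"
      using finite_degenerate[OF pen1] finite_degenerate[OF pen2] by blast
  qed
  then have infU: "infinite U" using infinite_UNIV_char_0 finite_Un[of U "- U"] by (metis Compl_partition)
  have g0: "g1 0 = S1" "g2 0 = S2" using pencil_roots_0 S by (auto simp: g1_def g2_def)
  then have U0: "0 \<in> U" using cS by (simp add: U_def)
  have "\<forall>u\<in>U. \<exists>e. bij_betw e {..<k1} (g1 u)"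
    using fin_g by (auto simp: U_def intro!: finite_same_card_bij)
  then obtain e1 where e1: "\<And>u. u \<in> U \<Longrightarrow> bij_betw (e1 u) {..<k1} (g1 u)" by metis
  have "\<forall>u\<in>U. \<exists>e. bij_betw e {..<k2} (g2 u)"
    using fin_g by (auto simp: U_def intro!: finite_same_card_bij)
  then obtain e2 where e2: "\<And>u. u \<in> U \<Longrightarrow> bij_betw (e2 u) {..<k2} (g2 u)" by metis
  have "\<exists>e. bij_betw e {..<k3} R" using R by (auto simp: k3_def intro!: finite_same_card_bij)
  then obtain e3 where e3: "bij_betw e3 {..<k3} R" by blast
  \<comment> \<open>enumerate the moving points of the first curve, then of the second, then the fixed points\<close>
  define X where "X u i = (if i < k1 then \<gamma>1 (e1 u i) else if i < k1 + k2 then \<gamma>2 (e2 u (i - k1)) else e3 (i - (k1 + k2)))"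
    for u i
  define C where "C c1 c2 c3 u i = (if i < k1 then c1 (e1 u i) else if i < k1 + k2 then c2 (e2 u (i - k1)) else c3 (e3 (i - (k1 + k2))))"
    for c1 c2 :: "'a \<Rightarrow> 'a" and c3 :: "(nat \<Rightarrow> 'a) \<Rightarrow> 'a" and u i
  have sumX: "(\<Sum>i<t. C c1 c2 c3 u i * q (X u i))
     = (\<Sum>\<rho>\<in>g1 u. c1 \<rho> * q (\<gamma>1 \<rho>)) + (\<Sum>\<rho>\<in>g2 u. c2 \<rho> * q (\<gamma>2 \<rho>)) + (\<Sum>v\<in>R. c3 v * q v)"
    if u: "u \<in> U" for u c1 c2 c3 and q :: "(nat \<Rightarrow> 'a) \<Rightarrow> 'a"
  proof -
    have "(\<Sum>i<t. C c1 c2 c3 u i * q (X u i)) = (\<Sum>i<k1. c1 (e1 u i) * q (\<gamma>1 (e1 u i)))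
      + (\<Sum>i<k2. c2 (e2 u i) * q (\<gamma>2 (e2 u i))) + (\<Sum>i<k3. c3 (e3 i) * q (e3 i))"
      unfolding tk sum_lessThan_add by (simp add: C_def X_def)
    then show ?thesis
      using sum.reindex_bij_betw[OF e1[OF u], of "\<lambda>\<rho>. c1 \<rho> * q (\<gamma>1 \<rho>)"]
        sum.reindex_bij_betw[OF e2[OF u], of "\<lambda>\<rho>. c2 \<rho> * q (\<gamma>2 \<rho>)"]
        sum.reindex_bij_betw[OF e3, of "\<lambda>v. c3 v * q v"] by simp
  qed
  have imX: "(\<lambda>i. h (X u i)) ` {..<t} = (\<lambda>x. h (\<gamma>1 x)) ` g1 u \<union> (\<lambda>x. h (\<gamma>2 x)) ` g2 u \<union> h ` R"
    if u: "u \<in> U" for u and h :: "(nat \<Rightarrow> 'a) \<Rightarrow> (nat \<Rightarrow> 'a) set"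
  proof -
    have "{..<t} = {..<k1} \<union> (\<lambda>i. k1 + i) ` {..<k2} \<union> (\<lambda>i. k1 + k2 + i) ` {..<k3}"
    proof -
      have "i \<in> {..<k1} \<union> (\<lambda>i. k1 + i) ` {..<k2} \<union> (\<lambda>i. k1 + k2 + i) ` {..<k3}" if "i < t" for i
      proof -
        consider "i < k1" | "k1 \<le> i" "i < k1 + k2" | "k1 + k2 \<le> i" by linarith
        then show ?thesis
        proof cases
          case 2 then show ?thesis by (intro UnI1 UnI2 image_eqI[of _ _ "i - k1"]) auto
        next
          case 3 then show ?thesis using that by (intro UnI2 image_eqI[of _ _ "i - (k1 + k2)"]) (auto simp: tk)
        qed auto
      qed
      then show ?thesis by (auto simp: tk)
    qed
    then have "(\<lambda>i. h (X u i)) ` {..<t} = (\<lambda>i. h (X u i)) ` {..<k1} \<union> (\<lambda>i. h (X u (k1 + i))) ` {..<k2}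
      \<union> (\<lambda>i. h (X u (k1 + k2 + i))) ` {..<k3}"
      by (simp add: image_Un image_image)
    also have "(\<lambda>i. h (X u i)) ` {..<k1} = (\<lambda>x. h (\<gamma>1 x)) ` (e1 u ` {..<k1})"
      unfolding image_image by (intro image_cong) (auto simp: X_def)
    also have "(\<lambda>i. h (X u (k1 + i))) ` {..<k2} = (\<lambda>x. h (\<gamma>2 x)) ` (e2 u ` {..<k2})"
      unfolding image_image by (intro image_cong) (auto simp: X_def)
    also have "(\<lambda>i. h (X u (k1 + k2 + i))) ` {..<k3} = h ` (e3 ` {..<k3})"
      unfolding image_image by (intro image_cong) (auto simp: X_def)
    finally show ?thesis
      using e1[OF u] e2[OF u] e3 by (simp add: bij_betw_imp_surj_on)
  qed
  have Xvec: "X u i \<in> vecs r \<and> X u i \<noteq> 0" if "u \<in> U" "i < t" for u i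
  proof -
    have "e3 j \<in> vecs r \<and> e3 j \<noteq> 0" if "j < k3" for j
    proof -
      have "e3 j \<in> R" using e3 that by (auto simp: bij_betw_def)
      then show ?thesis using R(2,3) by (metis subsetD)
    qed
    then show ?thesis
      using that param_curveD(1,2)[OF \<gamma>(1)] param_curveD(1,2)[OF \<gamma>(2)] unfolding X_def tk by auto
  qed
  have repX: "\<exists>c. represents {..<t} (X u) c" if u: "u \<in> U" for u
  proof -
    have u1: "card (pencil_roots S1 T1 u) = k1" and u2: "card (pencil_roots S2 T2 u) = k2"
      using u by (auto simp: U_def g1_def g2_def)
    obtain c1 where c1: "\<And>q. degree q \<le> D1 \<Longrightarrow>
        (\<Sum>\<rho>\<in>g1 u. c1 \<rho> * poly q \<rho>) = (\<Sum>s\<in>S1. a1 s * poly q s) - u * \<mu> * coeff q D1"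
      using pencil_apolar[OF pen1 rel1 u1] unfolding g1_def by blast
    obtain c2 where c2: "\<And>q. degree q \<le> D2 \<Longrightarrow>
        (\<Sum>\<rho>\<in>g2 u. c2 \<rho> * poly q \<rho>) = (\<Sum>s\<in>S2. a2 s * poly q s) - u * (- \<mu>) * coeff q D2"
      using pencil_apolar[OF pen2 rel2 u2] unfolding g2_def by blast
    have "represents {..<t} (X u) (C c1 c2 a3 u)"
    proof (rule represents_transfer[OF A(2)])
      show "finite A" using A by (simp add: rank_sets_def)
      fix f :: "(nat \<Rightarrow> 'a) \<Rightarrow> 'a" assume f: "f \<in> forms r d"
      obtain q1 where q1: "degree q1 \<le> D1" "\<forall>x. f (\<gamma>1 x) = poly q1 x" using param_curveD(5)[OF \<gamma>(1) f] by blast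
      obtain q2 where q2: "degree q2 \<le> D2" "\<forall>x. f (\<gamma>2 x) = poly q2 x" using param_curveD(5)[OF \<gamma>(2) f] by blast
      have g: "\<mu> * coeff q1 D1 = \<mu> * coeff q2 D2" by (rule glue[OF f q1(1) q2(1) q1(2) q2(2)])
      have "(\<Sum>i<t. C c1 c2 a3 u i * f (X u i)) = (\<Sum>s\<in>S1. a1 s * poly q1 s) - u * \<mu> * coeff q1 D1
        + ((\<Sum>s\<in>S2. a2 s * poly q2 s) - u * (- \<mu>) * coeff q2 D2) + (\<Sum>v\<in>R. a3 v * f v)"
        unfolding sumX[OF u] using c1[OF q1(1)] c2[OF q2(1)] q1(2) q2(2) by simp
      also have "\<dots> = (\<Sum>s\<in>S1. a1 s * poly q1 s) + (\<Sum>s\<in>S2. a2 s * poly q2 s) + (\<Sum>v\<in>R. a3 v * f v)"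
        using g by (auto simp: mult.assoc)
      also have "\<dots> = (\<Sum>a\<in>A. \<alpha> a * f (rep a))"
        unfolding \<alpha>[OF f] using q1(2) q2(2) by simp
      finally show "(\<Sum>a\<in>A. \<alpha> a * f (rep a)) = (\<Sum>i\<in>{..<t}. C c1 c2 a3 u i * f (X u i))" by simp
    qed simp
    then show ?thesis by blast
  qed
  have ranks: "t \<le> card ((\<lambda>i. funvec.span {X u i}) ` {..<t})" "(\<lambda>i. funvec.span {X u i}) ` {..<t} \<in> rank_sets r d P"
    if u: "u \<in> U" for u
  proof -
    obtain c where c: "represents {..<t} (X u) c" using repX[OF u] by blast
    note rs = represents_rank_set[OF c finite_lessThan]
    show "t \<le> card ((\<lambda>i. funvec.span {X u i}) ` {..<t})" by (rule rs(1)) (use Xvec[OF u] in auto)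
    have "card ((\<lambda>i. funvec.span {X u i}) ` {..<t}) \<le> card {..<t}" by (rule card_image_le) simp
    then show "(\<lambda>i. funvec.span {X u i}) ` {..<t} \<in> rank_sets r d P"
      by (intro rs(2)) (use Xvec[OF u] in auto)
  qed
  define \<omega> where "\<omega> u = C (lagrange_weight (g1 u)) (lagrange_weight (g2 u)) (\<lambda>_. 1) u" for u
  interpret config_family r t U X \<omega>
  proof
    show "t > 0" by (rule t0)
    show "infinite U" by (rule infU)
    show "X u i \<in> vecs r" "X u i \<noteq> 0" if "u \<in> U" "i < t" for u i using Xvec[OF that] by auto
    show "X u j \<notin> funvec.span {X u i}" if "u \<in> U" "i < t" "j < t" "i \<noteq> j" for u i j
    proof
      assume "X u j \<in> funvec.span {X u i}"
      then have "funvec.span {X u j} = funvec.span {X u i}" using Xvec[OF that(1,3)] by (intro span_single_eq) auto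
      moreover have "inj_on (\<lambda>i. funvec.span {X u i}) {..<t}"
        using ranks(1)[OF that(1)] card_image_le[of "{..<t}" "\<lambda>i. funvec.span {X u i}"] by (intro eq_card_imp_inj_on) auto
      ultimately show False using that by (auto dest: inj_onD)
    qed
    show "\<omega> u i \<noteq> 0" if "u \<in> U" "i < t" for u i
      unfolding \<omega>_def C_def using lagrange_weight_nonzero[OF fin_g(1)] lagrange_weight_nonzero[OF fin_g(2)] by auto
    fix q :: "(nat \<Rightarrow> 'a) \<Rightarrow> 'a" assume q: "q \<in> vector_poly r"
    obtain q1 where q1: "\<forall>x. q (\<gamma>1 x) = poly q1 x" using param_curve_vector_poly[OF \<gamma>(1) q] by blast
    obtain q2 where q2: "\<forall>x. q (\<gamma>2 x) = poly q2 x" using param_curve_vector_poly[OF \<gamma>(2) q] by blast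
    obtain Q1 where Q1: "\<forall>u. card (g1 u) = k1 \<longrightarrow> (\<Sum>\<rho>\<in>g1 u. lagrange_weight (g1 u) \<rho> * poly q1 \<rho>) = poly Q1 u"
      using weighted_sum_polynomial[OF pen1] unfolding g1_def by blast
    obtain Q2 where Q2: "\<forall>u. card (g2 u) = k2 \<longrightarrow> (\<Sum>\<rho>\<in>g2 u. lagrange_weight (g2 u) \<rho> * poly q2 \<rho>) = poly Q2 u"
      using weighted_sum_polynomial[OF pen2] unfolding g2_def by blast
    have "(\<Sum>i<t. \<omega> u i * q (X u i)) = poly (Q1 + Q2 + [:\<Sum>v\<in>R. q v:]) u" if u: "u \<in> U" for u
      unfolding \<omega>_def sumX[OF u] using Q1 Q2 q1 q2 u by (simp add: U_def)
    then show "\<exists>Q. \<forall>u\<in>U. (\<Sum>i<t. \<omega> u i * q (X u i)) = poly Q u" by blast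
  qed
  have cf: "config u = (\<lambda>x. funvec.span {\<gamma>1 x}) ` g1 u \<union> (\<lambda>x. funvec.span {\<gamma>2 x}) ` g2 u \<union> (\<lambda>v. funvec.span {v}) ` R"
    if "u \<in> U" for u unfolding config_def by (rule imX[OF that])
  have sub: "config ` U \<subseteq> rank_sets r d P" using ranks(2) by (auto simp: config_def)
  have A0: "config 0 = A" using cf[OF U0] g0 A_eq by simp
  have infC: "infinite (config ` U)"
  proof
    assume fin: "finite (config ` U)"
    \<comment> \<open>finitely many configurations would leave finitely many parameters for the roots, but distinct members have distinct root sets\<close>
    have curve: False if \<gamma>c: "param_curve r d \<gamma> D" and STc: "finite S" "card S = k" "finite T" "card T = k" "S \<noteq> T"
      and sub: "\<And>u. u \<in> U \<Longrightarrow> card (pencil_roots S T u) = k \<and> (\<lambda>x. funvec.span {\<gamma> x}) ` pencil_roots S T u \<subseteq> config u"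
      for \<gamma> D S T k
    proof -
      define Y where "Y = \<Union>(config ` U)"
      have "finite Y" unfolding Y_def using fin by (auto simp: config_def)
      moreover have "inj (\<lambda>x. funvec.span {\<gamma> x})"
      proof (rule injI, rule ccontr)
        fix x y assume "funvec.span {\<gamma> x} = funvec.span {\<gamma> y}" "x \<noteq> y"
        then show False using param_curveD(3)[OF \<gamma>c, of x y] span_single_eq_imp[of "\<gamma> x" "\<gamma> y"] by simp
      qed
      ultimately have "finite ((\<lambda>x. funvec.span {\<gamma> x}) -` Y)" by (intro finite_vimageI)
      then have fP: "finite (Pow ((\<lambda>x. funvec.span {\<gamma> x}) -` Y))" by simp
      have "pencil_roots S T ` U \<subseteq> Pow ((\<lambda>x. funvec.span {\<gamma> x}) -` Y)"
        using sub by (fastforce simp: Y_def)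
      then have "finite (pencil_roots S T ` U)" using fP finite_subset by blast
      moreover have "inj_on (pencil_roots S T) U"
        by (rule inj_onI) (use pencil_roots_inj[OF STc(1-4) STc(5)] sub in blast)
      ultimately show False using infU finite_imageD by blast
    qed
    show False
    proof (cases "S1 = T1")
      case False
      show False
        by (rule curve[OF \<gamma>(1) pen1 False]) (use cf in \<open>auto simp: U_def g1_def\<close>)
    next
      case True
      then have "S2 \<noteq> T2" using neq by blast
      show False
        by (rule curve[OF \<gamma>(2) pen2 \<open>S2 \<noteq> T2\<close>]) (use cf in \<open>auto simp: U_def g2_def\<close>)
    qed
  qed
  have "infinite (rank_sets r d P)" using infC sub finite_subset by blast
  moreover have "\<not> isolated_rank_set r d P A"
  proof (rule not_isolated_if_in_irreducible[OF sub _ _ infC])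
    show "irreducible_in (hilb_topology r (symmetric_rank r d P)) (config ` U)" using irreducible_config by (simp only: rank_P)
    show "A \<in> config ` U" using A0 U0 by (metis image_eqI)
  qed
  ultimately show ?thesis by blast
qed

text \<open>
  One representative of every point of the projective space, so that equality of points becomes
  equality of vectors.
\<close>

definition reps :: "(nat \<Rightarrow> 'a) set" where
  "reps = rep ` proj_space {..r}"

lemma reps: "v \<in> reps \<Longrightarrow> v \<in> vecs r" "v \<in> reps \<Longrightarrow> v \<noteq> 0"
  "v \<in> reps \<Longrightarrow> w \<in> reps \<Longrightarrow> w \<in> funvec.span {v} \<Longrightarrow> v = w"
proof -
  show "v \<in> reps \<Longrightarrow> v \<in> vecs r" "v \<in> reps \<Longrightarrow> v \<noteq> 0" by (auto simp: reps_def rep)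
  assume "v \<in> reps" "w \<in> reps" "w \<in> funvec.span {v}"
  moreover from this obtain a b where "a \<in> proj_space {..r}" "v = rep a" "b \<in> proj_space {..r}" "w = rep b"
    by (auto simp: reps_def)
  ultimately show "v = w" using span_single_eq[of w v] rep[of a r] rep[of b r] by metis
qed

lemma proj_points_reps:
  assumes "finite W" "W \<subseteq> reps"
  shows "proj_points r W"
  unfolding proj_points_def
proof (intro conjI ballI impI)
  show "W \<subseteq> vecs r" using assms reps(1) by blast
  fix v assume v: "v \<in> W"
  show "v \<noteq> 0" using v assms reps(2) by blast
  fix w assume "w \<in> W" "v \<noteq> w"
  then show "w \<notin> funvec.span {v}" using v assms reps(3)[of v w] by blast
qed (rule assms)

text \<open>
  Passing from representatives to points \<open>\<gamma> s\<close> of the parametrised curve rescales the coefficients by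
  \<open>d\<close>-th powers.
\<close>

lemma curve_coordinates:
  assumes \<gamma>: "param_curve r d \<gamma> D" and F: "finite F" "F \<subseteq> reps" "on_curve \<gamma> F"
  obtains \<xi> where "inj_on \<xi> F" "\<And>v. v \<in> F \<Longrightarrow> funvec.span {\<gamma> (\<xi> v)} = funvec.span {v}"
    "\<And>Z \<alpha>. Z \<subseteq> F \<Longrightarrow> \<exists>a. \<forall>f\<in>forms r d. (\<Sum>s\<in>\<xi> ` Z. a s * f (\<gamma> s)) = (\<Sum>v\<in>Z. \<alpha> v * f v)"
proof -
  have "\<forall>v\<in>F. \<exists>c x. c \<noteq> 0 \<and> v = fscale c (\<gamma> x)" using F(3) unfolding on_curve_def .
  then obtain c \<xi> where c: "\<And>v. v \<in> F \<Longrightarrow> c v \<noteq> 0 \<and> v = fscale (c v) (\<gamma> (\<xi> v))" by metis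
  have sp: "funvec.span {\<gamma> (\<xi> v)} = funvec.span {v}" if v: "v \<in> F" for v
  proof -
    have "v \<in> funvec.span {\<gamma> (\<xi> v)}" unfolding span_single using c[OF v] by blast
    then have "funvec.span {v} = funvec.span {\<gamma> (\<xi> v)}" using reps(2) F(2) v by (intro span_single_eq) auto
    then show ?thesis by simp
  qed
  have inj: "inj_on \<xi> F"
  proof (rule inj_onI)
    fix v w assume vw: "v \<in> F" "w \<in> F" "\<xi> v = \<xi> w"
    then have "funvec.span {v} = funvec.span {w}" using sp by metis
    then have "w \<in> funvec.span {v}" by (rule span_single_eq_imp)
    then show "v = w" using reps(3) vw F(2) by blast
  qed
  show thesis
  proof (rule that[OF inj sp])
    fix Z and \<alpha> :: "(nat \<Rightarrow> 'a) \<Rightarrow> 'a" assume Z: "Z \<subseteq> F"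
    define a where "a s = \<alpha> (inv_into F \<xi> s) * c (inv_into F \<xi> s) ^ d" for s
    have "(\<Sum>s\<in>\<xi> ` Z. a s * f (\<gamma> s)) = (\<Sum>v\<in>Z. \<alpha> v * f v)" if f: "f \<in> forms r d" for f
    proof -
      have "(\<Sum>s\<in>\<xi> ` Z. a s * f (\<gamma> s)) = (\<Sum>v\<in>Z. a (\<xi> v) * f (\<gamma> (\<xi> v)))"
        using inj_on_subset[OF inj Z] by (simp add: sum.reindex)
      also have "\<dots> = (\<Sum>v\<in>Z. \<alpha> v * f v)"
      proof (intro sum.cong refl)
        fix v assume "v \<in> Z"
        then have v: "v \<in> F" using Z by blast
        have "f v = c v ^ d * f (\<gamma> (\<xi> v))" using c[OF v] forms_homogeneous[OF f] by metis
        then show "a (\<xi> v) * f (\<gamma> (\<xi> v)) = \<alpha> v * f v" by (simp add: a_def inv_into_f_f[OF inj v])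
      qed
      finally show ?thesis .
    qed
    then show "\<exists>a. \<forall>f\<in>forms r d. (\<Sum>s\<in>\<xi> ` Z. a s * f (\<gamma> s)) = (\<Sum>v\<in>Z. \<alpha> v * f v)" by blast
  qed
qed

lemma represents_reps:
  assumes "A \<in> rank_sets r d P"
  shows "\<exists>\<alpha>. represents (rep ` A) (\<lambda>v. v) \<alpha>" "finite (rep ` A)" "card (rep ` A) = t" "rep ` A \<subseteq> reps"
    "(\<lambda>v. funvec.span {v}) ` rep ` A = A" "inj_on rep A"
proof -
  have A: "A \<subseteq> proj_space {..r}" "finite A" "card A = t" using assms t by (auto simp: rank_sets_def)
  show inj: "inj_on rep A"
  proof (rule inj_onI)
    fix a b assume "a \<in> A" "b \<in> A" "rep a = rep b"
    then show "a = b" using A(1) rep(2)[of a r] rep(2)[of b r] by auto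
  qed
  show "finite (rep ` A)" "card (rep ` A) = t" "rep ` A \<subseteq> reps"
    using A card_image[OF inj] by (auto simp: reps_def)
  show "(\<lambda>v. funvec.span {v}) ` rep ` A = A"
  proof -
    have "(\<lambda>a. funvec.span {rep a}) ` A = (\<lambda>a. a) ` A"
      using A(1) by (intro image_cong refl rep(2)[of _ r]) blast
    then show ?thesis by (simp add: image_image)
  qed
  obtain \<alpha> where \<alpha>: "represents A rep \<alpha>" using rank_set_represents[OF assms] by blast
  have "represents (rep ` A) (\<lambda>v. v) (\<lambda>v. \<alpha> (inv_into A rep v))"
    unfolding represents_def sum.reindex[OF inj] o_def
    using \<alpha>[unfolded represents_def] by (simp only: inv_into_f_f[OF inj] cong: sum.cong)
  then show "\<exists>\<alpha>. represents (rep ` A) (\<lambda>v. v) \<alpha>" by blast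
qed

text \<open>
  Exchanging \<open>Z\<close> for \<open>Z'\<close> in \<open>A\<close> gives another formula for \<open>p\<close>, so minimality of the rank applies.
\<close>

lemma replacement_card_le:
  assumes A: "A \<in> rank_sets r d P" "represents (rep ` A) (\<lambda>v. v) \<alpha>"
    and Z: "Z \<subseteq> rep ` A" "finite Z'" "Z' \<subseteq> reps"
    and eq: "\<And>f. f \<in> forms r d \<Longrightarrow> (\<Sum>v\<in>Z. \<alpha> v * f v) = (\<Sum>v\<in>Z'. \<beta> v * f v)"
  shows "card Z \<le> card Z'"
proof -
  note A' = represents_reps[OF A(1)]
  have finZ: "finite Z" using Z(1) A'(2) finite_subset by blast
  define V where "V = (rep ` A - Z) \<union> Z'"
  have finV: "finite V" using A' Z by (simp add: V_def)
  define c where "c v = (if v \<in> rep ` A - Z then \<alpha> v else 0) + (if v \<in> Z' then \<beta> v else 0)" for v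
  have "represents V (\<lambda>v. v) c"
  proof (rule represents_transfer[OF A(2) A'(2) finV])
    fix f :: "(nat \<Rightarrow> 'a) \<Rightarrow> 'a" assume f: "f \<in> forms r d"
    have "(\<Sum>v\<in>V. c v * f v) = (\<Sum>v\<in>V. if v \<in> rep ` A - Z then \<alpha> v * f v else 0) + (\<Sum>v\<in>V. if v \<in> Z' then \<beta> v * f v else 0)"
      unfolding sum.distrib[symmetric] by (intro sum.cong) (auto simp: c_def distrib_right)
    also have "(\<Sum>v\<in>V. if v \<in> rep ` A - Z then \<alpha> v * f v else 0) = (\<Sum>v\<in>V \<inter> (rep ` A - Z). \<alpha> v * f v)"
      by (rule sum.inter_restrict[OF finV, symmetric])
    also have "V \<inter> (rep ` A - Z) = rep ` A - Z" by (auto simp: V_def)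
    also have "(\<Sum>v\<in>V. if v \<in> Z' then \<beta> v * f v else 0) = (\<Sum>v\<in>V \<inter> Z'. \<beta> v * f v)"
      by (rule sum.inter_restrict[OF finV, symmetric])
    also have "V \<inter> Z' = Z'" by (auto simp: V_def)
    also have "(\<Sum>v\<in>Z'. \<beta> v * f v) = (\<Sum>v\<in>Z. \<alpha> v * f v)" using eq[OF f] by simp
    also have "(\<Sum>v\<in>rep ` A - Z. \<alpha> v * f v) + (\<Sum>v\<in>Z. \<alpha> v * f v) = (\<Sum>v\<in>rep ` A. \<alpha> v * f v)"
      by (rule sum.subset_diff[OF Z(1) A'(2), symmetric])
    finally show "(\<Sum>v\<in>rep ` A. \<alpha> v * f v) = (\<Sum>v\<in>V. c v * f v)" by simp
  qed
  from represents_rank_set(1)[OF this finV] have "t \<le> card ((\<lambda>v. funvec.span {v}) ` V)"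
    using A'(4) Z(3) reps unfolding V_def by blast
  also have "\<dots> \<le> card V" by (rule card_image_le[OF finV])
  also have "\<dots> \<le> card (rep ` A - Z) + card Z'" unfolding V_def by (rule card_Un_le)
  also have "card (rep ` A - Z) = t - card Z" using Z finZ A' by (simp add: card_Diff_subset)
  finally have "t \<le> t - card Z + card Z'" .
  moreover have "card Z \<le> t" using card_mono[OF A'(2) Z(1)] A'(3) by simp
  ultimately show ?thesis by linarith
qed

text \<open>
  The content of \<open>double_pencil_family\<close> in terms of representatives of points instead of curve parameters.
\<close>

lemma pencil_move:
  fixes \<mu> :: 'a
  assumes A: "A \<in> rank_sets r d P" "represents (rep ` A) (\<lambda>v. v) \<alpha>"
    and \<gamma>: "param_curve r d \<gamma>1 D1" "param_curve r d \<gamma>2 D2"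
    and Z: "Z1 \<subseteq> rep ` A" "Z2 \<subseteq> rep ` A" "Z1 \<inter> Z2 = {}" "finite Y1" "Y1 \<subseteq> reps" "finite Y2" "Y2 \<subseteq> reps"
      "card Y1 = card Z1" "card Y2 = card Z2"
    and on: "on_curve \<gamma>1 (Z1 \<union> Y1)" "on_curve \<gamma>2 (Z2 \<union> Y2)"
    and rel1: "\<And>f q. f \<in> forms r d \<Longrightarrow> degree q \<le> D1 \<Longrightarrow> \<forall>x. f (\<gamma>1 x) = poly q x \<Longrightarrow>
      (\<Sum>v\<in>Z1. \<alpha> v * f v) = (\<Sum>v\<in>Y1. \<beta>1 v * f v) + \<mu> * coeff q D1"
    and rel2: "\<And>f q. f \<in> forms r d \<Longrightarrow> degree q \<le> D2 \<Longrightarrow> \<forall>x. f (\<gamma>2 x) = poly q x \<Longrightarrow>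
      (\<Sum>v\<in>Z2. \<alpha> v * f v) = (\<Sum>v\<in>Y2. \<beta>2 v * f v) + (- \<mu>) * coeff q D2"
    and glue: "\<And>f q1 q2. f \<in> forms r d \<Longrightarrow> degree q1 \<le> D1 \<Longrightarrow> degree q2 \<le> D2 \<Longrightarrow>
      \<forall>x. f (\<gamma>1 x) = poly q1 x \<Longrightarrow> \<forall>x. f (\<gamma>2 x) = poly q2 x \<Longrightarrow> \<mu> * coeff q1 D1 = \<mu> * coeff q2 D2"
    and neq: "Z1 \<noteq> Y1 \<or> Z2 \<noteq> Y2"
  shows "infinite (rank_sets r d P) \<and> \<not> isolated_rank_set r d P A"
proof -
  note A' = represents_reps[OF A(1)]
  have finZ: "finite Z1" "finite Z2" using Z(1,2) A'(2) finite_subset by blast+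
  have F: "finite (Z1 \<union> Y1)" "Z1 \<union> Y1 \<subseteq> reps" "finite (Z2 \<union> Y2)" "Z2 \<union> Y2 \<subseteq> reps"
    using finZ Z A'(4) by auto
  obtain \<xi>1 where \<xi>1: "inj_on \<xi>1 (Z1 \<union> Y1)" "\<And>v. v \<in> Z1 \<union> Y1 \<Longrightarrow> funvec.span {\<gamma>1 (\<xi>1 v)} = funvec.span {v}"
    "\<And>Z \<alpha>. Z \<subseteq> Z1 \<union> Y1 \<Longrightarrow> \<exists>a. \<forall>f\<in>forms r d. (\<Sum>s\<in>\<xi>1 ` Z. a s * f (\<gamma>1 s)) = (\<Sum>v\<in>Z. \<alpha> v * f v)"
    by (rule curve_coordinates[OF \<gamma>(1) F(1,2) on(1)]) (rule that)
  obtain \<xi>2 where \<xi>2: "inj_on \<xi>2 (Z2 \<union> Y2)" "\<And>v. v \<in> Z2 \<union> Y2 \<Longrightarrow> funvec.span {\<gamma>2 (\<xi>2 v)} = funvec.span {v}"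
    "\<And>Z \<alpha>. Z \<subseteq> Z2 \<union> Y2 \<Longrightarrow> \<exists>a. \<forall>f\<in>forms r d. (\<Sum>s\<in>\<xi>2 ` Z. a s * f (\<gamma>2 s)) = (\<Sum>v\<in>Z. \<alpha> v * f v)"
    by (rule curve_coordinates[OF \<gamma>(2) F(3,4) on(2)]) (rule that)
  obtain a1 where a1: "\<forall>f\<in>forms r d. (\<Sum>s\<in>\<xi>1 ` Z1. a1 s * f (\<gamma>1 s)) = (\<Sum>v\<in>Z1. \<alpha> v * f v)" using \<xi>1(3)[of Z1 \<alpha>] by blast
  obtain b1 where b1: "\<forall>f\<in>forms r d. (\<Sum>s\<in>\<xi>1 ` Y1. b1 s * f (\<gamma>1 s)) = (\<Sum>v\<in>Y1. \<beta>1 v * f v)" using \<xi>1(3)[of Y1 \<beta>1] by blast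
  obtain a2 where a2: "\<forall>f\<in>forms r d. (\<Sum>s\<in>\<xi>2 ` Z2. a2 s * f (\<gamma>2 s)) = (\<Sum>v\<in>Z2. \<alpha> v * f v)" using \<xi>2(3)[of Z2 \<alpha>] by blast
  obtain b2 where b2: "\<forall>f\<in>forms r d. (\<Sum>s\<in>\<xi>2 ` Y2. b2 s * f (\<gamma>2 s)) = (\<Sum>v\<in>Y2. \<beta>2 v * f v)" using \<xi>2(3)[of Y2 \<beta>2] by blast
  define R where "R = rep ` A - (Z1 \<union> Z2)"
  have split: "rep ` A = Z1 \<union> Z2 \<union> R" using Z by (auto simp: R_def)
  have finR: "finite R" using A'(2) by (simp add: R_def)
  have disj: "(Z1 \<union> Z2) \<inter> R = {}" by (auto simp: R_def)
  have finA: "finite A" using A(1) by (simp add: rank_sets_def)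
  obtain \<alpha>' where \<alpha>': "represents A rep \<alpha>'" using rank_set_represents[OF A(1)] by blast
  have c: "card (\<xi>1 ` Z1) = card Z1" "card (\<xi>1 ` Y1) = card Y1" "card (\<xi>2 ` Z2) = card Z2" "card (\<xi>2 ` Y2) = card Y2"
    using \<xi>1(1) \<xi>2(1) by (auto intro!: card_image elim: inj_on_subset)
  show ?thesis
  proof (rule double_pencil_family[OF A(1) \<alpha>' \<gamma>, where ?S1.0 = "\<xi>1 ` Z1" and ?T1.0 = "\<xi>1 ` Y1" and ?S2.0 = "\<xi>2 ` Z2"
        and ?T2.0 = "\<xi>2 ` Y2" and R = R and ?a1.0 = a1 and ?a2.0 = a2 and ?b1.0 = b1 and ?b2.0 = b2 and ?a3.0 = \<alpha> and \<mu> = \<mu>])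
    show "card (\<xi>1 ` Y1) = card (\<xi>1 ` Z1)" "card (\<xi>2 ` Y2) = card (\<xi>2 ` Z2)" using c Z by auto
    show "R \<subseteq> vecs r" "0 \<notin> R" using A'(4) reps(1,2) by (auto simp: R_def)
    show "A = (\<lambda>x. funvec.span {\<gamma>1 x}) ` \<xi>1 ` Z1 \<union> (\<lambda>x. funvec.span {\<gamma>2 x}) ` \<xi>2 ` Z2 \<union> (\<lambda>v. funvec.span {v}) ` R"
    proof -
      have "(\<lambda>x. funvec.span {\<gamma>1 x}) ` \<xi>1 ` Z1 = (\<lambda>v. funvec.span {v}) ` Z1"
        unfolding image_image by (intro image_cong refl \<xi>1(2)) auto
      moreover have "(\<lambda>x. funvec.span {\<gamma>2 x}) ` \<xi>2 ` Z2 = (\<lambda>v. funvec.span {v}) ` Z2"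
        unfolding image_image by (intro image_cong refl \<xi>2(2)) auto
      ultimately have "(\<lambda>x. funvec.span {\<gamma>1 x}) ` \<xi>1 ` Z1 \<union> (\<lambda>x. funvec.span {\<gamma>2 x}) ` \<xi>2 ` Z2 \<union> (\<lambda>v. funvec.span {v}) ` R
        = (\<lambda>v. funvec.span {v}) ` (Z1 \<union> Z2 \<union> R)" by (simp only: image_Un)
      then show ?thesis using A'(5) split by simp
    qed
    have "card (rep ` A) = card (Z1 \<union> Z2) + card R"
      unfolding split using finZ finR disj by (intro card_Un_disjoint) auto
    then show "card (\<xi>1 ` Z1) + card (\<xi>2 ` Z2) + card R = t"
      using c A'(3) card_Un_disjoint[OF finZ Z(3)] by simp
    show "(\<Sum>a\<in>A. \<alpha>' a * f (rep a)) = (\<Sum>s\<in>\<xi>1 ` Z1. a1 s * f (\<gamma>1 s)) + (\<Sum>s\<in>\<xi>2 ` Z2. a2 s * f (\<gamma>2 s)) + (\<Sum>v\<in>R. \<alpha> v * f v)"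
      if f: "f \<in> forms r d" for f
    proof -
      have "(\<Sum>a\<in>A. \<alpha>' a * f (rep a)) = (\<Sum>v\<in>rep ` A. \<alpha> v * f v)"
        by (rule represents_eq[OF \<alpha>' A(2) finA A'(2) f])
      also have "\<dots> = (\<Sum>v\<in>Z1. \<alpha> v * f v) + (\<Sum>v\<in>Z2. \<alpha> v * f v) + (\<Sum>v\<in>R. \<alpha> v * f v)"
        unfolding split using finZ finR disj Z(3) by (simp add: sum.union_disjoint)
      finally show ?thesis using a1 a2 f by simp
    qed
    show "(\<Sum>s\<in>\<xi>1 ` Z1. a1 s * poly q s) = (\<Sum>s\<in>\<xi>1 ` Y1. b1 s * poly q s) + \<mu> * coeff q D1" if q: "degree q \<le> D1" for q
    proof -
      obtain f where f: "f \<in> forms r d" "\<forall>x. f (\<gamma>1 x) = poly q x" using param_curveD(6)[OF \<gamma>(1) q] by blast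
      show ?thesis using rel1[OF f(1) q f(2)] a1 b1 f by (simp add: f(2)[rule_format, symmetric])
    qed
    show "(\<Sum>s\<in>\<xi>2 ` Z2. a2 s * poly q s) = (\<Sum>s\<in>\<xi>2 ` Y2. b2 s * poly q s) + (- \<mu>) * coeff q D2" if q: "degree q \<le> D2" for q
    proof -
      obtain f where f: "f \<in> forms r d" "\<forall>x. f (\<gamma>2 x) = poly q x" using param_curveD(6)[OF \<gamma>(2) q] by blast
      show ?thesis using rel2[OF f(1) q f(2)] a2 b2 f by (simp add: f(2)[rule_format, symmetric])
    qed
    show "\<xi>1 ` Z1 \<noteq> \<xi>1 ` Y1 \<or> \<xi>2 ` Z2 \<noteq> \<xi>2 ` Y2"
      using neq inj_on_image_eq_iff[OF \<xi>1(1)] inj_on_image_eq_iff[OF \<xi>2(1)] by auto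
  qed (use finZ Z finR glue in auto)
qed

text \<open>
  The special case of \<open>pencil_move\<close> in which no points are moved on the second curve.
\<close>

lemma single_pencil_move:
  assumes A: "A \<in> rank_sets r d P" "represents (rep ` A) (\<lambda>v. v) \<alpha>"
    and \<gamma>: "param_curve r d \<gamma> D"
    and Z: "Z \<subseteq> rep ` A" "finite Y" "Y \<subseteq> reps" "card Y = card Z" "on_curve \<gamma> (Z \<union> Y)"
    and rel: "\<And>f. f \<in> forms r d \<Longrightarrow> (\<Sum>v\<in>Z. \<alpha> v * f v) = (\<Sum>v\<in>Y. \<beta> v * f v)"
    and neq: "Z \<noteq> Y"
  shows "infinite (rank_sets r d P) \<and> \<not> isolated_rank_set r d P A"
  by (rule pencil_move[OF A \<gamma> \<gamma>, where ?Z2.0 = "{}" and ?Y2.0 = "{}" and ?Z1.0 = Z and ?Y1.0 = Y and \<mu> = "0"])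
    (use Z rel neq in \<open>auto simp: on_curve_def\<close>)

end

section \<open>Two rank sets of the same point\<close>

text \<open>
  On the first line every form is, up to its value at the node \<open>o'\<close>, the restriction of a form vanishing on
  the second line.
\<close>

lemma node_split:
  assumes k1: "lin r k1 p1 = 1" "lin r k1 p2 = 0" "lin r k1 o' = 0"
    and k: "lin r k p1 = 0" "lin r k p2 = 0" "lin r k o' = 1" and f: "f \<in> forms r d"
  shows "\<exists>g\<in>forms r d. (\<forall>x\<in>funvec.span {p2, o'}. g x = 0) \<and>
     (\<forall>x\<in>funvec.span {p1, o'}. f x = g x + f o' * lin r k x ^ d)"
  using f
proof (induction rule: forms_induct)
  case (const c)
  show ?case by (rule bexI[OF _ forms_zero]) simp
next
  case (lin_mult f d l)
  then obtain g where g: "g \<in> forms r d" "\<forall>x\<in>funvec.span {p2, o'}. g x = 0"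
    "\<forall>x\<in>funvec.span {p1, o'}. f x = g x + f o' * lin r k x ^ d" by blast
  let ?h = "\<lambda>x. lin r l p1 * (lin r k1 x * f x) + lin r l o' * (lin r k x * g x)"
  show ?case
  proof (intro bexI[of _ ?h] conjI ballI)
    show "?h \<in> forms r (Suc d)" by (intro forms_add forms_scale forms_lin_mult lin_mult g)
    fix x assume "x \<in> funvec.span {p2, o'}"
    then show "?h x = 0" using g(2) k1 by (auto simp: span_pair)
  next
    fix x assume x: "x \<in> funvec.span {p1, o'}"
    then obtain a b where ab: "x = fscale a p1 + fscale b o'" unfolding span_pair by blast
    have l: "lin r l x = lin r l p1 * lin r k1 x + lin r l o' * lin r k x"
      unfolding ab by (simp add: k1 k mult.commute)
    have "lin r l x * f x = lin r l p1 * (lin r k1 x * f x) + lin r l o' * (lin r k x * f x)"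
      unfolding l by (simp add: algebra_simps)
    also have "lin r k x * f x = lin r k x * g x + f o' * lin r k x ^ Suc d"
      using g(3) x by (simp add: algebra_simps)
    finally show "lin r l x * f x = ?h x + lin r l o' * f o' * lin r k x ^ Suc d"
      by (simp add: algebra_simps)
  qed
next
  case (add f d g)
  then obtain f' g' where f': "f' \<in> forms r d" "\<forall>x\<in>funvec.span {p2, o'}. f' x = 0"
    "\<forall>x\<in>funvec.span {p1, o'}. f x = f' x + f o' * lin r k x ^ d"
    and g': "g' \<in> forms r d" "\<forall>x\<in>funvec.span {p2, o'}. g' x = 0"
    "\<forall>x\<in>funvec.span {p1, o'}. g x = g' x + g o' * lin r k x ^ d" by blast
  show ?case
  proof (intro bexI[of _ "\<lambda>x. f' x + g' x"] conjI ballI)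
    show "(\<lambda>x. f' x + g' x) \<in> forms r d" by (intro forms_add f' g')
  qed (use f' g' in \<open>simp_all add: algebra_simps\<close>)
qed

text \<open>
  If the line is disjoint from \<open>S\<close>, each linear form can be changed off the line so as to vanish on \<open>S\<close>.
\<close>

lemma skew_extension:
  assumes k: "lin r k p = 1" "lin r k q = 0" "\<forall>x\<in>S. lin r k x = 0"
    and l: "lin r l p = 0" "lin r l q = 1" "\<forall>x\<in>S. lin r l x = 0" and f: "f \<in> forms r d" and d: "d \<ge> 1"
  shows "\<exists>g\<in>forms r d. (\<forall>x\<in>S. g x = 0) \<and> (\<forall>x\<in>funvec.span {p, q}. f x = g x)"
  using f d
proof (induction rule: forms_induct)
  case (const c) then show ?case by simp
next
  case (lin_mult f d m)
  let ?h = "\<lambda>x. lin r m p * (lin r k x * f x) + lin r m q * (lin r l x * f x)"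
  show ?case
  proof (intro bexI[of _ ?h] conjI ballI)
    show "?h \<in> forms r (Suc d)" by (intro forms_add forms_scale forms_lin_mult lin_mult)
    fix x assume "x \<in> S"
    then show "?h x = 0" using k l by simp
  next
    fix x assume "x \<in> funvec.span {p, q}"
    then obtain a b where ab: "x = fscale a p + fscale b q" unfolding span_pair by blast
    have m: "lin r m x = lin r m p * lin r k x + lin r m q * lin r l x"
      unfolding ab by (simp add: k l mult.commute)
    show "lin r m x * f x = ?h x" unfolding m by (simp add: algebra_simps)
  qed
next
  case (add f d g)
  then obtain f' g' where f': "f' \<in> forms r d" "\<forall>x\<in>S. f' x = 0" "\<forall>x\<in>funvec.span {p, q}. f x = f' x"
    and g': "g' \<in> forms r d" "\<forall>x\<in>S. g' x = 0" "\<forall>x\<in>funvec.span {p, q}. g x = g' x" by blast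
  show ?case
  proof (intro bexI[of _ "\<lambda>x. f' x + g' x"] conjI ballI)
    show "(\<lambda>x. f' x + g' x) \<in> forms r d" by (intro forms_add f' g')
  qed (use f' g' in simp_all)
qed

text \<open>
  Two rank sets of which the first violates the claim. The goal is a contradiction, so every pencil through
  \<open>A\<close> must be constant.
\<close>

locale rigid_pair = rank_context r d t p
  for r d t :: nat and p :: "(nat \<Rightarrow>\<^sub>0 nat) \<Rightarrow> 'a::{alg_closed_field, field_char_0}" +
  fixes A B :: "(nat \<Rightarrow> 'a) set set" and \<alpha> \<beta> :: "(nat \<Rightarrow> 'a) \<Rightarrow> 'a"
  assumes A: "A \<in> rank_sets r d P" "represents (rep ` A) (\<lambda>v. v) \<alpha>"
    and B: "B \<in> rank_sets r d P" "represents (rep ` B) (\<lambda>v. v) \<beta>"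
    and neq: "A \<noteq> B" and small: "2 * t < 3 * d"
    and rigid: "\<not> (infinite (rank_sets r d P) \<and> \<not> isolated_rank_set r d P A)"
begin

definition "A' = rep ` A"
definition "B' = rep ` B"

lemma A': "finite A'" "card A' = t" "A' \<subseteq> reps" and B': "finite B'" "card B' = t" "B' \<subseteq> reps"
  unfolding A'_def B'_def by (rule represents_reps[OF A(1)] represents_reps[OF B(1)])+

lemma A'_neq_B': "A' \<noteq> B'"
proof
  assume "A' = B'"
  then have "(\<lambda>v. funvec.span {v}) ` rep ` A = (\<lambda>v. funvec.span {v}) ` rep ` B" by (simp add: A'_def B'_def)
  then show False using represents_reps(5)[OF A(1)] represents_reps(5)[OF B(1)] neq by simp
qed

lemma le_A: "Z \<subseteq> A' \<Longrightarrow> finite Y \<Longrightarrow> Y \<subseteq> reps \<Longrightarrow>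
    (\<And>f. f \<in> forms r d \<Longrightarrow> (\<Sum>v\<in>Z. \<alpha> v * f v) = (\<Sum>v\<in>Y. b v * f v)) \<Longrightarrow> card Z \<le> card Y"
  unfolding A'_def by (rule replacement_card_le[OF A])

lemma le_B: "Z \<subseteq> B' \<Longrightarrow> finite Y \<Longrightarrow> Y \<subseteq> reps \<Longrightarrow>
    (\<And>f. f \<in> forms r d \<Longrightarrow> (\<Sum>v\<in>Z. \<beta> v * f v) = (\<Sum>v\<in>Y. b v * f v)) \<Longrightarrow> card Z \<le> card Y"
  unfolding B'_def by (rule replacement_card_le[OF B])

lemma rigid_on_curve:
  assumes "param_curve r d \<gamma> D" "on_curve \<gamma> (Z \<union> Y)" "Z \<subseteq> A'" "finite Y" "Y \<subseteq> reps" "card Y = card Z"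
    "\<And>f. f \<in> forms r d \<Longrightarrow> (\<Sum>v\<in>Z. \<alpha> v * f v) = (\<Sum>v\<in>Y. b v * f v)"
  shows "Z = Y"
proof (rule ccontr)
  assume "Z \<noteq> Y"
  have "infinite (rank_sets r d P) \<and> \<not> isolated_rank_set r d P A"
    by (rule single_pencil_move[OF A assms(1) assms(3)[unfolded A'_def] assms(4-6,2,7) \<open>Z \<noteq> Y\<close>])
  then show False using rigid by blast
qed

lemma zero_notin_reps: "0 \<notin> reps"
  using reps(2) by blast

lemma rigid_on_line:
  assumes fr: "frame2 r a b" and L: "Z \<union> Y \<subseteq> funvec.span {a, b}" and ZY: "Z \<subseteq> A'" "finite Y" "Y \<subseteq> reps" "card Y = card Z"
    "\<And>f. f \<in> forms r d \<Longrightarrow> (\<Sum>v\<in>Z. \<alpha> v * f v) = (\<Sum>v\<in>Y. c v * f v)"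
  shows "Z = Y"
proof -
  have F: "finite (Z \<union> Y)" "0 \<notin> Z \<union> Y" using ZY A' finite_subset zero_notin_reps by blast+
  obtain \<gamma> where "param_curve r d \<gamma> d" "on_curve \<gamma> (Z \<union> Y)" using line_parametrization[OF fr F(1) L F(2)] by blast
  then show ?thesis by (rule rigid_on_curve[OF _ _ ZY])
qed

lemma \<alpha>_nonzero: "v \<in> A' \<Longrightarrow> \<alpha> v \<noteq> 0"
proof
  assume v: "v \<in> A'" "\<alpha> v = 0"
  have "card {v} \<le> card ({} :: (nat \<Rightarrow> 'a) set)" by (rule le_A[where b = \<alpha>]) (use v in auto)
  then show False by simp
qed

lemma \<beta>_nonzero: "v \<in> B' \<Longrightarrow> \<beta> v \<noteq> 0"
proof
  assume v: "v \<in> B'" "\<beta> v = 0"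
  have "card {v} \<le> card ({} :: (nat \<Rightarrow> 'a) set)" by (rule le_B[where b = \<beta>]) (use v in auto)
  then show False by simp
qed

text \<open>
  The support of the difference of the two formulas.
\<close>

definition W :: "(nat \<Rightarrow> 'a) set" where
  "W = {v \<in> A' \<union> B'. (if v \<in> A' then \<alpha> v else 0) - (if v \<in> B' then \<beta> v else 0) \<noteq> 0}"

lemma forms_eq: "f \<in> forms r d \<Longrightarrow> (\<Sum>v\<in>A'. \<alpha> v * f v) = (\<Sum>v\<in>B'. \<beta> v * f v)"
  using represents_eq[OF A(2) B(2)] A' B' by (simp add: A'_def B'_def)

lemma CB_W: "CB r d W" "W \<noteq> {}" "proj_points r W" "card W < 3 * d"
proof -
  have fin: "finite (A' \<union> B')" using A' B' by simp
  have "(\<Sum>v\<in>A' \<union> B'. ((if v \<in> A' then \<alpha> v else 0) - (if v \<in> B' then \<beta> v else 0)) * f v) = 0" if f: "f \<in> forms r d" for f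
  proof -
    have "(\<Sum>v\<in>A' \<union> B'. ((if v \<in> A' then \<alpha> v else 0) - (if v \<in> B' then \<beta> v else 0)) * f v)
      = (\<Sum>v\<in>A' \<union> B'. if v \<in> A' then \<alpha> v * f v else 0) - (\<Sum>v\<in>A' \<union> B'. if v \<in> B' then \<beta> v * f v else 0)"
      unfolding sum_subtractf[symmetric] by (intro sum.cong) (auto simp: left_diff_distrib)
    also have "\<dots> = (\<Sum>v\<in>(A' \<union> B') \<inter> A'. \<alpha> v * f v) - (\<Sum>v\<in>(A' \<union> B') \<inter> B'. \<beta> v * f v)"
      using sum.inter_restrict[OF fin, of "\<lambda>v. \<alpha> v * f v" A'] sum.inter_restrict[OF fin, of "\<lambda>v. \<beta> v * f v" B'] by simp
    also have "(A' \<union> B') \<inter> A' = A'" by blast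
    also have "(A' \<union> B') \<inter> B' = B'" by blast
    finally show ?thesis using forms_eq[OF f] by simp
  qed
  then show "CB r d W" unfolding W_def by (intro CB_support[OF fin] ballI)
  show "W \<noteq> {}"
  proof
    assume W: "W = {}"
    have "v \<in> A' \<longleftrightarrow> v \<in> B'" for v
    proof (rule ccontr)
      assume "(v \<in> A') \<noteq> (v \<in> B')"
      then have "v \<in> W" using \<alpha>_nonzero[of v] \<beta>_nonzero[of v] by (auto simp: W_def)
      then show False using W by simp
    qed
    then show False using A'_neq_B' by blast
  qed
  have "W \<subseteq> A' \<union> B'" by (auto simp: W_def)
  then have WR: "W \<subseteq> reps" "finite W" using A' B' fin finite_subset by blast+
  then show "proj_points r W" by (intro proj_points_reps)
  have "card W \<le> card (A' \<union> B')" using \<open>W \<subseteq> A' \<union> B'\<close> fin by (rule card_mono[rotated])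
  also have "\<dots> \<le> 2 * t" using card_Un_le[of A' B'] A' B' by simp
  finally show "card W < 3 * d" using small by simp
qed

text \<open>
  Outside \<open>W\<close> the two formulas have the same points and coefficients.
\<close>

lemma restrict:
  assumes Q: "W \<subseteq> Q"
  shows "A' - Q = B' - Q" "f \<in> forms r d \<Longrightarrow> (\<Sum>v\<in>A' \<inter> Q. \<alpha> v * f v) = (\<Sum>v\<in>B' \<inter> Q. \<beta> v * f v)"
proof -
  have in_both: "v \<in> B' \<and> \<alpha> v = \<beta> v" if "v \<in> A' - Q" for v
  proof -
    have "v \<notin> W" using that Q by blast
    then show ?thesis using that \<alpha>_nonzero[of v] by (auto simp: W_def split: if_splits)
  qed
  have in_both': "v \<in> A'" if "v \<in> B' - Q" for v
  proof -
    have "v \<notin> W" using that Q by blast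
    then show ?thesis using that \<beta>_nonzero[of v] by (auto simp: W_def split: if_splits)
  qed
  show eq: "A' - Q = B' - Q" using in_both in_both' by blast
  assume f: "f \<in> forms r d"
  have "(\<Sum>v\<in>A' \<inter> Q. \<alpha> v * f v) + (\<Sum>v\<in>A' - Q. \<alpha> v * f v) = (\<Sum>v\<in>A'. \<alpha> v * f v)"
    using A'(1) by (rule sum.Int_Diff[symmetric])
  also have "\<dots> = (\<Sum>v\<in>B'. \<beta> v * f v)" by (rule forms_eq[OF f])
  also have "\<dots> = (\<Sum>v\<in>B' \<inter> Q. \<beta> v * f v) + (\<Sum>v\<in>B' - Q. \<beta> v * f v)"
    using B'(1) by (rule sum.Int_Diff)
  also have "(\<Sum>v\<in>B' - Q. \<beta> v * f v) = (\<Sum>v\<in>A' - Q. \<alpha> v * f v)"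
    unfolding eq[symmetric] using in_both by (intro sum.cong) auto
  finally show "(\<Sum>v\<in>A' \<inter> Q. \<alpha> v * f v) = (\<Sum>v\<in>B' \<inter> Q. \<beta> v * f v)" by simp
qed

text \<open>
  Minimality, applied to \<open>A\<close> and to \<open>B\<close>, shows that both sets have the same number of points on the
  curve; by rigidity they then agree there, hence everywhere.
\<close>

lemma not_on_curve:
  assumes Q: "W \<subseteq> Q" and curve: "\<And>F. finite F \<Longrightarrow> F \<subseteq> Q \<Longrightarrow> 0 \<notin> F \<Longrightarrow> \<exists>\<gamma>. param_curve r d \<gamma> D \<and> on_curve \<gamma> F"
  shows False
proof -
  define Z where "Z = A' \<inter> Q"
  define Y where "Y = B' \<inter> Q"
  have fin: "finite (Z \<union> Y)" "Z \<union> Y \<subseteq> Q" "0 \<notin> Z \<union> Y" using A' B' zero_notin_reps by (auto simp: Z_def Y_def)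
  obtain \<gamma> where \<gamma>: "param_curve r d \<gamma> D" "on_curve \<gamma> (Z \<union> Y)" using curve[OF fin] by blast
  have ZY: "Z \<subseteq> A'" "finite Z" "Z \<subseteq> reps" "Y \<subseteq> B'" "finite Y" "Y \<subseteq> reps" using A' B' by (auto simp: Z_def Y_def)
  have rel: "(\<Sum>v\<in>Z. \<alpha> v * f v) = (\<Sum>v\<in>Y. \<beta> v * f v)" if "f \<in> forms r d" for f
    unfolding Z_def Y_def by (rule restrict(2)[OF Q that])
  have "card Z \<le> card Y" by (rule le_A[OF ZY(1,5,6) rel])
  moreover have "card Y \<le> card Z" by (rule le_B[OF ZY(4,2,3) rel[symmetric]])
  ultimately have "Z = Y" by (intro rigid_on_curve[OF \<gamma> ZY(1,5,6) _ rel]) auto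
  then have "A' = B'" using restrict(1)[OF Q] unfolding Z_def Y_def by blast
  then show False using A'_neq_B' by blast
qed

lemma not_on_conic: "frame3 r a b c \<Longrightarrow> W \<subseteq> conic a b c \<Longrightarrow> False"
  by (rule not_on_curve[where D = "2 * d"]) (auto intro: conic_parametrization)

lemma not_on_line: "frame2 r a b \<Longrightarrow> W \<subseteq> funvec.span {a, b} \<Longrightarrow> False"
  by (rule not_on_curve[where D = d]) (auto intro: line_parametrization)

text \<open>
  Forms vanishing on the second line see only the first, so the relation restricts to each of the lines.
\<close>

lemma skew_half:
  assumes fr: "frame2 r a b" "frame2 r a' b'" and W: "W \<subseteq> funvec.span {a, b} \<union> funvec.span {a', b'}"
    and skew: "funvec.span {a, b} \<inter> funvec.span {a', b'} \<subseteq> {0}"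
  shows "A' \<inter> funvec.span {a, b} = B' \<inter> funvec.span {a, b}"
proof -
  let ?L = "funvec.span {a, b}" and ?M = "funvec.span {a', b'}"
  have V: "a \<in> vecs r" "b \<in> vecs r" "a' \<in> vecs r" "b' \<in> vecs r" using fr unfolding frame2_def by blast+
  have base: "a \<in> ?L" "b \<in> ?L" "a' \<in> ?M" "b' \<in> ?M" by (auto intro: funvec.span_base)
  obtain k l where kl: "lin r k a = 1" "lin r k b = 0" "lin r l a = 0" "lin r l b = 1"
    using fr(1) unfolding frame2_def by blast
  have out: "x \<notin> funvec.span {y, a', b'}" if "x \<in> ?L" "y \<in> ?L" "x \<notin> funvec.span {y}" for x y
  proof
    assume "x \<in> funvec.span {y, a', b'}"
    then obtain c where c: "x - fscale c y \<in> ?M" unfolding funvec.span_insert[of y] by blast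
    have "x - fscale c y \<in> ?L" using that by (intro funvec.span_diff funvec.span_scale)
    then have "x - fscale c y = 0" using c skew by blast
    then have "x = fscale c y" by simp
    then show False using that(3) unfolding span_single by blast
  qed
  have "a \<notin> funvec.span {b}" using kl unfolding span_single by auto
  then have a: "a \<notin> funvec.span {b, a', b'}" using out[of a b] base by blast
  have "b \<notin> funvec.span {a}" using kl unfolding span_single by auto
  then have b: "b \<notin> funvec.span {a, a', b'}" using out[of b a] base by blast
  have sub: "{b, a', b'} \<subseteq> vecs r" "{a, a', b'} \<subseteq> vecs r" using V by auto
  obtain k where k: "\<forall>s\<in>funvec.span {b, a', b'}. lin r k s = 0" "lin r k a = 1"
    using lin_separates_ex[OF sub(1) V(1) a] by blast
  obtain l where l: "\<forall>s\<in>funvec.span {a, a', b'}. lin r l s = 0" "lin r l b = 1"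
    using lin_separates_ex[OF sub(2) V(2) b] by blast
  have M: "?M \<subseteq> funvec.span {b, a', b'}" "?M \<subseteq> funvec.span {a, a', b'}" by (intro funvec.span_mono; blast)+
  have kz: "lin r k b = 0" "\<forall>x\<in>?M. lin r k x = 0" using k(1) M funvec.span_base[of b "{b, a', b'}"] by auto
  have lz: "lin r l a = 0" "\<forall>x\<in>?M. lin r l x = 0" using l(1) M funvec.span_base[of a "{a, a', b'}"] by auto
  define Z where "Z = A' \<inter> ?L"
  define Y where "Y = B' \<inter> ?L"
  have ZY: "Z \<subseteq> A'" "finite Z" "Z \<subseteq> reps" "Y \<subseteq> B'" "finite Y" "Y \<subseteq> reps" using A' B' by (auto simp: Z_def Y_def)
  have rel: "(\<Sum>v\<in>Z. \<alpha> v * f v) = (\<Sum>v\<in>Y. \<beta> v * f v)" if f: "f \<in> forms r d" for f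
  proof -
    obtain g where g: "g \<in> forms r d" "\<forall>x\<in>?M. g x = 0" "\<forall>x\<in>?L. f x = g x"
      using skew_extension[OF k(2) kz lz(1) l(2) lz(2) f d0] by blast
    have "(\<Sum>v\<in>Z. \<alpha> v * f v) = (\<Sum>v\<in>Z. \<alpha> v * g v)" using g(3) by (intro sum.cong) (auto simp: Z_def)
    also have "\<dots> = (\<Sum>v\<in>A' \<inter> (?L \<union> ?M). \<alpha> v * g v)"
      by (rule sum.mono_neutral_left) (use A' g(2) in \<open>auto simp: Z_def\<close>)
    also have "\<dots> = (\<Sum>v\<in>B' \<inter> (?L \<union> ?M). \<beta> v * g v)" by (rule restrict(2)[OF W g(1)])
    also have "\<dots> = (\<Sum>v\<in>Y. \<beta> v * g v)"
      by (rule sum.mono_neutral_right) (use B' g(2) in \<open>auto simp: Y_def\<close>)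
    also have "\<dots> = (\<Sum>v\<in>Y. \<beta> v * f v)" using g(3) by (intro sum.cong) (auto simp: Y_def)
    finally show ?thesis .
  qed
  have "card Z \<le> card Y" by (rule le_A[OF ZY(1,5,6) rel])
  moreover have "card Y \<le> card Z" by (rule le_B[OF ZY(4,2,3) rel[symmetric]])
  moreover have "Z \<union> Y \<subseteq> ?L" by (auto simp: Z_def Y_def)
  ultimately have "Z = Y" by (intro rigid_on_line[OF fr(1) _ ZY(1,5,6) _ rel]) auto
  then show ?thesis by (simp add: Z_def Y_def)
qed

lemma not_on_skew_lines:
  assumes fr: "frame2 r a b" "frame2 r a' b'" and W: "W \<subseteq> funvec.span {a, b} \<union> funvec.span {a', b'}"
    and skew: "funvec.span {a, b} \<inter> funvec.span {a', b'} \<subseteq> {0}"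
  shows False
proof -
  have "A' \<inter> funvec.span {a, b} = B' \<inter> funvec.span {a, b}" by (rule skew_half[OF fr W skew])
  moreover have "A' \<inter> funvec.span {a', b'} = B' \<inter> funvec.span {a', b'}"
    by (rule skew_half[OF fr(2,1)]) (use W skew in blast)+
  ultimately have "A' = B'" using restrict(1)[OF W] by blast
  then show False using A'_neq_B' by blast
qed

text \<open>
  Testing with forms that vanish on the second line shows that the functionals of \<open>A\<close> and \<open>B\<close> on the first
  line, without the node, differ by a multiple \<open>\<mu>\<close> of the evaluation at the node. Adding the node to
  one or both of the point sets gives various pairs of decompositions of the same functional. By
  minimality the set from \<open>A\<close> is never the larger one, and by rigidity sets of equal size coincide. All
  the restrictions listed are instances of this.
\<close>

lemma node_half:
  assumes fr: "frame3 r p1 p2 o'" and o': "o' \<in> reps"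
    and W: "W \<subseteq> funvec.span {p1, o'} \<union> funvec.span {p2, o'}"
  defines "A1 \<equiv> A' \<inter> funvec.span {p1, o'} - {o'}" and "B1 \<equiv> B' \<inter> funvec.span {p1, o'} - {o'}"
  shows "\<exists>\<mu>. (\<forall>f\<in>forms r d. (\<Sum>v\<in>A1. \<alpha> v * f v) = (\<Sum>v\<in>B1. \<beta> v * f v) + \<mu> * f o') \<and>
    card A1 \<le> card B1 \<and> (o' \<in> A' \<longrightarrow> card A1 = card B1 \<longrightarrow> A1 = B1 \<and> \<mu> = 0) \<and>
    (o' \<in> A' \<longrightarrow> \<alpha> o' + \<mu> = 0 \<longrightarrow> card B1 \<noteq> card A1 + 1)"
proof -
  let ?L = "funvec.span {p1, o'}" and ?M = "funvec.span {p2, o'}"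
  obtain k1 k2 k where k: "lin r k1 p1 = 1" "lin r k1 p2 = 0" "lin r k1 o' = 0"
      "lin r k2 p1 = 0" "lin r k2 p2 = 1" "lin r k2 o' = 0" "lin r k p1 = 0" "lin r k p2 = 0" "lin r k o' = 1"
    and V: "p1 \<in> vecs r" "o' \<in> vecs r"
    using fr unfolding frame3_def by blast
  have fr2: "frame2 r p1 o'" unfolding frame2_def using k V by blast
  have base: "o' \<in> ?L" "o' \<in> ?M" by (auto intro: funvec.span_base)
  have AB: "A1 \<subseteq> A'" "finite A1" "A1 \<subseteq> reps" "o' \<notin> A1" "A1 \<subseteq> ?L" "B1 \<subseteq> B'" "finite B1" "B1 \<subseteq> reps" "o' \<notin> B1" "B1 \<subseteq> ?L"
    using A' B' by (auto simp: A1_def B1_def)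
  have vanish: "(\<Sum>v\<in>A1. \<alpha> v * g v) = (\<Sum>v\<in>B1. \<beta> v * g v)" if g: "g \<in> forms r d" "\<forall>x\<in>?M. g x = 0" for g
  proof -
    have "(\<Sum>v\<in>A1. \<alpha> v * g v) = (\<Sum>v\<in>A' \<inter> (?L \<union> ?M). \<alpha> v * g v)"
      by (rule sum.mono_neutral_left) (use A' g(2) base in \<open>auto simp: A1_def\<close>)
    also have "\<dots> = (\<Sum>v\<in>B' \<inter> (?L \<union> ?M). \<beta> v * g v)" by (rule restrict(2)[OF W g(1)])
    also have "\<dots> = (\<Sum>v\<in>B1. \<beta> v * g v)"
      by (rule sum.mono_neutral_right) (use B' g(2) base in \<open>auto simp: B1_def\<close>)
    finally show ?thesis .
  qed
  define \<mu> where "\<mu> = (\<Sum>v\<in>A1. \<alpha> v * lin r k v ^ d) - (\<Sum>v\<in>B1. \<beta> v * lin r k v ^ d)"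
  have rel: "(\<Sum>v\<in>A1. \<alpha> v * f v) = (\<Sum>v\<in>B1. \<beta> v * f v) + \<mu> * f o'" if f: "f \<in> forms r d" for f
  proof -
    obtain g where g: "g \<in> forms r d" "\<forall>x\<in>?M. g x = 0" "\<forall>x\<in>?L. f x = g x + f o' * lin r k x ^ d"
      using node_split[OF k(1-3,7-9) f] by blast
    have expand: "(\<Sum>v\<in>S. c v * f v) = (\<Sum>v\<in>S. c v * g v) + f o' * (\<Sum>v\<in>S. c v * lin r k v ^ d)" if "S \<subseteq> ?L" for S c
      unfolding sum_distrib_left sum.distrib[symmetric]
      using g(3) that by (intro sum.cong refl) (auto simp: algebra_simps dest!: subsetD)
    show ?thesis unfolding expand[OF AB(5)] expand[OF AB(10)] vanish[OF g(1,2)] \<mu>_def by (simp add: algebra_simps)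
  qed
  define b where "b s v = (if v = o' then s else \<beta> v)" for s v
  have b_sum: "(\<Sum>v\<in>insert o' B1. b s v * f v) = (\<Sum>v\<in>B1. \<beta> v * f v) + s * f o'" for s f
  proof -
    have "(\<Sum>v\<in>B1. b s v * f v) = (\<Sum>v\<in>B1. \<beta> v * f v)" using AB(9) by (intro sum.cong) (auto simp: b_def)
    then show ?thesis using AB(7,9) by (simp add: b_def)
  qed
  have a_sum: "(\<Sum>v\<in>insert o' A1. \<alpha> v * f v) = (\<Sum>v\<in>A1. \<alpha> v * f v) + \<alpha> o' * f o'" for f
    using AB(2,4) by simp
  have le: "card A1 \<le> card B1"
  proof -
    have rel': "(\<Sum>v\<in>A1. \<alpha> v * f v) = (\<Sum>v\<in>insert o' B1. b \<mu> v * f v)" if "f \<in> forms r d" for f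
      unfolding b_sum by (rule rel[OF that])
    have Y: "finite (insert o' B1)" "insert o' B1 \<subseteq> reps" "A1 \<union> insert o' B1 \<subseteq> ?L" using AB o' base by auto
    have "card A1 \<le> card (insert o' B1)" by (rule le_A[OF AB(1) Y(1,2) rel'])
    moreover have "card A1 \<noteq> card (insert o' B1)"
    proof
      assume c: "card A1 = card (insert o' B1)"
      have "A1 = insert o' B1" by (rule rigid_on_line[OF fr2 Y(3) AB(1) Y(1,2) c[symmetric] rel'])
      then show False using AB(4) by blast
    qed
    ultimately show ?thesis using AB by simp
  qed
  have eq: "A1 = B1 \<and> \<mu> = 0" if oA: "o' \<in> A'" and c: "card A1 = card B1"
  proof -
    have oA1: "insert o' A1 \<subseteq> A'" using oA AB by simp
    have rel': "(\<Sum>v\<in>insert o' A1. \<alpha> v * f v) = (\<Sum>v\<in>insert o' B1. b (\<alpha> o' + \<mu>) v * f v)" if "f \<in> forms r d" for f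
      unfolding b_sum a_sum rel[OF that] by (simp add: algebra_simps)
    have Y: "finite (insert o' B1)" "insert o' B1 \<subseteq> reps" "insert o' A1 \<union> insert o' B1 \<subseteq> ?L" using AB o' base by auto
    have "insert o' A1 = insert o' B1"
      by (rule rigid_on_line[OF fr2 Y(3) oA1 Y(1,2) _ rel']) (use AB c in simp)
    then have e: "A1 = B1" using insert_ident[OF AB(4,9)] by blast
    have "\<mu> = 0"
    proof (rule ccontr)
      assume nz: "\<mu> \<noteq> 0"
      have "card (insert o' A1) \<le> card A1"
      proof (rule le_A[OF oA1 AB(2,3), where b = "\<lambda>v. \<alpha> v + \<alpha> o' / \<mu> * (\<alpha> v - \<beta> v)"])
        fix f :: "(nat \<Rightarrow> 'a) \<Rightarrow> 'a" assume f: "f \<in> forms r d"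
        have "(\<Sum>v\<in>A1. (\<alpha> v + \<alpha> o' / \<mu> * (\<alpha> v - \<beta> v)) * f v)
          = (\<Sum>v\<in>A1. \<alpha> v * f v) + \<alpha> o' / \<mu> * ((\<Sum>v\<in>A1. \<alpha> v * f v) - (\<Sum>v\<in>A1. \<beta> v * f v))"
          by (simp add: sum_distrib_left sum.distrib sum_subtractf algebra_simps)
        also have "(\<Sum>v\<in>A1. \<alpha> v * f v) - (\<Sum>v\<in>A1. \<beta> v * f v) = \<mu> * f o'" using rel[OF f] e by simp
        also have "\<alpha> o' / \<mu> * (\<mu> * f o') = \<alpha> o' * f o'" using nz by simp
        finally show "(\<Sum>v\<in>insert o' A1. \<alpha> v * f v) = (\<Sum>v\<in>A1. (\<alpha> v + \<alpha> o' / \<mu> * (\<alpha> v - \<beta> v)) * f v)"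
          unfolding a_sum by simp
      qed
      then show False using AB by simp
    qed
    then show ?thesis using e by blast
  qed
  \<comment> \<open>here \<open>B1\<close> alone represents the functional of \<open>A1\<close> together with the node\<close>
  have last: "card B1 \<noteq> card A1 + 1" if oA: "o' \<in> A'" and z: "\<alpha> o' + \<mu> = 0"
  proof
    assume c: "card B1 = card A1 + 1"
    have oA1: "insert o' A1 \<subseteq> A'" using oA AB by simp
    have L: "insert o' A1 \<union> B1 \<subseteq> ?L" using AB base by auto
    have "insert o' A1 = B1"
    proof (rule rigid_on_line[OF fr2 L oA1 AB(7,8)])
      show "card B1 = card (insert o' A1)" using c AB by simp
      fix f :: "(nat \<Rightarrow> 'a) \<Rightarrow> 'a" assume f: "f \<in> forms r d"
      have "(\<Sum>v\<in>insert o' A1. \<alpha> v * f v) = (\<Sum>v\<in>B1. \<beta> v * f v) + (\<alpha> o' + \<mu>) * f o'"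
        unfolding a_sum rel[OF f] by (simp add: algebra_simps)
      then show "(\<Sum>v\<in>insert o' A1. \<alpha> v * f v) = (\<Sum>v\<in>B1. \<beta> v * f v)" using z by simp
    qed
    then show False using AB(9) by blast
  qed
  show ?thesis
    by (rule exI[of _ \<mu>]) (intro conjI ballI impI; (rule rel le conjunct1[OF eq] conjunct2[OF eq] last; assumption))
qed

text \<open>
  The restrictions from \<open>node_half\<close> leave only the case that neither set contains the node and both have
  the same number of points on each line. There the defects at the node are opposite, and moving both
  pencils simultaneously contradicts rigidity.
\<close>

lemma not_on_node:
  assumes fr: "frame3 r p1 p2 o'" and o': "o' \<in> reps"
    and W: "W \<subseteq> funvec.span {p1, o'} \<union> funvec.span {p2, o'}"
  shows False
proof -
  let ?L = "funvec.span {p1, o'}" and ?M = "funvec.span {p2, o'}"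
  obtain k1 k2 k where k: "lin r k1 p1 = 1" "lin r k1 p2 = 0" "lin r k1 o' = 0"
      "lin r k2 p1 = 0" "lin r k2 p2 = 1" "lin r k2 o' = 0" "lin r k p1 = 0" "lin r k p2 = 0" "lin r k o' = 1"
    and V: "p1 \<in> vecs r" "p2 \<in> vecs r" "o' \<in> vecs r"
    using fr unfolding frame3_def by blast
  have fr': "frame3 r p2 p1 o'" unfolding frame3_def using k V by blast
  have W': "W \<subseteq> ?M \<union> ?L" using W by blast
  define A1 where "A1 = A' \<inter> ?L - {o'}"
  define B1 where "B1 = B' \<inter> ?L - {o'}"
  define A2 where "A2 = A' \<inter> ?M - {o'}"
  define B2 where "B2 = B' \<inter> ?M - {o'}"
  obtain \<mu>1 where h1: "\<And>f. f \<in> forms r d \<Longrightarrow> (\<Sum>v\<in>A1. \<alpha> v * f v) = (\<Sum>v\<in>B1. \<beta> v * f v) + \<mu>1 * f o'"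
    "card A1 \<le> card B1" "o' \<in> A' \<Longrightarrow> card A1 = card B1 \<Longrightarrow> A1 = B1 \<and> \<mu>1 = 0"
    "o' \<in> A' \<Longrightarrow> \<alpha> o' + \<mu>1 = 0 \<Longrightarrow> card B1 \<noteq> card A1 + 1"
    using node_half[OF fr o' W, folded A1_def B1_def] by blast
  obtain \<mu>2 where h2: "\<And>f. f \<in> forms r d \<Longrightarrow> (\<Sum>v\<in>A2. \<alpha> v * f v) = (\<Sum>v\<in>B2. \<beta> v * f v) + \<mu>2 * f o'"
    "card A2 \<le> card B2" "o' \<in> A' \<Longrightarrow> card A2 = card B2 \<Longrightarrow> A2 = B2 \<and> \<mu>2 = 0"
    "o' \<in> A' \<Longrightarrow> \<alpha> o' + \<mu>2 = 0 \<Longrightarrow> card B2 \<noteq> card A2 + 1"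
    using node_half[OF fr' o' W', folded A2_def B2_def] by blast
  have only: "v = o'" if v: "v \<in> reps" "v \<in> ?L" "v \<in> ?M" for v
  proof -
    obtain a b c e where ab: "v = fscale a p1 + fscale b o'" and ce: "v = fscale c p2 + fscale e o'"
      using v(2,3) unfolding span_pair by blast
    have "a = lin r k1 v" unfolding ab by (simp add: k)
    also have "\<dots> = 0" unfolding ce by (simp add: k)
    finally have "v = fscale b o'" using ab by simp
    then have "v \<in> funvec.span {o'}" unfolding span_single by blast
    then show ?thesis using reps(3)[OF o' v(1)] by simp
  qed
  have base: "o' \<in> ?L" "o' \<in> ?M" by (auto intro: funvec.span_base)
  have fin: "finite A1" "finite A2" "finite B1" "finite B2" using A' B' by (auto simp: A1_def A2_def B1_def B2_def)
  have disj: "A1 \<inter> A2 = {}" "B1 \<inter> B2 = {}" using only A'(3) B'(3) by (auto simp: A1_def A2_def B1_def B2_def)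
  have A_split: "A' \<inter> (?L \<union> ?M) = A1 \<union> A2 \<union> (A' \<inter> {o'})" and B_split: "B' \<inter> (?L \<union> ?M) = B1 \<union> B2 \<union> (B' \<inter> {o'})"
    using base by (auto simp: A1_def A2_def B1_def B2_def)
  have o_out: "(A1 \<union> A2) \<inter> (A' \<inter> {o'}) = {}" "(B1 \<union> B2) \<inter> (B' \<inter> {o'}) = {}" by (auto simp: A1_def A2_def B1_def B2_def)
  have equal: False if "A1 = B1" "A2 = B2" "o' \<in> A' \<longleftrightarrow> o' \<in> B'"
  proof -
    have "A' \<inter> (?L \<union> ?M) = B' \<inter> (?L \<union> ?M)" unfolding A_split B_split using that by auto
    then have "A' = B'" using restrict(1)[OF W] by blast
    then show False using A'_neq_B' by blast
  qed
  have cards: "card A1 + card A2 + card (A' \<inter> {o'}) = card B1 + card B2 + card (B' \<inter> {o'})"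
  proof -
    have "card (A' \<inter> (?L \<union> ?M)) = card (B' \<inter> (?L \<union> ?M))"
    proof -
      have "card (A' \<inter> (?L \<union> ?M)) + card (A' - (?L \<union> ?M)) = t" using card_Int_Diff[OF A'(1), of "?L \<union> ?M"] A'(2) by simp
      moreover have "card (B' \<inter> (?L \<union> ?M)) + card (B' - (?L \<union> ?M)) = t" using card_Int_Diff[OF B'(1), of "?L \<union> ?M"] B'(2) by simp
      ultimately show ?thesis using restrict(1)[OF W] by simp
    qed
    then show ?thesis unfolding A_split B_split using fin disj o_out by (simp add: card_Un_disjoint)
  qed
  define a0 where "a0 = (if o' \<in> A' then \<alpha> o' else 0)"
  define b0 where "b0 = (if o' \<in> B' then \<beta> o' else 0)"
  \<comment> \<open>compare the two formulas on a form that is \<open>1\<close> at the node and \<open>0\<close> at \<open>p1\<close> and \<open>p2\<close>, both sides restricted to the two lines\<close>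
  have balance: "a0 + \<mu>1 + \<mu>2 = b0"
  proof -
    let ?E = "\<lambda>v. lin r k v ^ d"
    have E: "?E \<in> forms r d" by (rule forms_lin_power)
    have "(\<Sum>v\<in>A' \<inter> (?L \<union> ?M). \<alpha> v * ?E v) = (\<Sum>v\<in>A1. \<alpha> v * ?E v) + (\<Sum>v\<in>A2. \<alpha> v * ?E v) + (\<Sum>v\<in>A' \<inter> {o'}. \<alpha> v * ?E v)"
      unfolding A_split using fin disj o_out by (simp add: sum.union_disjoint)
    also have "(\<Sum>v\<in>A' \<inter> {o'}. \<alpha> v * ?E v) = a0" by (simp add: a0_def k)
    finally have 1: "(\<Sum>v\<in>A' \<inter> (?L \<union> ?M). \<alpha> v * ?E v) = (\<Sum>v\<in>A1. \<alpha> v * ?E v) + (\<Sum>v\<in>A2. \<alpha> v * ?E v) + a0" .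
    have "(\<Sum>v\<in>B' \<inter> (?L \<union> ?M). \<beta> v * ?E v) = (\<Sum>v\<in>B1. \<beta> v * ?E v) + (\<Sum>v\<in>B2. \<beta> v * ?E v) + (\<Sum>v\<in>B' \<inter> {o'}. \<beta> v * ?E v)"
      unfolding B_split using fin disj o_out by (simp add: sum.union_disjoint)
    also have "(\<Sum>v\<in>B' \<inter> {o'}. \<beta> v * ?E v) = b0" by (simp add: b0_def k)
    finally have 2: "(\<Sum>v\<in>B' \<inter> (?L \<union> ?M). \<beta> v * ?E v) = (\<Sum>v\<in>B1. \<beta> v * ?E v) + (\<Sum>v\<in>B2. \<beta> v * ?E v) + b0" .
    show ?thesis using restrict(2)[OF W E] h1(1)[OF E] h2(1)[OF E] unfolding 1 2 by (simp add: k algebra_simps)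
  qed
  show False
  proof (cases "o' \<in> A'")
    case oA: True
    show False
    proof (cases "o' \<in> B'")
      case True
      then have "card A1 + card A2 = card B1 + card B2" using cards oA by simp
      then have "card A1 = card B1" "card A2 = card B2" using h1(2) h2(2) by linarith+
      then show False using equal h1(3)[OF oA] h2(3)[OF oA] oA True by blast
    next
      case False
      then have "card A1 + card A2 + 1 = card B1 + card B2" using cards oA by simp
      then consider "card A1 = card B1" "card B2 = card A2 + 1" | "card A2 = card B2" "card B1 = card A1 + 1"
        using h1(2) h2(2) by linarith
      then show False
      proof cases
        case 1
        then have "\<mu>1 = 0" using h1(3)[OF oA] by blast
        then show False using balance h2(4)[OF oA] 1 oA False by (simp add: a0_def b0_def)
      next
        case 2
        then have "\<mu>2 = 0" using h2(3)[OF oA] by blast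
        then show False using balance h1(4)[OF oA] 2 oA False by (simp add: a0_def b0_def)
      qed
    qed
  next
    case oA: False
    show False
    proof (cases "o' \<in> B'")
      case True
      then show False using cards oA h1(2) h2(2) by simp
    next
      case oB: False
      have c: "card B1 = card A1" "card B2 = card A2" using cards oA oB h1(2) h2(2) by simp_all
      have mu: "\<mu>2 = - \<mu>1" using balance oA oB by (simp add: a0_def b0_def eq_neg_iff_add_eq_0 add.commute)
      have "frame2 r p1 o'" "frame2 r p2 o'" unfolding frame2_def using k V by blast+
      note \<gamma> = param_curve_line[OF this(1), of d] param_curve_line[OF this(2), of d]
      have coeff: "coeff q d = f o'" if fq: "f \<in> forms r d" "\<forall>x. f (p' + fscale x o') = poly q x" for f q p'
      proof -
        obtain q' where "coeff q' d = f o'" "\<forall>x. f (p' + fscale x o') = poly q' x" using line_pullback[OF fq(1)] by blast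
        moreover from this(2) fq(2) have "q = q'" by (simp add: poly_eq_poly_eq_iff[symmetric] fun_eq_iff)
        ultimately show ?thesis by simp
      qed
      have on: "on_curve (\<lambda>x. p' + fscale x o') S" if S: "S \<subseteq> reps" "S \<subseteq> funvec.span {p', o'}" "o' \<notin> S" for S p'
        unfolding on_curve_def
      proof
        fix v assume v: "v \<in> S"
        have "v \<in> funvec.span {p', o'}" using S(2) v by blast
        then obtain a b where ab: "v = fscale a p' + fscale b o'" unfolding span_pair by blast
        have "a \<noteq> 0"
        proof
          assume "a = 0"
          then have "v \<in> funvec.span {o'}" using ab unfolding span_single by auto
          then have "o' = v" using reps(3)[OF o'] v S(1) by blast
          then show False using v S(3) by blast
        qed
        then have "v = fscale a (p' + fscale (b / a) o')" unfolding ab by (simp add: funvec.scale_right_distrib)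
        then show "\<exists>c x. c \<noteq> 0 \<and> v = fscale c (p' + fscale x o')" using \<open>a \<noteq> 0\<close> by blast
      qed
      have "infinite (rank_sets r d P) \<and> \<not> isolated_rank_set r d P A"
      proof (rule pencil_move[OF A \<gamma>])
        show "A1 \<subseteq> rep ` A" "A2 \<subseteq> rep ` A" by (auto simp: A1_def A2_def A'_def)
        show "A1 \<inter> A2 = {}" by (rule disj)
        show "finite B1" "finite B2" by (rule fin)+
        show "B1 \<subseteq> reps" "B2 \<subseteq> reps" using B'(3) by (auto simp: B1_def B2_def)
        show "card B1 = card A1" "card B2 = card A2" by (rule c)+
        show "on_curve (\<lambda>x. p1 + fscale x o') (A1 \<union> B1)"
          by (rule on) (use A' B' in \<open>auto simp: A1_def B1_def\<close>)
        show "on_curve (\<lambda>x. p2 + fscale x o') (A2 \<union> B2)"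
          by (rule on) (use A' B' in \<open>auto simp: A2_def B2_def\<close>)
        show "A1 \<noteq> B1 \<or> A2 \<noteq> B2" using equal oA oB by blast
        show "(\<Sum>v\<in>A1. \<alpha> v * f v) = (\<Sum>v\<in>B1. \<beta> v * f v) + \<mu>1 * coeff q d"
          if "f \<in> forms r d" "\<forall>x. f (p1 + fscale x o') = poly q x" for f q
          using h1(1)[OF that(1)] coeff[OF that] by simp
        show "(\<Sum>v\<in>A2. \<alpha> v * f v) = (\<Sum>v\<in>B2. \<beta> v * f v) + - \<mu>1 * coeff q d"
          if "f \<in> forms r d" "\<forall>x. f (p2 + fscale x o') = poly q x" for f q
          using h2(1)[OF that(1)] coeff[OF that] mu by simp
        show "\<mu>1 * coeff q1 d = \<mu>1 * coeff q2 d"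
          if "f \<in> forms r d" "\<forall>x. f (p1 + fscale x o') = poly q1 x" "\<forall>x. f (p2 + fscale x o') = poly q2 x" for f q1 q2
          using coeff[OF that(1,2)] coeff[OF that(1,3)] by simp
      qed
      then show False using rigid by blast
    qed
  qed
qed

lemma not_on_two_lines:
  assumes fr: "frame2 r a b" "frame2 r a' b'" and W: "W \<subseteq> funvec.span {a, b} \<union> funvec.span {a', b'}"
  shows False
proof (cases "funvec.span {a, b} \<inter> funvec.span {a', b'} \<subseteq> {0}")
  case True then show False by (rule not_on_skew_lines[OF fr W])
next
  case False
  then obtain v where v: "v \<in> funvec.span {a, b}" "v \<in> funvec.span {a', b'}" "v \<noteq> 0" by blast
  have "{a, b} \<subseteq> vecs r" using fr unfolding frame2_def by blast
  then have "v \<in> vecs r" using v(1) funvec.span_minimal[OF _ vecs_subspace] by blast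
  then have sv: "funvec.span {v} \<in> proj_space {..r}" using v(3) by (rule span_in_proj_space)
  define o' where "o' = rep (funvec.span {v})"
  have o': "o' \<in> reps" "o' \<noteq> 0" "o' \<in> vecs r" using sv rep[OF sv] by (auto simp: o'_def reps_def)
  have "funvec.span {o'} = funvec.span {v}" using rep(2)[OF sv] by (simp add: o'_def)
  then have "o' \<in> funvec.span {v}" using funvec.span_base[of o' "{o'}"] by auto
  then have o_in: "o' \<in> funvec.span {x, y}" if "v \<in> funvec.span {x, y}" for x y
    using that unfolding span_single by (auto intro: funvec.span_scale)
  have other: "\<exists>q\<in>vecs r. q \<notin> funvec.span {o'} \<and> funvec.span {x, y} \<subseteq> funvec.span {q, o'}"
    if f: "frame2 r x y" and "v \<in> funvec.span {x, y}" for x y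
  proof -
    have "x \<notin> funvec.span {o'} \<or> y \<notin> funvec.span {o'}"
    proof (rule ccontr)
      assume "\<not> ?thesis"
      then obtain s u where su: "x = fscale s o'" "y = fscale u o'" unfolding span_single by blast
      obtain k l where "lin r k x = 1" "lin r k y = 0" "lin r l y = 1" using f unfolding frame2_def by blast
      then show False unfolding su by auto
    qed
    then obtain q where q: "q \<in> {x, y}" "q \<notin> funvec.span {o'}" by blast
    have "q \<in> funvec.span {x, y}" using q(1) by (rule funvec.span_base)
    then have "funvec.span {x, y} \<subseteq> funvec.span {o', q}"
      by (rule span_pair_exchange[OF o_in[OF that(2)] _ o'(2) q(2)])
    moreover have "q \<in> vecs r" using q(1) f unfolding frame2_def by blast
    ultimately show ?thesis
      using q(2) by (intro bexI[of _ q] conjI) (simp_all only: insert_commute[of q o' "{}"] simp_thms)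
  qed
  obtain p1 where p1: "p1 \<in> vecs r" "p1 \<notin> funvec.span {o'}" "funvec.span {a, b} \<subseteq> funvec.span {p1, o'}"
    using other[OF fr(1) v(1)] by blast
  obtain p2 where p2: "p2 \<in> vecs r" "p2 \<notin> funvec.span {o'}" "funvec.span {a', b'} \<subseteq> funvec.span {p2, o'}"
    using other[OF fr(2) v(2)] by blast
  have o_out: "o' \<notin> funvec.span {q}" if "q \<notin> funvec.span {o'}" for q
  proof
    assume "o' \<in> funvec.span {q}"
    then have "funvec.span {o'} = funvec.span {q}" using o'(2) by (rule span_single_eq)
    then show False using that funvec.span_base[of q "{q}"] by simp
  qed
  have W12: "W \<subseteq> funvec.span {p1, o'} \<union> funvec.span {p2, o'}" using W p1(3) p2(3) by blast
  show False
  proof (cases "p2 \<in> funvec.span {p1, o'}")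
    case True
    have "o' \<in> funvec.span {p1, o'}" by (rule funvec.span_base) simp
    then have "funvec.span {p2, o'} \<subseteq> funvec.span {p1, o'}"
      using True by (intro funvec.span_minimal funvec.subspace_span) auto
    then have "W \<subseteq> funvec.span {p1, o'}" using W12 by blast
    moreover have "frame2 r p1 o'" by (rule frame2I[OF p1(1) o'(3) p1(2) o_out[OF p1(2)]])
    ultimately show False using not_on_line by blast
  next
    case False
    have "p1 \<notin> funvec.span {p2, o'}"
    proof
      assume "p1 \<in> funvec.span {p2, o'}"
      moreover have "o' \<in> funvec.span {p2, o'}" by (rule funvec.span_base) simp
      ultimately have "funvec.span {p2, o'} \<subseteq> funvec.span {o', p1}"
        by (intro span_pair_exchange[OF _ _ o'(2) p1(2)])
      then show False using False funvec.span_base[of p2 "{p2, o'}"] by (auto simp: insert_commute)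
    qed
    moreover have "o' \<notin> funvec.span {p1, p2}"
    proof
      assume "o' \<in> funvec.span {p1, p2}"
      moreover have "p1 \<in> funvec.span {p1, p2}" by (rule funvec.span_base) simp
      moreover have "p1 \<noteq> 0" using p1(2) funvec.span_zero[of "{o'}"] by blast
      ultimately have "funvec.span {p1, p2} \<subseteq> funvec.span {p1, o'}"
        by (intro span_pair_exchange[OF _ _ _ o_out[OF p1(2)]])
      then show False using False funvec.span_base[of p2 "{p1, p2}"] by auto
    qed
    ultimately have "frame3 r p1 p2 o'" using False by (intro frame3I p1 p2 o')
    then show False using not_on_node o'(1) W12 by blast
  qed
qed

lemma contradiction: False
  using CB_two_lines_or_conic[OF CB_W(3,1,2,4)]
proof
  assume "two_lines r W"
  then show False unfolding two_lines_def using not_on_two_lines by blast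
next
  assume "on_conic r W"
  then show False unfolding on_conic_def using not_on_conic by blast
qed

end

theorem theorem1:
  fixes r d t :: nat
    and P :: "((nat \<Rightarrow>\<^sub>0 nat) \<Rightarrow> 'a::{alg_closed_field, field_char_0}) set"
  assumes "r \<ge> 2" and "d \<ge> 1"
    and "t > 0" and "real t < 3 * real d / 2"
    and "P \<in> proj_space (monomials r d)"
    and "symmetric_rank r d P = t"
    and "\<exists>A B. A \<in> rank_sets r d P \<and> B \<in> rank_sets r d P \<and> A \<noteq> B"
  shows "infinite (rank_sets r d P) \<and> \<not> (\<exists>Z. isolated_rank_set r d P Z)"
proof -
  obtain p where p: "P = funvec.span {p}" using assms(5) unfolding proj_space_def by blast
  interpret rank_context r d t p
    by standard (use assms p in auto)
  have move: "infinite (rank_sets r d P) \<and> \<not> isolated_rank_set r d P Z"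
    if Z: "Z \<in> rank_sets r d P" "Y \<in> rank_sets r d P" "Z \<noteq> Y" for Z Y
  proof (rule ccontr)
    assume n: "\<not> ?thesis"
    obtain \<alpha> where \<alpha>: "represents (rep ` Z) (\<lambda>v. v) \<alpha>" using represents_reps(1)[OF Z(1)[unfolded p]] by blast
    obtain \<beta> where \<beta>: "represents (rep ` Y) (\<lambda>v. v) \<beta>" using represents_reps(1)[OF Z(2)[unfolded p]] by blast
    interpret rigid_pair r d t p Z Y \<alpha> \<beta>
      by standard (use Z \<alpha> \<beta> n assms(4) in \<open>auto simp: p\<close>)
    show False by (rule contradiction)
  qed
  obtain A B where AB: "A \<in> rank_sets r d P" "B \<in> rank_sets r d P" "A \<noteq> B" using assms(7) by blast
  have "\<not> isolated_rank_set r d P Z" for Z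
  proof
    assume iso: "isolated_rank_set r d P Z"
    then have Z: "Z \<in> rank_sets r d P" by (simp add: isolated_rank_set_def)
    then show False using move[OF Z AB(1)] move[OF Z AB(2)] AB(3) iso by blast
  qed
  then show ?thesis using move[OF AB] by blast
qed

end
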